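(* Let $M\ge1$ be an integer, $N\ge0$ a real number, $\tau,\tau'\ge0$, and let $\mathcal A_\tau$ denote the single-mode quantum-limited amplifier channel of gain $G=\cosh^2\tau$. Put $\nu=\mathrm{sech}(\tau'-\tau)$ and $\{N\}=N-\lfloor N\rfloor$. The minimum of the output fidelity $$\mathcal F\bigl((\mathrm{id}_A\otimes\mathcal A_\tau^{\otimes M})(\rho_{AS}),\,(\mathrm{id}_A\otimes\mathcal A_{\tau'}^{\otimes M})(\rho_{AS})\bigr)$$ over all states $\rho_{AS}$ of $M$ signal modes $S$ and an arbitrary ancilla $A$ with average total signal photon number $\mathrm{Tr}[\rho_{AS}(\mathbb I_A\otimes\hat N_S)]=N$ equals $$\mathcal F^{\min}=\nu^M\Bigl[(1-\{N\})\,\nu^{\lfloor N\rfloor}+\{N\}\,\nu^{\lceil N\rceil}\Bigr].$$ Consequently the energy-constrained Bures distance is $B_N(\mathcal A_\tau^{\otimes M},\mathcal A_{\tau'}^{\otimes M})=\sqrt{1-\mathcal F^{\min}}$.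
   Context: Fidelity is $\mathcal F(\rho,\sigma)=\mathrm{Tr}\sqrt{\sqrt\rho\,\sigma\sqrt\rho}$. $\hat N_S=\sum_{m=1}^M\hat a_m^\dagger\hat a_m$ is the total photon number operator on $S$. The quantum-limited amplifier of gain $G=\cosh^2\tau$ maps a mode as $\hat a_{out}=\sqrt G\,\hat a_{in}+\sqrt{G-1}\,\hat e_{in}^\dagger$ with $\hat e_{in}$ a vacuum environment mode (environment output traced out); equivalently it is implemented by a unitary with $\hat U(\tau)|n\rangle_S|0\rangle_E=\mathrm{sech}^{\,n+1}\tau\sum_{a\ge0}\sqrt{\binom{n+a}{a}}\tanh^a\tau|n+a\rangle_S|a\rangle_E$. The energy-constrained Bures distance is $B_N(\mathcal A_\tau^{\otimes M},\mathcal A_{\tau'}^{\otimes M})=\sup_{\rho_{AS}}\sqrt{1-\mathcal F((\mathrm{id}_A\otimes\mathcal A_\tau^{\otimes M})(\rho_{AS}),(\mathrm{id}_A\otimes\mathcal A_{\tau'}^{\otimes M})(\rho_{AS}))}$, the supremum being over all states with $\mathrm{Tr}[\rho_{AS}(\mathbb I_A\otimes\hat N_S)]=N$. *)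

theory Defs
  imports "HOL-Analysis.Analysis" "HOL-Library.Infinite_Typeclass"
begin

section \<open>Operators on \<open>\<ell>\<^sup>2(I)\<close>\<close>

text \<open>
  A Hilbert space with an orthonormal basis labelled by a set \<open>I\<close> is identified with
  \<open>\<ell>\<^sup>2(I)\<close>, and an operator \<open>A\<close> with its matrix elements \<open>A i j = \<langle>i|A|j\<rangle>\<close>. Operators on
  \<open>\<ell>\<^sup>2(I)\<close> are extended by zero outside \<open>I \<times> I\<close>, so that equality of operators is equality of
  functions.
\<close>

type_synonym ('i, 'j) kernel = "'i \<Rightarrow> 'j \<Rightarrow> complex"

definition ell2 :: "'i set \<Rightarrow> ('i \<Rightarrow> complex) set" where
  "ell2 I = {\<psi>. (\<lambda>i. (cmod (\<psi> i))\<^sup>2) summable_on I}"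

definition inner_on :: "'i set \<Rightarrow> ('i \<Rightarrow> complex) \<Rightarrow> ('i \<Rightarrow> complex) \<Rightarrow> complex" where
  "inner_on I \<phi> \<psi> = (\<Sum>\<^sub>\<infinity>i\<in>I. cnj (\<phi> i) * \<psi> i)"

definition norm_on :: "'i set \<Rightarrow> ('i \<Rightarrow> complex) \<Rightarrow> real" where
  "norm_on I \<psi> = sqrt (\<Sum>\<^sub>\<infinity>i\<in>I. (cmod (\<psi> i))\<^sup>2)"

definition apply_op :: "'j set \<Rightarrow> ('i, 'j) kernel \<Rightarrow> ('j \<Rightarrow> complex) \<Rightarrow> 'i \<Rightarrow> complex" where
  "apply_op J A \<psi> i = (\<Sum>\<^sub>\<infinity>j\<in>J. A i j * \<psi> j)"

definition comp_op :: "'k set \<Rightarrow> ('i, 'k) kernel \<Rightarrow> ('k, 'j) kernel \<Rightarrow> ('i, 'j) kernel" where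
  "comp_op K A B i j = (\<Sum>\<^sub>\<infinity>k\<in>K. A i k * B k j)"

definition adj_op :: "('i, 'j) kernel \<Rightarrow> ('j, 'i) kernel" where
  "adj_op A j i = cnj (A i j)"

definition id_op :: "'i set \<Rightarrow> ('i, 'i) kernel" where
  "id_op I i j = (if i = j \<and> i \<in> I then 1 else 0)"

definition tensor_op :: "('i, 'j) kernel \<Rightarrow> ('k, 'l) kernel \<Rightarrow> ('i \<times> 'k, 'j \<times> 'l) kernel" where
  "tensor_op A B p q = A (fst p) (fst q) * B (snd p) (snd q)"

definition bounded_op :: "'i set \<Rightarrow> ('i, 'i) kernel \<Rightarrow> bool" where
  "bounded_op I A \<longleftrightarrow>
     (\<forall>i j. i \<notin> I \<or> j \<notin> I \<longrightarrow> A i j = 0) \<and>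
     (\<exists>C. \<forall>\<psi>\<in>ell2 I.
        (\<forall>i\<in>I. (\<lambda>j. A i j * \<psi> j) summable_on I) \<and>
        apply_op I A \<psi> \<in> ell2 I \<and>
        norm_on I (apply_op I A \<psi>) \<le> C * norm_on I \<psi>)"

definition positive_op :: "'i set \<Rightarrow> ('i, 'i) kernel \<Rightarrow> bool" where
  "positive_op I A \<longleftrightarrow> bounded_op I A \<and>
     (\<forall>\<psi>\<in>ell2 I. inner_on I \<psi> (apply_op I A \<psi>) \<in> \<real> \<and>
                  0 \<le> Re (inner_on I \<psi> (apply_op I A \<psi>)))"

definition sqrt_op :: "'i set \<Rightarrow> ('i, 'i) kernel \<Rightarrow> ('i, 'i) kernel" where
  "sqrt_op I A = (THE R. positive_op I R \<and> comp_op I R R = A)"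

definition trace_op :: "'i set \<Rightarrow> ('i, 'i) kernel \<Rightarrow> complex" where
  "trace_op I A = (\<Sum>\<^sub>\<infinity>i\<in>I. A i i)"

definition density_op :: "'i set \<Rightarrow> ('i, 'i) kernel \<Rightarrow> bool" where
  "density_op I \<rho> \<longleftrightarrow> positive_op I \<rho> \<and> ((\<lambda>i. \<rho> i i) has_sum 1) I"

definition fidelity :: "'i set \<Rightarrow> ('i, 'i) kernel \<Rightarrow> ('i, 'i) kernel \<Rightarrow> real" where
  "fidelity I \<rho> \<sigma> =
     Re (trace_op I (sqrt_op I (comp_op I (comp_op I (sqrt_op I \<rho>) \<sigma>) (sqrt_op I \<rho>))))"


section \<open>Signal modes and photon number\<close>

text \<open>
  The modes are labelled by a finite type \<open>'m\<close> (so \<open>M = CARD('m)\<close>), and the Fock basis of the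
  signal space by occupation numbers \<open>'m \<Rightarrow> nat\<close>.
\<close>

definition annihilation :: "'m \<Rightarrow> ('m \<Rightarrow> nat, 'm \<Rightarrow> nat) kernel" where
  "annihilation m k n = (if n = k(m := Suc (k m)) then complex_of_real (sqrt (real (n m))) else 0)"

definition number_op :: "('m::finite \<Rightarrow> nat, 'm \<Rightarrow> nat) kernel" where
  "number_op n n' = (\<Sum>m\<in>UNIV. comp_op UNIV (adj_op (annihilation m)) (annihilation m) n n')"

lemma number_op_eq:
  fixes n n' :: "'m::finite \<Rightarrow> nat"
  shows "number_op n n' = (if n = n' then of_nat (\<Sum>m\<in>UNIV. n m) else 0)"
proof -
  have "comp_op UNIV (adj_op (annihilation m)) (annihilation m) n n'
      = (if n = n' then of_nat (n m) else 0)" for m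
  proof -
    let ?f = "\<lambda>k. adj_op (annihilation m) n k * annihilation m k n'"
    let ?k = "n(m := n m - 1)"
    have "?f k = 0" if "k \<noteq> ?k" for k
      using that by (auto simp: adj_op_def annihilation_def)
    then have "infsum ?f UNIV = infsum ?f {?k}"
      by (intro infsum_cong_neutral) auto
    also have "\<dots> = ?f ?k" by simp
    also have "\<dots> = (if n = n' then of_nat (n m) else 0)"
    proof (cases "n m = 0")
      case True
      then show ?thesis by (auto simp: adj_op_def annihilation_def)
    next
      case False
      then have "?k(m := Suc (?k m)) = n" by auto
      then show ?thesis
        by (auto simp: adj_op_def annihilation_def simp flip: of_real_mult)
    qed
    finally show ?thesis by (simp add: comp_op_def)
  qed
  then show ?thesis by (simp add: number_op_def)
qed

text \<open>
  \<open>Tr[\<rho>\<^sub>A\<^sub>S (\<one>\<^sub>A \<otimes> N\<^sub>S)] = N\<close> for an ancilla \<open>\<ell>\<^sup>2(J)\<close>. The has-sum form excludes states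
  of infinite energy, whose total sum would by convention be 0.
\<close>

definition mean_photon_number_is ::
  "'a set \<Rightarrow> ('a \<times> ('m::finite \<Rightarrow> nat), 'a \<times> ('m \<Rightarrow> nat)) kernel \<Rightarrow> real \<Rightarrow> bool" where
  "mean_photon_number_is J \<rho> N \<longleftrightarrow>
     ((\<lambda>i. comp_op (J \<times> UNIV) \<rho> (tensor_op (id_op J) number_op) i i)
        has_sum complex_of_real N) (J \<times> UNIV)"


section \<open>The quantum-limited amplifier\<close>

text \<open>
  The isometry \<open>|n\<rangle>\<^sub>S \<mapsto> U(\<tau>) |n\<rangle>\<^sub>S |0\<rangle>\<^sub>E\<close>, with rows labelled by the joint Fock basis
  \<open>|k\<rangle>\<^sub>S |a\<rangle>\<^sub>E\<close>. It determines the channel, because the environment starts in the vacuum.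
\<close>

definition amplifier_isometry :: "real \<Rightarrow> (nat \<times> nat, nat) kernel" where
  "amplifier_isometry \<tau> p n = (case p of (k, a) \<Rightarrow>
     if k = n + a
     then complex_of_real ((1 / cosh \<tau>) ^ (n + 1) * sqrt (real ((n + a) choose a)) * tanh \<tau> ^ a)
     else 0)"

lemma amplifier_isometry_isometric:
  "comp_op UNIV (adj_op (amplifier_isometry \<tau>)) (amplifier_isometry \<tau>) = id_op UNIV"
proof (intro ext)
  fix n n' :: nat
  let ?V = "amplifier_isometry \<tau>"
  define s where "s = 1 / cosh \<tau>"
  define t where "t = tanh \<tau>"
  let ?f = "\<lambda>p. adj_op ?V n p * ?V p n'"
  have zero: "?f p = 0" if "p \<notin> range (\<lambda>a. (n + a, a))" for p
    using that by (auto simp: adj_op_def amplifier_isometry_def split: prod.splits)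
  have "infsum ?f UNIV = infsum ?f (range (\<lambda>a. (n + a, a)))"
    using zero by (intro infsum_cong_neutral) auto
  also have "\<dots> = infsum (\<lambda>a. ?f (n + a, a)) UNIV"
    by (subst infsum_reindex) (auto simp: inj_on_def o_def)
  also have "\<dots> = (if n = n' then 1 else 0)"
  proof (cases "n = n'")
    case False
    then show ?thesis
      by (auto simp: adj_op_def amplifier_isometry_def)
  next
    case True
    have "(sinh \<tau>)\<^sup>2 = (cosh \<tau>)\<^sup>2 - 1" using cosh_square_eq[of \<tau>] by simp
    then have t2: "t\<^sup>2 = 1 - s\<^sup>2"
      using cosh_real_pos[of \<tau>]
      by (simp add: t_def s_def tanh_def power_divide diff_divide_distrib del: cosh_square_eq)
    have s0: "0 < s" "s \<le> 1" using cosh_real_ge_1[of \<tau>] by (auto simp: s_def)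
    then have t1: "0 \<le> t\<^sup>2" "t\<^sup>2 < 1" using t2 by (auto simp: power_le_one)
    have "(\<lambda>a. ((- real (n + 1)) gchoose a) * (- t\<^sup>2) ^ a) sums (1 + - t\<^sup>2) powr (- real (n + 1))"
      using t1 by (intro gen_binomial_real) auto
    also have "(\<lambda>a. ((- real (n + 1)) gchoose a) * (- t\<^sup>2) ^ a) = (\<lambda>a. real ((n + a) choose a) * (t\<^sup>2) ^ a)"
    proof
      fix a
      have "((- real (n + 1)) gchoose a) = (-1) ^ a * real ((n + a) choose a)"
        by (subst gbinomial_minus) (simp add: binomial_gbinomial add_ac)
      moreover have "(- t\<^sup>2) ^ a = (-1) ^ a * (t\<^sup>2) ^ a"
        by (rule power_minus)
      moreover have "(-1::real) ^ a * (-1) ^ a = 1"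
        by (simp flip: power_mult_distrib)
      ultimately show "((- real (n + 1)) gchoose a) * (- t\<^sup>2) ^ a = real ((n + a) choose a) * (t\<^sup>2) ^ a"
        by (simp add: algebra_simps)
    qed
    also have "(1 + - t\<^sup>2) powr (- real (n + 1)) = 1 / (s\<^sup>2) ^ (n + 1)"
      using s0 unfolding t2 powr_minus by (subst powr_realpow) (auto simp: inverse_eq_divide)
    finally have "(\<lambda>a. (s\<^sup>2) ^ (n + 1) * (real ((n + a) choose a) * (t\<^sup>2) ^ a)) sums
        ((s\<^sup>2) ^ (n + 1) * (1 / (s\<^sup>2) ^ (n + 1)))"
      by (rule sums_mult)
    then have "(\<lambda>a. (s\<^sup>2) ^ (n + 1) * (real ((n + a) choose a) * (t\<^sup>2) ^ a)) sums 1"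
      using s0 by simp
    then have "((\<lambda>a. (s\<^sup>2) ^ (n + 1) * (real ((n + a) choose a) * (t\<^sup>2) ^ a)) has_sum 1) UNIV"
      using t1 by (intro norm_summable_imp_has_sum) (auto simp: sums_iff)
    then have "((\<lambda>a. complex_of_real ((s\<^sup>2) ^ (n + 1) * (real ((n + a) choose a) * (t\<^sup>2) ^ a))) has_sum
        complex_of_real 1) UNIV"
      by (rule has_sum_of_real)
    moreover have "?f (n + a, a)
        = complex_of_real ((s\<^sup>2) ^ (n + 1) * (real ((n + a) choose a) * (t\<^sup>2) ^ a))" for a
    proof -
      have "?f (n + a, a)
          = complex_of_real ((s ^ (n + 1) * sqrt (real ((n + a) choose a)) * t ^ a)\<^sup>2)"
        using True
        by (simp add: adj_op_def amplifier_isometry_def s_def t_def power2_eq_square)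
      also have "(s ^ (n + 1) * sqrt (real ((n + a) choose a)) * t ^ a)\<^sup>2
          = (s\<^sup>2) ^ (n + 1) * (real ((n + a) choose a) * (t\<^sup>2) ^ a)"
        by (simp add: power_mult_distrib power_even_eq[symmetric] flip: power_mult)
          (simp add: mult.commute power_mult_distrib power_mult)
      finally show ?thesis .
    qed
    ultimately show ?thesis using True by (simp add: infsumI)
  qed
  finally show "comp_op UNIV (adj_op ?V) ?V n n' = id_op UNIV n n'"
    by (simp add: comp_op_def id_op_def)
qed

definition trace_env :: "('k \<times> 'e, 'k \<times> 'e) kernel \<Rightarrow> ('k, 'k) kernel" where
  "trace_env X k l = (\<Sum>\<^sub>\<infinity>e. X (k, e) (l, e))"

definition amplifier :: "real \<Rightarrow> (nat, nat) kernel \<Rightarrow> (nat, nat) kernel" where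
  "amplifier \<tau> X =
     trace_env (comp_op UNIV (comp_op UNIV (amplifier_isometry \<tau>) X) (adj_op (amplifier_isometry \<tau>)))"

definition matrix_unit :: "'i \<Rightarrow> 'j \<Rightarrow> ('i, 'j) kernel" where
  "matrix_unit i j p q = (if p = i \<and> q = j then 1 else 0)"

text \<open>
  \<open>\<Phi>\<^sup>\<otimes>\<^sup>M\<close> in matrix elements: on \<open>|n\<rangle>\<langle>n'|\<close>, a tensor product of single-mode matrix units, it
  acts factorwise, and it is extended linearly. For the amplifier, only the finitely many terms
  with \<open>n \<le> k\<close> and \<open>n' \<le> l\<close> are nonzero.
\<close>

definition tensor_power ::
  "((nat, nat) kernel \<Rightarrow> (nat, nat) kernel) \<Rightarrow>
   ('m::finite \<Rightarrow> nat, 'm \<Rightarrow> nat) kernel \<Rightarrow> ('m \<Rightarrow> nat, 'm \<Rightarrow> nat) kernel" where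
  "tensor_power \<Phi> X k l =
     (\<Sum>\<^sub>\<infinity>(n, n')\<in>UNIV. X n n' * (\<Prod>m\<in>UNIV. \<Phi> (matrix_unit (n m) (n' m)) (k m) (l m)))"

text \<open>\<open>id\<^sub>A \<otimes> \<Phi>\<close> acts as \<open>\<Phi>\<close> on each block \<open>\<langle>\<alpha>|\<rho>|\<beta>\<rangle>\<close> with respect to the ancilla basis.\<close>

definition id_tensor ::
  "'a set \<Rightarrow> (('s, 's) kernel \<Rightarrow> ('s, 's) kernel) \<Rightarrow>
   ('a \<times> 's, 'a \<times> 's) kernel \<Rightarrow> ('a \<times> 's, 'a \<times> 's) kernel" where
  "id_tensor J \<Phi> \<rho> p q =
     (if fst p \<in> J \<and> fst q \<in> J
      then \<Phi> (\<lambda>n n'. \<rho> (fst p, n) (fst q, n')) (snd p) (snd q) else 0)"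


section \<open>Energy-constrained output fidelity and Bures distance\<close>

text \<open>
  The ancilla ranges over the spaces \<open>\<ell>\<^sup>2(J)\<close> for all nonempty sets \<open>J\<close> of labels of an infinite
  type \<open>'a\<close>. Every separable Hilbert space (and, for large \<open>'a\<close>, every Hilbert space up to a given
  dimension) is of this form up to isometry.
\<close>

definition probes ::
  "real \<Rightarrow> ('a::infinite set \<times> ('a \<times> ('m::finite \<Rightarrow> nat), 'a \<times> ('m \<Rightarrow> nat)) kernel) set" where
  "probes N = {(J, \<rho>). J \<noteq> {} \<and> density_op (J \<times> UNIV) \<rho> \<and> mean_photon_number_is J \<rho> N}"

definition output_fidelity ::
  "((('m::finite \<Rightarrow> nat), ('m \<Rightarrow> nat)) kernel \<Rightarrow> ('m \<Rightarrow> nat, 'm \<Rightarrow> nat) kernel) \<Rightarrow>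
   (('m \<Rightarrow> nat, 'm \<Rightarrow> nat) kernel \<Rightarrow> ('m \<Rightarrow> nat, 'm \<Rightarrow> nat) kernel) \<Rightarrow>
   'a set \<times> ('a \<times> ('m \<Rightarrow> nat), 'a \<times> ('m \<Rightarrow> nat)) kernel \<Rightarrow> real" where
  "output_fidelity \<Phi> \<Psi> = (\<lambda>(J, \<rho>).
     fidelity (J \<times> UNIV) (id_tensor J \<Phi> \<rho>) (id_tensor J \<Psi> \<rho>))"

definition ec_bures_distance ::
  "'a::infinite itself \<Rightarrow> real \<Rightarrow>
   (('m::finite \<Rightarrow> nat, 'm \<Rightarrow> nat) kernel \<Rightarrow> ('m \<Rightarrow> nat, 'm \<Rightarrow> nat) kernel) \<Rightarrow>
   (('m \<Rightarrow> nat, 'm \<Rightarrow> nat) kernel \<Rightarrow> ('m \<Rightarrow> nat, 'm \<Rightarrow> nat) kernel) \<Rightarrow> real" where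
  "ec_bures_distance _ N \<Phi> \<Psi> =
     (SUP P \<in> (probes N :: ('a set \<times> ('a \<times> ('m \<Rightarrow> nat), 'a \<times> ('m \<Rightarrow> nat)) kernel) set).
        sqrt (1 - output_fidelity \<Phi> \<Psi> P))"

end

theory Submission
  imports Defs
begin

text \<open>
  Lower bound: amplifying a purification of \<open>\<rho>\<close> gives purifications of the two outputs. Since the
  isometries satisfy \<open>V\<^sub>\<tau>\<^sup>* V\<^sub>\<tau>\<^sub>' |n\<rangle> = \<nu>\<^bsup>n+1\<^esup> |n\<rangle>\<close>, their overlap is \<open>\<Sum> \<nu>\<^bsup>M+|n|\<^esup> \<langle>n|\<rho>|n\<rangle>\<close>. By the easy
  half of Uhlmann's theorem the fidelity is at least this overlap, and since \<open>k \<mapsto> \<nu>\<^bsup>k\<^esup>\<close> is convex, the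
  overlap lies above the chord of \<open>\<nu>\<^bsup>k\<^esup>\<close> over \<open>[\<lfloor>N\<rfloor>, \<lfloor>N\<rfloor> + 1]\<close> at \<open>N\<close>.

  Attainment: mix Fock states with \<open>\<lfloor>N\<rfloor>\<close> and \<open>\<lceil>N\<rceil>\<close> photons in one mode, flagged by orthogonal ancilla
  states. Both outputs are then diagonal, no entanglement is needed, and the fidelity can be computed
  explicitly.
\<close>


section \<open>Abstract operator theory: square roots, approximate inverses, trace bounds\<close>

subsection \<open>Positive operators on a real Hilbert space\<close>

text \<open>The definitions speak of kernels, while norms and limits live on bounded operators.
  These are real-linear here, so ell2 is treated as a real Hilbert space with complex structure
  \<open>imul\<close>, and complex linearity becomes commutation with it. Every complex vector then
  counts twice, as \<open>w\<close> and \<open>imul w\<close>; this doubles traces and overlaps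
  alike, and the factors 2 cancel.

  Fidelity hides two obligations. \<open>sqrt_op\<close> is a definite description, so positive
  roots must be shown to exist and to be unique. The trace is an infinite sum with default value 0,
  so the root inside the fidelity must be shown to have a summable diagonal before a lower bound
  makes sense. This and Uhlmann's inequality are usually read off from polar decompositions; here
  Bessel families, produced by truncated Neumann series of possibly non-invertible positive
  operators, take the place of partial isometries.

  The overlap is insensitive to coherences of the probe: for a fixed environment occupation, the
  Kraus operators of the two channels have a product (adjoint times operator) that is diagonal in
  the Fock basis.\<close>

definition selfadjoint :: "('h::real_inner \<Rightarrow>\<^sub>L 'h) \<Rightarrow> bool" where
  "selfadjoint A \<longleftrightarrow> (\<forall>x y. inner x (A y) = inner (A x) y)"

definition pos :: "('h::real_inner \<Rightarrow>\<^sub>L 'h) \<Rightarrow> bool" where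
  "pos A \<longleftrightarrow> selfadjoint A \<and> (\<forall>x. 0 \<le> inner x (A x))"

lemma selfadjointD: "selfadjoint A \<Longrightarrow> inner x (A y) = inner (A x) y"
  unfolding selfadjoint_def by blast

lemma pos_selfadjoint: "pos A \<Longrightarrow> selfadjoint A"
  and pos_nonneg: "pos A \<Longrightarrow> 0 \<le> inner x (A x)"
  by (auto simp: pos_def)

lemma inner_le_norm_blinfun: "inner x (blinfun_apply A x) \<le> norm A * (norm x)\<^sup>2"
proof -
  have "inner x (A x) \<le> norm x * norm (A x)" by (rule norm_cauchy_schwarz)
  also have "\<dots> \<le> norm x * (norm A * norm x)" by (intro mult_left_mono norm_blinfun) auto
  finally show ?thesis by (simp add: power2_eq_square mult_ac)
qed

text \<open>A - A^2 is the sum of (1 - A) A (1 - A) and A (1 - A) A, both positive forms. The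
  argument is purely algebraic because it precedes, and feeds, the construction of square
  roots.\<close>

lemma pos_square_le:
  assumes "pos A" and le: "\<And>x. inner x (A x) \<le> (norm x)\<^sup>2"
  shows "(norm (A x))\<^sup>2 \<le> inner x (A x)"
proof -
  have sa: "inner x (A y) = inner (A x) y" for x y
    using assms selfadjointD pos_selfadjoint by blast
  define y r where "y = A x" and "r = x - y"
  have "inner x (A x) - (norm (A x))\<^sup>2 = inner x (A r)"
    by (simp add: r_def y_def blinfun.diff_right inner_diff power2_norm_eq_inner sa)
  also have "\<dots> = inner r (A r) + inner y (A r)"
    by (simp add: r_def inner_diff)
  also have "inner y (A r) = (norm y)\<^sup>2 - inner y (A y)"
    by (simp add: r_def y_def blinfun.diff_right inner_diff power2_norm_eq_inner sa)
  finally show ?thesis using pos_nonneg[OF assms(1), of r] le[of y] by linarith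
qed

lemma pos_le_one_norm:
  assumes "pos A" and "\<And>x. inner x (A x) \<le> (norm x)\<^sup>2"
  shows "norm (A x) \<le> norm x"
  using pos_square_le[OF assms, of x] assms(2)[of x] by (meson norm_ge_zero order_trans power2_le_imp_le)

lemma pos_scaleR: "pos A \<Longrightarrow> 0 \<le> c \<Longrightarrow> pos (c *\<^sub>R A)"
  by (auto simp: pos_def selfadjoint_def scaleR_blinfun.rep_eq)

text \<open>After rescaling to a contraction, \<open>pos_square_le\<close> bounds the norm of A x by
  the vanishing form.\<close>

lemma pos_form_zero:
  assumes "pos A" "inner x (A x) = 0"
  shows "A x = 0"
proof (cases "A = 0")
  case False
  let ?B = "(1 / norm A) *\<^sub>R A"
  have "inner y (?B y) \<le> (norm y)\<^sup>2" for y
    using inner_le_norm_blinfun[of y A] False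
    by (simp add: scaleR_blinfun.rep_eq divide_simps mult.commute)
  from pos_square_le[OF pos_scaleR[OF assms(1)] this, of x]
  have "(norm (?B x))\<^sup>2 \<le> 0" using assms(2) by (simp add: scaleR_blinfun.rep_eq)
  then show ?thesis using False by (simp add: scaleR_blinfun.rep_eq)
qed simp

subsection \<open>Square roots\<close>

text \<open>
  For \<open>0 \<le> A \<le> 1\<close> and \<open>B = 1 - A\<close>, the iterates converge to \<open>1 - \<surd>A\<close>. Started at \<open>0\<close>, the same
  recursion on numbers with \<open>B\<close> replaced by \<open>1\<close> increases to \<open>1\<close> and majorises the increments.
\<close>

fun sqrt_iter :: "('h::real_normed_vector \<Rightarrow>\<^sub>L 'h) \<Rightarrow> nat \<Rightarrow> 'h \<Rightarrow>\<^sub>L 'h" where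
  "sqrt_iter B 0 = 0"
| "sqrt_iter B (Suc n) = (1/2) *\<^sub>R (B + (sqrt_iter B n o\<^sub>L sqrt_iter B n))"

fun sqrt_iter_bound :: "nat \<Rightarrow> real" where
  "sqrt_iter_bound 0 = 0"
| "sqrt_iter_bound (Suc n) = (1 + (sqrt_iter_bound n)\<^sup>2) / 2"

lemma sqrt_iter_bound_range: "0 \<le> sqrt_iter_bound n \<and> sqrt_iter_bound n \<le> 1"
proof (induction n)
  case (Suc n)
  then have "(sqrt_iter_bound n)\<^sup>2 \<le> 1" by (simp add: power_le_one)
  then show ?case by auto
qed simp

lemma sqrt_iter_bound_mono: "incseq sqrt_iter_bound"
proof (rule incseq_SucI)
  fix n
  have "0 \<le> (1 - sqrt_iter_bound n)\<^sup>2" by simp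
  then show "sqrt_iter_bound n \<le> sqrt_iter_bound (Suc n)"
    by (simp add: power2_diff)
qed

lemma norm_sqrt_iter_le:
  assumes "norm B \<le> 1"
  shows "norm (sqrt_iter B n) \<le> sqrt_iter_bound n"
proof (induction n)
  case (Suc n)
  have "norm (sqrt_iter B n o\<^sub>L sqrt_iter B n) \<le> norm (sqrt_iter B n) * norm (sqrt_iter B n)"
    by (rule norm_blinfun_compose)
  also have "\<dots> \<le> (sqrt_iter_bound n)\<^sup>2"
    using Suc by (simp add: power2_eq_square mult_mono sqrt_iter_bound_range)
  finally have "norm (B + (sqrt_iter B n o\<^sub>L sqrt_iter B n)) \<le> 1 + (sqrt_iter_bound n)\<^sup>2"
    using assms norm_triangle_ineq[of B "sqrt_iter B n o\<^sub>L sqrt_iter B n"] by linarith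
  then show ?case by simp
qed simp

lemma norm_sqrt_iter_diff_le:
  assumes "norm B \<le> 1"
  shows "norm (sqrt_iter B (Suc n) - sqrt_iter B n) \<le> sqrt_iter_bound (Suc n) - sqrt_iter_bound n"
proof (induction n)
  case 0
  then show ?case using assms by simp
next
  case (Suc n)
  define Y Z where "Y = sqrt_iter B (Suc n)" and "Z = sqrt_iter B n"
  define y z where "y = sqrt_iter_bound (Suc n)" and "z = sqrt_iter_bound n"
  have IH: "norm (Y - Z) \<le> y - z" using Suc by (simp only: Y_def Z_def y_def z_def)
  have nY: "norm Y \<le> y" "norm Z \<le> z"
    unfolding Y_def Z_def y_def z_def by (intro norm_sqrt_iter_le assms)+
  \<comment> \<open>Y^2 - Z^2 is split as Y (Y - Z) + (Y - Z) Z, which is valid without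
    commutativity; its norm bound is exactly the scalar difference of squares.\<close>
  have "sqrt_iter B (Suc (Suc n)) - Y = (1/2) *\<^sub>R ((Y o\<^sub>L (Y - Z)) + ((Y - Z) o\<^sub>L Z))"
  proof -
    have "sqrt_iter B (Suc (Suc n)) = (1/2) *\<^sub>R (B + (Y o\<^sub>L Y))" unfolding Y_def by (rule sqrt_iter.simps)
    moreover have "Y = (1/2) *\<^sub>R (B + (Z o\<^sub>L Z))" unfolding Y_def Z_def by (rule sqrt_iter.simps)
    ultimately have "sqrt_iter B (Suc (Suc n)) - Y = (1/2) *\<^sub>R (B + (Y o\<^sub>L Y)) - (1/2) *\<^sub>R (B + (Z o\<^sub>L Z))"
      by (metis (no_types))
    also have "\<dots> = (1/2) *\<^sub>R ((Y o\<^sub>L (Y - Z)) + ((Y - Z) o\<^sub>L Z))"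
      by (intro blinfun_eqI) (simp add: blinfun.bilinear_simps algebra_simps)
    finally show ?thesis .
  qed
  also have "norm \<dots> \<le> (1/2) * (norm Y * norm (Y - Z) + norm (Y - Z) * norm Z)"
    using norm_blinfun_compose[of Y "Y - Z"] norm_blinfun_compose[of "Y - Z" Z]
      norm_triangle_ineq[of "Y o\<^sub>L (Y - Z)" "(Y - Z) o\<^sub>L Z"] by simp
  also have "\<dots> = (1/2) * (norm (Y - Z) * (norm Y + norm Z))" by (simp add: algebra_simps)
  also have "\<dots> \<le> (1/2) * ((y - z) * (y + z))"
    using IH nY order_trans[OF norm_ge_zero IH] by (intro mult_left_mono mult_mono) auto
  also have "\<dots> = sqrt_iter_bound (Suc (Suc n)) - y"
    unfolding y_def z_def by (simp add: algebra_simps power2_eq_square)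
  finally show ?case by (simp only: Y_def y_def)
qed

lemma sqrt_iter_convergent:
  fixes B :: "'h::banach \<Rightarrow>\<^sub>L 'h"
  assumes "norm B \<le> 1"
  shows "convergent (sqrt_iter B)"
proof -
  have dist: "norm (sqrt_iter B (n + k) - sqrt_iter B n) \<le> sqrt_iter_bound (n + k) - sqrt_iter_bound n" for n k
  proof (induction k)
    case (Suc k)
    have "norm (sqrt_iter B (n + Suc k) - sqrt_iter B n)
        \<le> norm (sqrt_iter B (Suc (n + k)) - sqrt_iter B (n + k)) + norm (sqrt_iter B (n + k) - sqrt_iter B n)"
      using norm_triangle_ineq[of "sqrt_iter B (Suc (n + k)) - sqrt_iter B (n + k)"
          "sqrt_iter B (n + k) - sqrt_iter B n"] by (simp del: sqrt_iter.simps)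
    then show ?case
      using Suc norm_sqrt_iter_diff_le[OF assms, of "n + k"]
      by (simp del: sqrt_iter.simps sqrt_iter_bound.simps)
  qed simp
  obtain L where "sqrt_iter_bound \<longlonglongrightarrow> L"
    using incseq_convergent[OF sqrt_iter_bound_mono, of 1] sqrt_iter_bound_range by blast
  then have "Cauchy sqrt_iter_bound" by (rule LIMSEQ_imp_Cauchy)
  have "Cauchy (sqrt_iter B)"
  proof (rule CauchyI')
    fix e :: real assume "0 < e"
    then obtain M where M: "norm (sqrt_iter_bound m - sqrt_iter_bound n) < e" if "m \<ge> M" "n \<ge> M" for m n
      using CauchyD[OF \<open>Cauchy sqrt_iter_bound\<close>] by metis
    have "norm (sqrt_iter B m - sqrt_iter B n) < e" if "m \<ge> M" "m < n" for m n
    proof -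
      have "norm (sqrt_iter B n - sqrt_iter B m) \<le> sqrt_iter_bound n - sqrt_iter_bound m"
        using dist[of m "n - m"] that by simp
      also have "\<dots> < e" using M[of n m] that by simp
      finally show ?thesis by (simp add: norm_minus_commute)
    qed
    then show "\<exists>M. \<forall>m\<ge>M. \<forall>n>m. dist (sqrt_iter B m) (sqrt_iter B n) < e"
      by (auto simp: dist_norm)
  qed
  then show ?thesis by (simp add: Cauchy_convergent_iff)
qed

definition commutes :: "('h::real_normed_vector \<Rightarrow>\<^sub>L 'h) \<Rightarrow> ('h \<Rightarrow>\<^sub>L 'h) \<Rightarrow> bool" where
  "commutes A C \<longleftrightarrow> A o\<^sub>L C = C o\<^sub>L A"

lemma commutesD: "commutes A C \<Longrightarrow> blinfun_apply A (C x) = C (A x)"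
  unfolding commutes_def by (metis blinfun_apply_blinfun_compose)

lemma commutesI: "(\<And>x. blinfun_apply A (blinfun_apply C x) = C (A x)) \<Longrightarrow> commutes A C"
  unfolding commutes_def by (intro blinfun_eqI) simp

text \<open>The limit Y satisfies 2 Y = B + Y^2, hence (1 - Y)^2 = 1 - B = A. Iterates are
  polynomials in B, so they commute with whatever commutes with A; this clause later yields both the
  uniqueness of the root and its complex linearity.\<close>

lemma sqrt_exists_le_one:
  fixes A :: "'h::{real_inner,banach} \<Rightarrow>\<^sub>L 'h"
  assumes "pos A" and le: "\<And>x. inner x (A x) \<le> (norm x)\<^sup>2"
  shows "\<exists>S. pos S \<and> S o\<^sub>L S = A \<and> (\<forall>C. commutes A C \<longrightarrow> commutes S C)"
proof -
  define B where "B = id_blinfun - A"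
  have B: "B x = x - A x" for x by (simp add: B_def blinfun.diff_left)
  have sa: "inner x (A y) = inner (A x) y" for x y
    using assms selfadjointD pos_selfadjoint by blast
  have posB: "pos B"
    unfolding pos_def selfadjoint_def
    using le by (auto simp: B inner_diff sa power2_norm_eq_inner)
  have nB: "norm B \<le> 1"
  proof (rule norm_blinfun_bound)
    fix x show "norm (B x) \<le> 1 * norm x"
      using pos_le_one_norm[OF posB, of x] pos_nonneg[OF assms(1)]
      by (simp add: B inner_diff power2_norm_eq_inner)
  qed simp
  obtain Y where Y: "sqrt_iter B \<longlonglongrightarrow> Y"
    using sqrt_iter_convergent[OF nB] by (auto simp: convergent_def)
  have nY: "norm Y \<le> 1"
  proof (rule LIMSEQ_le_const2[OF tendsto_norm[OF Y]])
    show "\<exists>N. \<forall>n\<ge>N. norm (sqrt_iter B n) \<le> 1"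
      using norm_sqrt_iter_le[OF nB] sqrt_iter_bound_range order_trans by blast
  qed
  have "(\<lambda>n. sqrt_iter B (Suc n)) \<longlonglongrightarrow> (1/2) *\<^sub>R (B + (Y o\<^sub>L Y))"
    unfolding sqrt_iter.simps by (intro tendsto_intros bounded_bilinear.tendsto[OF bounded_bilinear_blinfun_compose] Y)
  from LIMSEQ_unique[OF LIMSEQ_Suc[OF Y] this] have eqY: "Y = (1/2) *\<^sub>R (B + (Y o\<^sub>L Y))" .
  have YY: "Y (Y x) = 2 *\<^sub>R Y x - B x" for x
  proof -
    have "Y x = (1/2) *\<^sub>R (B x + Y (Y x))"
      by (subst eqY) (simp add: blinfun.bilinear_simps)
    then have "2 *\<^sub>R Y x = 2 *\<^sub>R ((1/2) *\<^sub>R (B x + Y (Y x)))" by (rule arg_cong)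
    then show ?thesis by simp
  qed
  have lim: "(\<lambda>n. sqrt_iter B n x) \<longlonglongrightarrow> Y x" for x
    by (rule tendsto_intros Y)+
  have saY: "inner x (Y y) = inner (Y x) y" for x y
  proof -
    have "inner x (sqrt_iter B n y) = inner (sqrt_iter B n x) y" for n x y
    proof (induction n arbitrary: x y)
      case (Suc n)
      then show ?case
        using selfadjointD[OF pos_selfadjoint[OF posB]]
        by (simp add: blinfun.bilinear_simps inner_add)
    qed simp
    then have "(\<lambda>n. inner x (sqrt_iter B n y)) = (\<lambda>n. inner (sqrt_iter B n x) y)" by simp
    moreover have "(\<lambda>n. inner x (sqrt_iter B n y)) \<longlonglongrightarrow> inner x (Y y)"
      by (intro tendsto_intros lim)
    moreover have "(\<lambda>n. inner (sqrt_iter B n x) y) \<longlonglongrightarrow> inner (Y x) y"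
      by (intro tendsto_intros lim)
    ultimately show ?thesis using LIMSEQ_unique by metis
  qed
  define S where "S = id_blinfun - Y"
  have S: "S x = x - Y x" for x by (simp add: S_def blinfun.diff_left)
  have "pos S"
    unfolding pos_def selfadjoint_def
  proof (intro conjI allI)
    fix x y show "inner x (S y) = inner (S x) y" by (simp add: S inner_diff saY)
    have "inner x (Y x) \<le> norm Y * (norm x)\<^sup>2" by (rule inner_le_norm_blinfun)
    also have "\<dots> \<le> (norm x)\<^sup>2" using nY by (simp add: mult_left_le_one_le)
    finally show "0 \<le> inner x (S x)" by (simp add: S inner_diff power2_norm_eq_inner)
  qed
  moreover have "S o\<^sub>L S = A"
    by (intro blinfun_eqI) (simp add: S blinfun.diff_right YY B scaleR_2)
  moreover have "commutes S C" if "commutes A C" for C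
  proof (rule commutesI)
    fix x
    have "sqrt_iter B n (C x) = C (sqrt_iter B n x)" for n x
    proof (induction n arbitrary: x)
      case (Suc n)
      then show ?case
        using commutesD[OF that] by (simp add: blinfun.bilinear_simps B)
    qed (simp add: blinfun.bilinear_simps)
    then have "(\<lambda>n. sqrt_iter B n (C x)) = (\<lambda>n. C (sqrt_iter B n x))" by simp
    moreover have "(\<lambda>n. C (sqrt_iter B n x)) \<longlonglongrightarrow> C (Y x)"
      by (intro tendsto_intros lim)
    ultimately have "Y (C x) = C (Y x)" using lim[of "C x"] LIMSEQ_unique by metis
    then show "S (C x) = C (S x)" by (simp add: S blinfun.diff_right)
  qed
  ultimately show ?thesis by blast
qed

lemma pos_sqrt_exists:
  fixes A :: "'h::{real_inner,banach} \<Rightarrow>\<^sub>L 'h"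
  assumes "pos A"
  shows "\<exists>S. pos S \<and> S o\<^sub>L S = A \<and> (\<forall>C. commutes A C \<longrightarrow> commutes S C)"
proof (cases "A = 0")
  case True
  then show ?thesis
    by (intro exI[of _ 0]) (auto simp: pos_def selfadjoint_def commutes_def)
next
  case False
  let ?c = "norm A"
  let ?B = "(1 / ?c) *\<^sub>R A"
  have "inner y (?B y) \<le> (norm y)\<^sup>2" for y
    using inner_le_norm_blinfun[of y A] False
    by (simp add: scaleR_blinfun.rep_eq divide_simps mult.commute)
  from sqrt_exists_le_one[OF pos_scaleR[OF assms] this]
  obtain S where S: "pos S" "S o\<^sub>L S = ?B" "\<And>C. commutes ?B C \<Longrightarrow> commutes S C" by auto
  have SS: "S (S x) = (1 / ?c) *\<^sub>R A x" for x
    using S(2) by (metis blinfun_apply_blinfun_compose scaleR_blinfun.rep_eq)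
  show ?thesis
  proof (intro exI[of _ "sqrt ?c *\<^sub>R S"] conjI allI impI)
    show "pos (sqrt ?c *\<^sub>R S)" by (intro pos_scaleR S) simp
    show "(sqrt ?c *\<^sub>R S) o\<^sub>L (sqrt ?c *\<^sub>R S) = A"
      using False by (intro blinfun_eqI) (simp add: blinfun.bilinear_simps SS)
    fix C assume "commutes A C"
    then have "commutes ?B C" by (auto intro!: commutesI simp: blinfun.bilinear_simps dest: commutesD)
    from S(3)[OF this] show "commutes (sqrt ?c *\<^sub>R S) C"
      by (auto intro!: commutesI simp: blinfun.bilinear_simps commutesD)
  qed
qed

text \<open>R commutes with A = R^2, so the commutation property of S makes S and R commute. For y =
  (S - R) x this gives (S + R) y = 0; both forms vanish at y, so S y = R y = 0 and |y|^2 = <x, (S -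
  R) y> = 0.\<close>

lemma pos_sqrt_unique:
  fixes A :: "'h::{real_inner,banach} \<Rightarrow>\<^sub>L 'h"
  assumes "pos S" "pos R" "S o\<^sub>L S = A" "R o\<^sub>L R = A"
    and comm: "\<And>C. commutes A C \<Longrightarrow> commutes S C"
  shows "R = S"
proof (rule blinfun_eqI)
  fix x
  have SS: "S (S x) = A x" and RR: "R (R x) = A x" for x
    using assms(3,4) by (metis blinfun_apply_blinfun_compose)+
  have "commutes A R" by (rule commutesI) (simp flip: RR)
  then have SR: "S (R x) = R (S x)" for x using comm commutesD by blast
  define y where "y = S x - R x"
  have "S y + R y = 0"
    by (simp add: y_def blinfun.diff_right SS RR SR)
  then have "inner y (S y) + inner y (R y) = 0" by (metis inner_add_right inner_zero_right)
  then have "inner y (S y) = 0" "inner y (R y) = 0"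
    using pos_nonneg[OF assms(1), of y] pos_nonneg[OF assms(2), of y] by linarith+
  then have "S y = 0" "R y = 0" using pos_form_zero assms(1,2) by auto
  moreover have "inner y y = inner x (S y) - inner x (R y)"
    using selfadjointD[OF pos_selfadjoint[OF assms(1)], of x y]
      selfadjointD[OF pos_selfadjoint[OF assms(2)], of x y]
    by (simp add: inner_diff y_def)
  ultimately show "R x = S x" by (simp add: y_def)
qed

subsection \<open>Approximate inversion of a positive contraction\<close>

locale pos_contraction =
  fixes R :: "'h::real_inner \<Rightarrow>\<^sub>L 'h"
  assumes pos: "pos R" and le_one: "\<And>x. inner x (R x) \<le> (norm x)\<^sup>2"
begin

definition co :: "'h \<Rightarrow> 'h" where "co x = x - R x"

text \<open>Truncated Neumann series for the inverse of R. R may fail to be invertible; what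
  survives is R (\<open>ainv\<close> n x) = x - (1 - R)^n x, to be used where the last term vanishes
  in the limit.\<close>

definition ainv :: "nat \<Rightarrow> 'h \<Rightarrow> 'h" where "ainv n x = (\<Sum>k<n. (co ^^ k) x)"

lemma R_sa: "inner x (R y) = inner (R x) y"
  using pos pos_selfadjoint selfadjointD by blast

lemma co_sa: "inner x ((co ^^ n) y) = inner ((co ^^ n) x) y"
proof (induction n arbitrary: x y)
  case (Suc n)
  have "inner x ((co ^^ Suc n) y) = inner (co x) ((co ^^ n) y)"
    by (simp add: co_def inner_diff R_sa)
  also have "\<dots> = inner ((co ^^ n) (co x)) y" by (rule Suc)
  finally show ?case by (simp add: funpow_swap1)
qed simp

lemma R_co: "R ((co ^^ n) x) = (co ^^ n) (R x)"
  by (induction n) (simp_all add: co_def blinfun.diff_right)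

text \<open>Even powers of 1 - R are squares; odd ones are 1 - R conjugated by a power of
  itself.\<close>

lemma co_pow_nonneg: "0 \<le> inner x ((co ^^ n) x)"
proof -
  have "inner x ((co ^^ (k + k)) x) = (norm ((co ^^ k) x))\<^sup>2" for k
    using co_sa[of x k "(co ^^ k) x"] by (simp add: funpow_add power2_norm_eq_inner)
  moreover have "inner x ((co ^^ (Suc (k + k))) x) \<ge> 0" for k
  proof -
    have "inner x ((co ^^ (Suc (k + k))) x) = inner ((co ^^ k) x) (co ((co ^^ k) x))"
    proof -
      have "(co ^^ (Suc (k + k))) x = (co ^^ k) (co ((co ^^ k) x))"
        by (simp add: funpow_add funpow_swap1)
      then show ?thesis by (simp add: co_sa)
    qed
    then show ?thesis using le_one[of "(co ^^ k) x"]
      by (simp add: co_def inner_diff power2_norm_eq_inner)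
  qed
  ultimately show ?thesis
    by (cases "even n") (auto simp: mult_2 elim!: evenE oddE)
qed

text \<open>Two factors 1 - R are peeled off, one to each side, which lowers n by 2. The base cases
  are R and R - R^2.\<close>

lemma R_co_pow_nonneg: "0 \<le> inner x (R ((co ^^ n) x))"
proof (induction n arbitrary: x rule: nat_less_induct)
  case (1 n)
  consider "n = 0" | "n = 1" | k where "n = Suc (Suc k)"
    by (metis One_nat_def not0_implies_Suc)
  then show ?case
  proof cases
    case 1
    then show ?thesis using pos pos_nonneg by auto
  next
    case 2
    have "(norm (R x))\<^sup>2 \<le> inner x (R x)" using pos_square_le[OF pos le_one] .
    then show ?thesis using 2
      by (simp add: co_def blinfun.diff_right inner_diff R_sa power2_norm_eq_inner)
  next
    case 3
    have "R ((co ^^ n) x) = co (R ((co ^^ k) (co x)))"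
      using 3 R_co[of 1] by (simp add: R_co funpow_swap1)
    then have "inner x (R ((co ^^ n) x)) = inner (co x) (R ((co ^^ k) (co x)))"
      using co_sa[of x 1 "R ((co ^^ k) (co x))"] by simp
    then show ?thesis using 1 3 by simp
  qed
qed

lemma R_ainv: "R (ainv n x) = x - (co ^^ n) x"
  by (induction n) (simp_all add: ainv_def blinfun.add_right, simp add: co_def)

lemma ainv_sa: "inner x (ainv n y) = inner (ainv n x) y"
  by (simp add: ainv_def inner_sum_left inner_sum_right co_sa)

lemma moment_antimono:
  assumes "m \<le> n" shows "inner x ((co ^^ n) x) \<le> inner x ((co ^^ m) x)"
  using assms
proof (induction n rule: dec_induct)
  case (step n)
  have "(co ^^ Suc n) x = (co ^^ n) x - R ((co ^^ n) x)" by (simp add: co_def[of "(co ^^ n) x"])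
  then show ?case using step R_co_pow_nonneg[of x n] by (simp add: inner_diff)
qed simp

text \<open>With C = (1 - R)^n, the squared norm of x - C x is |x|^2 - 2 <x, C x> + <x, C^2 x>, and
  0 \<le> C^2 \<le> C. The bound is uniform in n, although \<open>ainv n\<close> itself may blow
  up.\<close>

lemma norm_R_ainv_le: "norm (R (ainv n x)) \<le> norm x"
proof -
  have "(norm ((co ^^ n) x))\<^sup>2 = inner x ((co ^^ (n + n)) x)"
    using co_sa[of x n "(co ^^ n) x"] by (simp add: funpow_add power2_norm_eq_inner)
  also have "\<dots> \<le> inner x ((co ^^ n) x)" by (rule moment_antimono) simp
  finally have "(norm (x - (co ^^ n) x))\<^sup>2 \<le> (norm x)\<^sup>2"
    using co_pow_nonneg[of x n]
    by (simp add: power2_norm_eq_inner inner_diff inner_commute)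
  then show ?thesis by (simp add: R_ainv power2_le_iff_abs_le)
qed

text \<open>The numbers d(k) = <x, R (1 - R)^k x> decrease and telescope to a sum of at most |x|^2,
  so d(2n) \<le> |x|^2 / (2n + 1); the left-hand side is d(2n) - d(2n + 1). This elementary rate
  stands in for the spectral theorem.\<close>

lemma norm_R_co_pow_le: "(norm (R ((co ^^ n) x)))\<^sup>2 \<le> (norm x)\<^sup>2 / (2 * real n + 1)"
proof -
  define d where "d k = inner x (R ((co ^^ k) x))" for k
  have d_diff: "d k = inner x ((co ^^ k) x) - inner x ((co ^^ Suc k) x)" for k
    by (simp add: d_def co_def inner_diff)
  have d_step: "d (Suc k) = d k - inner (R x) ((co ^^ k) (R x))" for k
    by (simp add: d_def co_def R_co blinfun.diff_right inner_diff flip: R_sa)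
  have d_anti: "d m \<le> d k" if "k \<le> m" for k m
    using that
  proof (induction m rule: dec_induct)
    case (step m)
    then show ?case using co_pow_nonneg[of "R x" m] d_step[of m] by linarith
  qed simp
  have d_sum: "(\<Sum>k<m. d k) = (norm x)\<^sup>2 - inner x ((co ^^ m) x)" for m
    by (induction m) (simp_all add: d_diff power2_norm_eq_inner)
  have "(\<Sum>k<2 * n + 1. d k) \<le> (norm x)\<^sup>2"
    using co_pow_nonneg[of x "2 * n + 1"] d_sum[of "2 * n + 1"] by linarith
  moreover have "(\<Sum>k<2 * n + 1. d (2 * n)) \<le> (\<Sum>k<2 * n + 1. d k)"
    by (intro sum_mono d_anti) simp
  ultimately have *: "(2 * real n + 1) * d (2 * n) \<le> (norm x)\<^sup>2" by (simp add: algebra_simps)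
  have "(norm (R ((co ^^ n) x)))\<^sup>2 = inner (R x) ((co ^^ (n + n)) (R x))"
    using co_sa[of "R x" n "(co ^^ n) (R x)"]
    by (simp add: R_co funpow_add power2_norm_eq_inner)
  also have "\<dots> = d (2 * n) - d (Suc (2 * n))" using d_step[of "2 * n"] by (simp add: mult_2)
  also have "\<dots> \<le> d (2 * n)" using R_co_pow_nonneg[of x "Suc (2 * n)"] by (simp add: d_def)
  finally have "(2 * real n + 1) * (norm (R ((co ^^ n) x)))\<^sup>2 \<le> (2 * real n + 1) * d (2 * n)"
    by (rule mult_left_mono) simp
  from order_trans[OF this *] show ?thesis by (simp add: pos_le_divide_eq mult.commute)
qed

lemma R_co_pow_tendsto_0: "(\<lambda>n. R ((co ^^ n) x)) \<longlonglongrightarrow> 0"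
proof -
  have "(\<lambda>n. (norm x)\<^sup>2 / (2 * real n + 1)) \<longlonglongrightarrow> 0"
  proof -
    have "filterlim (\<lambda>n. 2 * n) sequentially sequentially"
      by (rule filterlim_subseq) (simp add: strict_mono_def)
    from filterlim_compose[OF LIMSEQ_inverse_real_of_nat this]
    have "(\<lambda>n. (norm x)\<^sup>2 * inverse (real (Suc (2 * n)))) \<longlonglongrightarrow> (norm x)\<^sup>2 * 0"
      by (intro tendsto_mult tendsto_const) (simp add: o_def)
    then show ?thesis by (simp add: divide_inverse add.commute)
  qed
  then have "(\<lambda>n. (norm (R ((co ^^ n) x)))\<^sup>2) \<longlonglongrightarrow> 0"
    by (rule tendsto_sandwich[OF _ _ tendsto_const, rotated 2]) (auto simp: norm_R_co_pow_le)
  then have "(\<lambda>n. sqrt ((norm (R ((co ^^ n) x)))\<^sup>2)) \<longlonglongrightarrow> sqrt 0" by (rule tendsto_real_sqrt)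
  then show ?thesis by (simp add: tendsto_norm_zero_iff)
qed

text \<open>In a complete space the hypothesis says that w lies in the image of the unit ball under
  R. Tested on v = (1 - R)^(2n) w, it bounds the squared norm of (1 - R)^n w by the norm of R (1 -
  R)^(2n) w.\<close>

lemma co_pow_tendsto_0:
  assumes "\<And>v. \<bar>inner v w\<bar> \<le> norm (R v)"
  shows "(\<lambda>n. (co ^^ n) w) \<longlonglongrightarrow> 0"
proof -
  have le: "(norm ((co ^^ n) w))\<^sup>2 \<le> norm (R ((co ^^ (n + n)) w))" for n
  proof -
    have "(norm ((co ^^ n) w))\<^sup>2 = inner ((co ^^ (n + n)) w) w"
      using co_sa[of w n "(co ^^ n) w"]
      by (simp add: funpow_add power2_norm_eq_inner inner_commute)
    then show ?thesis using assms[of "(co ^^ (n + n)) w"] by simp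
  qed
  have "filterlim (\<lambda>n. n + n) sequentially sequentially"
    by (rule filterlim_subseq) (simp add: strict_mono_def)
  from filterlim_compose[OF R_co_pow_tendsto_0 this, of w]
  have "(\<lambda>n. norm (R ((co ^^ (n + n)) w))) \<longlonglongrightarrow> 0" by (rule tendsto_norm_zero)
  then have "(\<lambda>n. (norm ((co ^^ n) w))\<^sup>2) \<longlonglongrightarrow> 0"
    by (rule tendsto_sandwich[OF _ _ tendsto_const, rotated 2]) (auto simp: le)
  then have "(\<lambda>n. sqrt ((norm ((co ^^ n) w))\<^sup>2)) \<longlonglongrightarrow> sqrt 0" by (rule tendsto_real_sqrt)
  then show ?thesis by (simp add: tendsto_norm_zero_iff)
qed

lemma R_ainv_tendsto:
  assumes "\<And>v. \<bar>inner v w\<bar> \<le> norm (R v)"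
  shows "(\<lambda>n. R (ainv n w)) \<longlonglongrightarrow> w"
  using tendsto_diff[OF tendsto_const co_pow_tendsto_0[OF assms], of w] by (simp add: R_ainv)

lemma RR_ainv_tendsto: "(\<lambda>n. R (R (ainv n x))) \<longlonglongrightarrow> R x"
  using tendsto_diff[OF tendsto_const R_co_pow_tendsto_0, of "R x" x]
  by (simp add: R_ainv blinfun.diff_right)

text \<open>For W the family w, the hypothesis says that W times its adjoint is at most R^2; the
  vectors \<open>ainv n (w e)\<close> approximate the inverse of R applied to W, which is then a
  contraction. Bessel's inequality is what is kept of a partial isometry.\<close>

lemma bessel_ainv:
  assumes "\<And>v. (\<Sum>e\<in>E. (inner v (w e))\<^sup>2) \<le> (norm (R v))\<^sup>2"
  shows "(\<Sum>e\<in>E. (inner v (ainv n (w e)))\<^sup>2) \<le> (norm v)\<^sup>2"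
proof -
  have "(\<Sum>e\<in>E. (inner v (ainv n (w e)))\<^sup>2) \<le> (norm (R (ainv n v)))\<^sup>2"
    using assms[of "ainv n v"] by (simp add: ainv_sa)
  also have "\<dots> \<le> (norm v)\<^sup>2" using norm_R_ainv_le by (simp add: power_mono)
  finally show ?thesis .
qed

end

subsection \<open>Overlaps and the trace norm\<close>

lemma has_sum_sum:
  fixes f :: "'i \<Rightarrow> 'j \<Rightarrow> 'b::topological_comm_monoid_add"
  assumes "\<And>i. i \<in> I \<Longrightarrow> (f i has_sum s i) A"
  shows "((\<lambda>j. \<Sum>i\<in>I. f i j) has_sum (\<Sum>i\<in>I. s i)) A"
  using assms by (induction I rule: infinite_finite_induct) (auto intro!: has_sum_add)

lemma has_sum_diff:
  fixes f g :: "'i \<Rightarrow> 'b::topological_ab_group_add"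
  assumes "(f has_sum s) A" "(g has_sum t) A"
  shows "((\<lambda>i. f i - g i) has_sum (s - t)) A"
  using has_sum_add[OF assms(1), of "\<lambda>i. - g i" "- t"] assms(2) by (simp add: has_sum_uminus)

text \<open>Writing T = S^2, the left side is the sum of |S (u e)|^2. Parseval expands it over b,
  and after exchanging the sums Bessel bounds each j-term by |S (b j)|^2. A Bessel family thus sees
  no more of T than an orthonormal basis does.\<close>

lemma bessel_trace_le:
  fixes T :: "'h::{real_inner,banach} \<Rightarrow>\<^sub>L 'h" and b :: "'j \<Rightarrow> 'h"
  assumes parseval: "\<And>x. ((\<lambda>j. (inner x (b j))\<^sup>2) has_sum (norm x)\<^sup>2) UNIV"
    and T: "pos T" and trace: "((\<lambda>j. inner (b j) (T (b j))) has_sum t) UNIV"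
    and fin: "finite E" and bessel: "\<And>v. (\<Sum>e\<in>E. (inner v (u e))\<^sup>2) \<le> (norm v)\<^sup>2"
  shows "(\<Sum>e\<in>E. inner (u e) (T (u e))) \<le> t"
proof -
  obtain S where S: "pos S" "S o\<^sub>L S = T" using pos_sqrt_exists[OF T] by blast
  have sa: "inner x (S y) = inner (S x) y" for x y using S pos_selfadjoint selfadjointD by blast
  have form: "inner x (T x) = (norm (S x))\<^sup>2" for x
    using S(2) by (auto simp: power2_norm_eq_inner simp flip: sa)
  have "((\<lambda>j. \<Sum>e\<in>E. (inner (S (u e)) (b j))\<^sup>2) has_sum (\<Sum>e\<in>E. (norm (S (u e)))\<^sup>2)) UNIV"
    by (intro has_sum_sum parseval)
  then have "(\<Sum>e\<in>E. (norm (S (u e)))\<^sup>2) \<le> t"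
  proof (rule has_sum_mono[OF _ trace])
    fix j
    have "inner (S (u e)) (b j) = inner (S (b j)) (u e)" for e
      using sa[of "u e" "b j"] by (simp add: inner_commute)
    then have "(\<Sum>e\<in>E. (inner (S (u e)) (b j))\<^sup>2) = (\<Sum>e\<in>E. (inner (S (b j)) (u e))\<^sup>2)" by simp
    also have "\<dots> \<le> (norm (S (b j)))\<^sup>2" by (rule bessel)
    finally show "(\<Sum>e\<in>E. (inner (S (u e)) (b j))\<^sup>2) \<le> inner (b j) (T (b j))" by (simp add: form)
  qed
  then show ?thesis by (simp add: form)
qed

lemma pos_form_amgm:
  assumes "pos T"
  shows "inner u (T v) \<le> (inner u (T u) + inner v (T v)) / 2"
  using pos_nonneg[OF assms, of "u - v"] selfadjointD[OF pos_selfadjoint[OF assms], of u v]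
  by (simp add: blinfun.diff_right inner_diff inner_commute)

lemma abs_inner_le_of_bessel:
  assumes "finite E" "e \<in> E" "(\<Sum>e\<in>E. (inner v (w e))\<^sup>2) \<le> (norm y)\<^sup>2"
  shows "\<bar>inner v (w e)\<bar> \<le> norm y"
proof -
  have "(inner v (w e))\<^sup>2 \<le> (\<Sum>e\<in>E. (inner v (w e))\<^sup>2)"
    using assms(1,2) by (intro member_le_sum) auto
  with assms(3) have "(inner v (w e))\<^sup>2 \<le> (norm y)\<^sup>2" by linarith
  then show ?thesis by (simp add: power2_le_iff_abs_le)
qed

text \<open>
  With polar decompositions \<open>W = R U\<^sup>*\<close> and \<open>R Z = T V\<^sup>*\<close>, one has \<open>tr (W\<^sup>* Z) = tr (U T V\<^sup>*)\<close>. The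
  partial isometries are replaced by the contractions that \<open>ainv\<close> provides.
\<close>

lemma overlap_le_trace:
  fixes R T :: "'h::{real_inner,banach} \<Rightarrow>\<^sub>L 'h" and b :: "'j \<Rightarrow> 'h" and w z :: "'e \<Rightarrow> 'h"
  assumes parseval: "\<And>x. ((\<lambda>j. (inner x (b j))\<^sup>2) has_sum (norm x)\<^sup>2) UNIV"
    and R: "pos_contraction R" and T: "pos_contraction T"
    and trace: "((\<lambda>j. inner (b j) (T (b j))) has_sum t) UNIV"
    and fin: "finite E"
    and w: "\<And>x. (\<Sum>e\<in>E. (inner x (w e))\<^sup>2) \<le> (norm (R x))\<^sup>2"
    and z: "\<And>x. (\<Sum>e\<in>E. (inner (R x) (z e))\<^sup>2) \<le> (norm (T x))\<^sup>2"
  shows "(\<Sum>e\<in>E. inner (w e) (z e)) \<le> t"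
proof -
  interpret R: pos_contraction R by fact
  interpret T: pos_contraction T by fact
  define u where "u m e = R.ainv m (w e)" for m e
  define k where "k e = R (z e)" for e
  define u' where "u' n e = T.ainv n (k e)" for n e
  have k: "(\<Sum>e\<in>E. (inner x (k e))\<^sup>2) \<le> (norm (T x))\<^sup>2" for x
    using z[of x] by (simp add: k_def R.R_sa)
  have bound: "(\<Sum>e\<in>E. inner (u m e) (T (u' n e))) \<le> t" for m n
  proof -
    have "(\<Sum>e\<in>E. inner (u m e) (T (u' n e)))
        \<le> (\<Sum>e\<in>E. (inner (u m e) (T (u m e)) + inner (u' n e) (T (u' n e))) / 2)"
      by (intro sum_mono pos_form_amgm T.pos)
    also have "\<dots> = ((\<Sum>e\<in>E. inner (u m e) (T (u m e))) + (\<Sum>e\<in>E. inner (u' n e) (T (u' n e)))) / 2"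
      by (simp add: sum.distrib flip: sum_divide_distrib)
    also have "\<dots> \<le> (t + t) / 2"
      unfolding u_def u'_def
      by (intro divide_right_mono add_mono bessel_trace_le[OF parseval T.pos trace fin]
          R.bessel_ainv[OF w] T.bessel_ainv[OF k]) simp
    finally show ?thesis by simp
  qed
  \<comment> \<open>As n grows, T (u' n e) tends to k e: by \<open>k\<close>, these vectors meet the
    domain condition for T.\<close>
  have bound2: "(\<Sum>e\<in>E. inner (u m e) (k e)) \<le> t" for m
  proof (rule LIMSEQ_le_const2)
    show "(\<lambda>n. \<Sum>e\<in>E. inner (u m e) (T (u' n e))) \<longlonglongrightarrow> (\<Sum>e\<in>E. inner (u m e) (k e))"
      unfolding u'_def
      by (intro tendsto_sum tendsto_inner tendsto_const T.R_ainv_tendsto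
          abs_inner_le_of_bessel[OF fin _ k])
  qed (use bound in blast)
  \<comment> \<open>Now R moves from k e = R (z e) onto u m e, and R (u m e) tends to w e.\<close>
  show ?thesis
  proof (rule LIMSEQ_le_const2)
    have "(\<lambda>m. \<Sum>e\<in>E. inner (R (u m e)) (z e)) \<longlonglongrightarrow> (\<Sum>e\<in>E. inner (w e) (z e))"
      unfolding u_def
      by (intro tendsto_sum tendsto_inner tendsto_const R.R_ainv_tendsto
          abs_inner_le_of_bessel[OF fin _ w])
    then show "(\<lambda>m. \<Sum>e\<in>E. inner (u m e) (k e)) \<longlonglongrightarrow> (\<Sum>e\<in>E. inner (w e) (z e))"
      by (simp add: k_def R.R_sa)
  qed (use bound2 in blast)
qed

text \<open>Bessel says that taking coefficients against u is a contraction; this is the same bound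
  for its adjoint, obtained by testing Bessel on the sum itself.\<close>

lemma norm_sum_scaleR_le_of_bessel:
  assumes bessel: "\<And>v. (\<Sum>e\<in>E. (inner v (u e))\<^sup>2) \<le> (norm v)\<^sup>2"
  shows "(norm (\<Sum>e\<in>E. c e *\<^sub>R u e))\<^sup>2 \<le> (\<Sum>e\<in>E. (c e)\<^sup>2)"
proof -
  define s where "s = (\<Sum>e\<in>E. c e *\<^sub>R u e)"
  have "(norm s)\<^sup>2 = (\<Sum>e\<in>E. c e * inner s (u e))"
    unfolding power2_norm_eq_inner by (subst (2) s_def) (simp add: inner_sum_right)
  also have "\<dots> \<le> (\<Sum>e\<in>E. ((c e)\<^sup>2 + (inner s (u e))\<^sup>2) / 2)"
  proof (rule sum_mono)
    fix e show "c e * inner s (u e) \<le> ((c e)\<^sup>2 + (inner s (u e))\<^sup>2) / 2"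
      using sum_squares_bound[of "c e" "inner s (u e)"] by simp
  qed
  also have "\<dots> = ((\<Sum>e\<in>E. (c e)\<^sup>2) + (\<Sum>e\<in>E. (inner s (u e))\<^sup>2)) / 2"
    by (simp add: sum.distrib flip: sum_divide_distrib)
  also have "\<dots> \<le> ((\<Sum>e\<in>E. (c e)\<^sup>2) + (norm s)\<^sup>2) / 2" using bessel[of s] by simp
  finally show ?thesis by (simp add: s_def)
qed

text \<open>Write ' for adjoints and Z for the family z. Then T^2 = R Z Z' R, so T = R Z U' with U a
  partial isometry, and AM-GM on <R (b j), Z U' (b j)> bounds the trace by the mean of the squared
  Hilbert-Schmidt norms of Z and R. This is what makes the trace in the fidelity a convergent
  sum.\<close>

lemma trace_bounded:
  fixes R T :: "'h::{real_inner,banach} \<Rightarrow>\<^sub>L 'h" and b :: "'j \<Rightarrow> 'h" and z :: "'e \<Rightarrow> 'h"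
  assumes parseval: "\<And>x. ((\<lambda>j. (inner x (b j))\<^sup>2) has_sum (norm x)\<^sup>2) UNIV"
    and R: "pos R" and T: "pos_contraction T"
    and z: "\<And>x. ((\<lambda>e. (inner (R x) (z e))\<^sup>2) has_sum (norm (T x))\<^sup>2) UNIV"
    and zb: "\<And>E. finite E \<Longrightarrow> (\<Sum>e\<in>E. (norm (z e))\<^sup>2) \<le> c"
    and Rb: "\<And>F. finite F \<Longrightarrow> (\<Sum>j\<in>F. (norm (R (b j)))\<^sup>2) \<le> c'"
    and F: "finite F"
  shows "(\<Sum>j\<in>F. inner (b j) (T (b j))) \<le> (c + c') / 2"
proof -
  interpret T: pos_contraction T by fact
  have R_sa: "inner x (R y) = inner (R x) y" for x y
    using R pos_selfadjoint selfadjointD by blast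
  define k where "k e = R (z e)" for e
  have k: "((\<lambda>e. (inner x (k e))\<^sup>2) has_sum (norm (T x))\<^sup>2) UNIV" for x
    using z[of x] by (simp add: k_def R_sa)
  \<comment> \<open>Polarization turns the identity for squares into one for products.\<close>
  have k2: "((\<lambda>e. inner x (k e) * inner y (k e)) has_sum inner (T x) (T y)) UNIV" for x y
  proof -
    have "((\<lambda>e. ((inner (x + y) (k e))\<^sup>2 - (inner (x - y) (k e))\<^sup>2) / 4)
        has_sum ((norm (T (x + y)))\<^sup>2 - (norm (T (x - y)))\<^sup>2) / 4) UNIV"
      by (intro has_sum_divide_const has_sum_diff k)
    moreover have "((norm (T (x + y)))\<^sup>2 - (norm (T (x - y)))\<^sup>2) / 4 = inner (T x) (T y)"
      unfolding power2_norm_eq_inner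
      by (simp add: blinfun.bilinear_simps inner_add inner_diff inner_commute)
    moreover have "((inner (x + y) v)\<^sup>2 - (inner (x - y) v)\<^sup>2) / 4 = inner x v * inner y v" for v
      by (simp add: inner_add inner_diff power2_eq_square algebra_simps)
    ultimately show ?thesis by simp
  qed
  define u where "u n e = T.ainv n (k e)" for n e
  have bess: "(\<Sum>e\<in>E. (inner v (u n e))\<^sup>2) \<le> (norm v)\<^sup>2" if "finite E" for n v E
    unfolding u_def using k that
    by (intro T.bessel_ainv) (auto intro!: finite_sum_le_has_sum)
  have fin: "(\<Sum>e\<in>E. \<Sum>j\<in>F. inner (R (b j)) (z e) * inner (b j) (u n e)) \<le> (c + c') / 2"
    if E: "finite E" for E n
  proof -
    define y where "y j = (\<Sum>e\<in>E. inner (b j) (u n e) *\<^sub>R z e)" for j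
    have "(\<Sum>e\<in>E. \<Sum>j\<in>F. inner (R (b j)) (z e) * inner (b j) (u n e)) = (\<Sum>j\<in>F. inner (R (b j)) (y j))"
      unfolding y_def by (subst sum.swap) (simp add: inner_sum_right mult.commute)
    also have "\<dots> \<le> (\<Sum>j\<in>F. ((norm (y j))\<^sup>2 + (norm (R (b j)))\<^sup>2) / 2)"
    proof (rule sum_mono)
      fix j
      have "0 \<le> (norm (R (b j) - y j))\<^sup>2" by simp
      then show "inner (R (b j)) (y j) \<le> ((norm (y j))\<^sup>2 + (norm (R (b j)))\<^sup>2) / 2"
        unfolding power2_norm_eq_inner by (simp add: inner_diff inner_commute)
    qed
    also have "\<dots> = ((\<Sum>j\<in>F. (norm (y j))\<^sup>2) + (\<Sum>j\<in>F. (norm (R (b j)))\<^sup>2)) / 2"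
      by (simp add: sum.distrib flip: sum_divide_distrib)
    \<comment> \<open>The Hilbert-Schmidt norm of Z U' is computed on its adjoint: s below is U Z'
      (b i), and Bessel makes U a contraction.\<close>
    also have "(\<Sum>j\<in>F. (norm (y j))\<^sup>2) \<le> c"
    proof -
      have "((\<lambda>i. \<Sum>j\<in>F. (inner (y j) (b i))\<^sup>2) has_sum (\<Sum>j\<in>F. (norm (y j))\<^sup>2)) UNIV"
        by (intro has_sum_sum parseval)
      moreover have "((\<lambda>i. \<Sum>e\<in>E. (inner (z e) (b i))\<^sup>2) has_sum (\<Sum>e\<in>E. (norm (z e))\<^sup>2)) UNIV"
        by (intro has_sum_sum parseval)
      moreover have "(\<Sum>j\<in>F. (inner (y j) (b i))\<^sup>2) \<le> (\<Sum>e\<in>E. (inner (z e) (b i))\<^sup>2)" for i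
      proof -
        define s where "s = (\<Sum>e\<in>E. inner (z e) (b i) *\<^sub>R u n e)"
        have "(\<Sum>j\<in>F. (inner (y j) (b i))\<^sup>2) = (\<Sum>j\<in>F. (inner s (b j))\<^sup>2)"
          proof (rule sum.cong)
            fix j
            have "inner (y j) (b i) = (\<Sum>e\<in>E. inner (b j) (u n e) * inner (z e) (b i))"
              by (simp add: y_def inner_sum_left)
            also have "\<dots> = inner s (b j)"
              by (simp add: s_def inner_sum_left inner_commute[of "b j"] mult.commute)
            finally show "(inner (y j) (b i))\<^sup>2 = (inner s (b j))\<^sup>2" by simp
          qed simp
        also have "\<dots> \<le> (norm s)\<^sup>2" by (rule finite_sum_le_has_sum[OF parseval F]) auto
        also have "\<dots> \<le> (\<Sum>e\<in>E. (inner (z e) (b i))\<^sup>2)"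
          unfolding s_def by (intro norm_sum_scaleR_le_of_bessel bess E)
        finally show ?thesis .
      qed
      ultimately have "(\<Sum>j\<in>F. (norm (y j))\<^sup>2) \<le> (\<Sum>e\<in>E. (norm (z e))\<^sup>2)"
        by (rule has_sum_mono)
      then show ?thesis using zb[OF E] by linarith
    qed
    finally show ?thesis using Rb[OF F] by simp
  qed
  \<comment> \<open>Letting E exhaust all labels turns the double sum into the trace over F of T^2
    \<open>ainv n\<close>, whose limit in n is that of T.\<close>
  have le: "(\<Sum>j\<in>F. inner (T (b j)) (T (T.ainv n (b j)))) \<le> (c + c') / 2" for n
  proof -
    have "((\<lambda>e. \<Sum>j\<in>F. inner (R (b j)) (z e) * inner (b j) (u n e))
        has_sum (\<Sum>j\<in>F. inner (T (b j)) (T (T.ainv n (b j))))) UNIV"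
      using k2[of _ "T.ainv n _"]
      by (intro has_sum_sum) (simp add: u_def k_def R_sa T.ainv_sa)
    then show ?thesis by (rule has_sum_le_finite_sums) (use fin in blast)
  qed
  show ?thesis
  proof (rule LIMSEQ_le_const2)
    show "(\<lambda>n. \<Sum>j\<in>F. inner (b j) (T (T (T.ainv n (b j))))) \<longlonglongrightarrow> (\<Sum>j\<in>F. inner (b j) (T (b j)))"
      by (intro tendsto_sum tendsto_inner tendsto_const T.RR_ainv_tendsto)
    show "\<exists>N. \<forall>n\<ge>N. (\<Sum>j\<in>F. inner (b j) (T (T (T.ainv n (b j))))) \<le> (c + c') / 2"
      using le by (simp add: T.R_sa)
  qed
qed

section \<open>Kernels on ell2 as bounded operators on a real Hilbert space\<close>

subsection \<open>The Hilbert space \<open>\<ell>\<^sup>2\<close>\<close>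

lemma zero_in_ell2: "(\<lambda>_. 0) \<in> ell2 I"
  by (simp add: ell2_def)

lemma ell2_comparison:
  assumes "f \<in> ell2 I" "\<And>i. i \<in> I \<Longrightarrow> cmod (g i) \<le> C * cmod (f i)"
  shows "g \<in> ell2 I"
proof -
  have "(\<lambda>i. C\<^sup>2 * (cmod (f i))\<^sup>2) summable_on I"
    using assms(1) by (intro summable_on_cmult_right) (simp add: ell2_def)
  then show ?thesis
    unfolding ell2_def mem_Collect_eq
  proof (rule summable_on_comparison_test)
    fix i assume "i \<in> I"
    from power_mono[OF assms(2)[OF this], of 2]
    show "(cmod (g i))\<^sup>2 \<le> C\<^sup>2 * (cmod (f i))\<^sup>2" by (simp add: power_mult_distrib)
  qed simp
qed

lemma ell2_add:
  assumes "f \<in> ell2 I" "g \<in> ell2 I"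
  shows "(\<lambda>i. f i + g i) \<in> ell2 I"
proof -
  have "(\<lambda>i. 2 * (cmod (f i))\<^sup>2 + 2 * (cmod (g i))\<^sup>2) summable_on I"
    using assms by (intro summable_on_add summable_on_cmult_right) (simp_all add: ell2_def)
  then show ?thesis
    unfolding ell2_def mem_Collect_eq
  proof (rule summable_on_comparison_test)
    fix i
    have "(cmod (f i + g i))\<^sup>2 \<le> (cmod (f i) + cmod (g i))\<^sup>2"
      by (intro power_mono norm_triangle_ineq) simp
    also have "\<dots> \<le> 2 * (cmod (f i))\<^sup>2 + 2 * (cmod (g i))\<^sup>2"
      using zero_le_power2[of "cmod (f i) - cmod (g i)"]
      unfolding power2_sum power2_diff by linarith
    finally show "(cmod (f i + g i))\<^sup>2 \<le> 2 * (cmod (f i))\<^sup>2 + 2 * (cmod (g i))\<^sup>2" .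
  qed simp
qed

lemma ell2_cmult: "f \<in> ell2 I \<Longrightarrow> (\<lambda>i. c * f i) \<in> ell2 I"
  by (rule ell2_comparison[of f _ _ "cmod c"]) (simp_all add: norm_mult)

lemma ell2_inner_summable:
  assumes "f \<in> ell2 I" "g \<in> ell2 I"
  shows "(\<lambda>i. inner (f i) (g i)) summable_on I"
proof (rule abs_summable_summable, rule summable_on_comparison_test)
  show "(\<lambda>i. (cmod (f i))\<^sup>2 + (cmod (g i))\<^sup>2) summable_on I"
    using assms by (intro summable_on_add) (simp_all add: ell2_def)
  fix i
  have "norm (inner (f i) (g i)) \<le> cmod (f i) * cmod (g i)" using Cauchy_Schwarz_ineq2 by simp
  also have "\<dots> \<le> (cmod (f i))\<^sup>2 + (cmod (g i))\<^sup>2"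
    using sum_squares_bound[of "cmod (f i)" "cmod (g i)"]
      mult_nonneg_nonneg[OF norm_ge_zero[of "f i"] norm_ge_zero[of "g i"]]
    unfolding mult.assoc by linarith
  finally show "norm (inner (f i) (g i)) \<le> (cmod (f i))\<^sup>2 + (cmod (g i))\<^sup>2" .
qed simp

lemma ell2_subset: "f \<in> ell2 J \<Longrightarrow> I \<subseteq> J \<Longrightarrow> f \<in> ell2 I"
  unfolding ell2_def by (auto intro: summable_on_subset_banach)

text \<open>Indexed by the whole type: a subset I enters only through kernels supported on it, which
  spares one Hilbert space per index set.\<close>

typedef 'i l2 = "ell2 (UNIV :: 'i set)" morphisms coord Abs_l2
  using zero_in_ell2 by blast

lemmas coord_in_ell2 = coord

lemma coord_Abs_l2 [simp]: "f \<in> ell2 UNIV \<Longrightarrow> coord (Abs_l2 f) = f"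
  by (rule Abs_l2_inverse)

lemma l2_eqI: "(\<And>i. coord f i = coord g i) \<Longrightarrow> f = g"
  by (simp add: coord_inject[symmetric] fun_eq_iff)

instantiation l2 :: (type) real_vector
begin

definition "0 = Abs_l2 (\<lambda>_. 0)"
definition "f + g = Abs_l2 (\<lambda>i. coord f i + coord g i)"
definition "- f = Abs_l2 (\<lambda>i. - coord f i)"
definition "f - g = f + - (g :: 'a l2)"
definition "r *\<^sub>R f = Abs_l2 (\<lambda>i. of_real r * coord f i)"

lemma coord_zero: "coord 0 i = 0"
  by (simp add: zero_l2_def zero_in_ell2)

lemma coord_add: "coord (f + g) i = coord f i + coord g i"
  by (simp add: plus_l2_def ell2_add coord_in_ell2)

lemma coord_uminus: "coord (- f) i = - coord f i"
  using ell2_cmult[OF coord_in_ell2[of f], of "-1"] by (simp add: uminus_l2_def)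

lemma coord_diff: "coord (f - g) i = coord f i - coord g i"
  by (simp add: minus_l2_def coord_add coord_uminus)

lemma coord_scaleR: "coord (r *\<^sub>R f) i = of_real r * coord f i"
  by (simp add: scaleR_l2_def ell2_cmult coord_in_ell2)

instance
  by standard
    (auto intro!: l2_eqI simp: coord_add coord_zero coord_uminus coord_diff coord_scaleR algebra_simps)

end

text \<open>The inner product is the real part of the complex one: \<open>\<ell>\<^sup>2\<close> becomes a real Hilbert space.\<close>

instantiation l2 :: (type) real_inner
begin

definition "inner f g = (\<Sum>\<^sub>\<infinity>i. inner (coord f i) (coord g i))"
definition "norm f = sqrt (inner f (f :: 'a l2))"
definition "sgn f = f /\<^sub>R norm (f :: 'a l2)"
definition "dist f g = norm (f - g :: 'a l2)"
definition [code del]: "(uniformity :: ('a l2 \<times> 'a l2) filter) = (INF e\<in>{0<..}. principal {(x, y). dist x y < e})"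
definition [code del]: "open (U :: 'a l2 set) = (\<forall>x\<in>U. eventually (\<lambda>(x', y). x' = x \<longrightarrow> y \<in> U) uniformity)"

lemma inner_l2_has_sum: "((\<lambda>i. inner (coord f i) (coord g i)) has_sum inner f g) UNIV"
  by (simp add: inner_l2_def ell2_inner_summable coord_in_ell2)

instance
proof
  fix f g h :: "'a l2" and r :: real
  show "dist f g = norm (f - g)" by (rule dist_l2_def)
  show "sgn f = f /\<^sub>R norm f" by (rule sgn_l2_def)
  show "(uniformity :: ('a l2 \<times> 'a l2) filter) = (INF e\<in>{0<..}. principal {(x, y). dist x y < e})"
    by (rule uniformity_l2_def)
  show "open U \<longleftrightarrow> (\<forall>x\<in>U. eventually (\<lambda>(x', y). x' = x \<longrightarrow> y \<in> U) uniformity)" for U :: "'a l2 set"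
    by (rule open_l2_def)
  show "inner f g = inner g f" by (simp add: inner_l2_def inner_commute)
  show "inner (f + g) h = inner f h + inner g h"
  proof (rule has_sum_unique[OF inner_l2_has_sum])
    show "((\<lambda>i. inner (coord (f + g) i) (coord h i)) has_sum (inner f h + inner g h)) UNIV"
      using has_sum_add[OF inner_l2_has_sum[of f h] inner_l2_has_sum[of g h]]
      by (simp add: coord_add inner_add_left)
  qed
  show "inner (r *\<^sub>R f) g = r * inner f g"
  proof (rule has_sum_unique[OF inner_l2_has_sum])
    show "((\<lambda>i. inner (coord (r *\<^sub>R f) i) (coord g i)) has_sum (r * inner f g)) UNIV"
      using has_sum_cmult_right[OF inner_l2_has_sum[of f g], of r]
      by (simp add: coord_scaleR flip: scaleR_conv_of_real)
  qed
  show "0 \<le> inner f f" unfolding inner_l2_def by (rule infsum_nonneg) simp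
  show "inner f f = 0 \<longleftrightarrow> f = 0"
  proof
    assume "inner f f = 0"
    then have "((\<lambda>i. inner (coord f i) (coord f i)) has_sum 0) UNIV" using inner_l2_has_sum[of f f] by simp
    then have "inner (coord f i) (coord f i) = 0" for i
      by (rule nonneg_has_sum_le_0D) auto
    then show "f = 0" by (intro l2_eqI) (simp add: coord_zero)
  qed (simp add: inner_l2_def coord_zero)
  show "norm f = sqrt (inner f f)" by (rule norm_l2_def)
qed

end

lemma norm_l2_has_sum: "((\<lambda>i. (cmod (coord f i))\<^sup>2) has_sum (norm f)\<^sup>2) UNIV"
  using inner_l2_has_sum[of f f] by (simp add: power2_norm_eq_inner)

lemma sum_coord_le_norm:
  assumes "finite F" shows "(\<Sum>i\<in>F. (cmod (coord f i))\<^sup>2) \<le> (norm f)\<^sup>2"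
  by (rule finite_sum_le_has_sum[OF norm_l2_has_sum assms]) auto

lemma norm_coord_le: "cmod (coord f i) \<le> norm f"
  using sum_coord_le_norm[of "{i}" f] by (simp add: power2_le_iff_abs_le)

lemma coord_bounded_linear: "bounded_linear (\<lambda>f. coord f i)"
  by (rule bounded_linear_intro[where K = 1])
    (auto simp: coord_add coord_scaleR norm_coord_le scaleR_conv_of_real)

lemma norm_l2_le:
  assumes "0 \<le> c" "\<And>F. finite F \<Longrightarrow> (\<Sum>i\<in>F. (cmod (coord f i))\<^sup>2) \<le> c\<^sup>2"
  shows "norm f \<le> c"
proof -
  have "(norm f)\<^sup>2 \<le> c\<^sup>2"
    using norm_l2_has_sum by (rule has_sum_le_finite_sums) (use assms in blast)
  then show ?thesis using assms(1) by (rule power2_le_imp_le)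
qed

instance l2 :: (type) banach
proof
  fix X :: "nat \<Rightarrow> 'a l2"
  assume X: "Cauchy X"
  have "Cauchy (\<lambda>n. coord (X n) i)" for i
    using X by (rule bounded_linear.Cauchy[OF coord_bounded_linear])
  then have "\<exists>l. (\<lambda>n. coord (X n) i) \<longlonglongrightarrow> l" for i
    by (simp add: Cauchy_convergent_iff convergent_def)
  then obtain l where l: "\<And>i. (\<lambda>n. coord (X n) i) \<longlonglongrightarrow> l i" by metis
  \<comment> \<open>The bound is uniform over finite F, so the coordinatewise limit in m can be
    taken before l is known to be square summable.\<close>
  have close: "\<exists>M. \<forall>n\<ge>M. \<forall>F. finite F \<longrightarrow> (\<Sum>i\<in>F. (cmod (coord (X n) i - l i))\<^sup>2) \<le> e\<^sup>2"
    if "0 < e" for e :: real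
  proof -
    obtain M where M: "\<And>m n. m \<ge> M \<Longrightarrow> n \<ge> M \<Longrightarrow> norm (X m - X n) < e"
      using CauchyD[OF X \<open>0 < e\<close>] by blast
    have "(\<Sum>i\<in>F. (cmod (coord (X n) i - l i))\<^sup>2) \<le> e\<^sup>2" if "n \<ge> M" "finite F" for n F
    proof (rule LIMSEQ_le_const2)
      show "(\<lambda>m. \<Sum>i\<in>F. (cmod (coord (X n) i - coord (X m) i))\<^sup>2) \<longlonglongrightarrow> (\<Sum>i\<in>F. (cmod (coord (X n) i - l i))\<^sup>2)"
        by (intro tendsto_intros l)
      have "(\<Sum>i\<in>F. (cmod (coord (X n) i - coord (X m) i))\<^sup>2) \<le> e\<^sup>2" if "m \<ge> M" for m
      proof -
        have "(\<Sum>i\<in>F. (cmod (coord (X n - X m) i))\<^sup>2) \<le> (norm (X n - X m))\<^sup>2"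
          by (rule sum_coord_le_norm) fact
        also have "\<dots> \<le> e\<^sup>2"
          using M[OF \<open>n \<ge> M\<close> that] by (intro power_mono) auto
        finally show ?thesis by (simp add: coord_diff)
      qed
      then show "\<exists>N. \<forall>m\<ge>N. (\<Sum>i\<in>F. (cmod (coord (X n) i - coord (X m) i))\<^sup>2) \<le> e\<^sup>2" by blast
    qed
    then show ?thesis by blast
  qed
  from close[of 1] obtain M where
    M: "\<And>F. finite F \<Longrightarrow> (\<Sum>i\<in>F. (cmod (coord (X M) i - l i))\<^sup>2) \<le> 1" by force
  have "(\<lambda>i. coord (X M) i - l i) \<in> ell2 UNIV"
    unfolding ell2_def mem_Collect_eq
    by (rule nonneg_bdd_above_summable_on) (auto intro!: bdd_aboveI M)
  then have "(\<lambda>i. coord (X M) i + (- 1) * (coord (X M) i - l i)) \<in> ell2 UNIV"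
    by (intro ell2_add ell2_cmult coord_in_ell2)
  then have l2: "l \<in> ell2 UNIV" by simp
  have "X \<longlonglongrightarrow> Abs_l2 l"
  proof (rule LIMSEQ_I)
    fix r :: real assume "0 < r"
    then obtain M where M: "\<And>n F. n \<ge> M \<Longrightarrow> finite F \<Longrightarrow> (\<Sum>i\<in>F. (cmod (coord (X n) i - l i))\<^sup>2) \<le> (r/2)\<^sup>2"
      using close[of "r/2"] by force
    have "norm (X n - Abs_l2 l) \<le> r/2" if "n \<ge> M" for n
      using M[OF that] \<open>0 < r\<close> l2 by (intro norm_l2_le) (simp_all add: coord_diff)
    then show "\<exists>no. \<forall>n\<ge>no. norm (X n - Abs_l2 l) < r"
      using \<open>0 < r\<close> by (intro exI[of _ M]) force
  qed
  then show "convergent X" by (auto simp: convergent_def)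
qed

subsection \<open>Complex structure and the standard basis\<close>

definition imul :: "'i l2 \<Rightarrow> 'i l2" where
  "imul f = Abs_l2 (\<lambda>i. \<i> * coord f i)"

lemma coord_imul: "coord (imul f) i = \<i> * coord f i"
  by (simp add: imul_def ell2_cmult coord_in_ell2)

lemma imul_add: "imul (f + g) = imul f + imul g"
  and imul_diff: "imul (f - g) = imul f - imul g"
  and imul_scaleR: "imul (r *\<^sub>R f) = r *\<^sub>R imul f"
  and imul_imul [simp]: "imul (imul f) = - f"
  by (auto intro!: l2_eqI simp: coord_imul coord_add coord_diff coord_scaleR coord_uminus algebra_simps)

lemma inner_imul_imul [simp]: "inner (imul f) (imul g) = inner f g"
  by (simp add: inner_l2_def coord_imul inner_complex_def add.commute)

lemma inner_imul_left: "inner (imul f) g = - inner f (imul g)"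
  using inner_imul_imul[of "imul f" g] by simp

lemma inner_imul_self [simp]: "inner (imul f) f = 0" "inner f (imul f) = 0"
  using inner_imul_left[of f f] by (simp_all add: inner_commute)

lemma norm_imul [simp]: "norm (imul f) = norm f"
  by (simp add: norm_eq_sqrt_inner)

definition imul_op :: "'i l2 \<Rightarrow>\<^sub>L 'i l2" where
  "imul_op = Blinfun imul"

lemma imul_op [simp]: "blinfun_apply imul_op f = imul f"
  unfolding imul_op_def
  by (subst bounded_linear_Blinfun_apply)
    (auto intro!: bounded_linear_intro[where K = 1] simp: imul_add imul_scaleR)

definition unit :: "'i \<Rightarrow> 'i l2" where
  "unit i = Abs_l2 (\<lambda>j. if j = i then 1 else 0)"

lemma coord_unit: "coord (unit i) j = (if j = i then 1 else 0)"
proof -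
  have "(\<lambda>j. if j = i then 1 else 0 :: complex) \<in> ell2 UNIV"
    unfolding ell2_def mem_Collect_eq
    by (rule finite_nonzero_values_imp_summable_on) (simp add: if_distrib cong: if_cong)
  then show ?thesis by (simp add: unit_def)
qed

lemma inner_unit: "inner f (unit i) = Re (coord f i)"
proof -
  have "inner f (unit i) = (\<Sum>\<^sub>\<infinity>j\<in>{i}. inner (coord f j) (coord (unit i) j))"
    unfolding inner_l2_def by (rule infsum_cong_neutral) (auto simp: coord_unit)
  then show ?thesis by (simp add: coord_unit inner_complex_def)
qed

lemma inner_imul_unit: "inner f (imul (unit i)) = Im (coord f i)"
  using inner_imul_left[of f "unit i"] by (simp add: inner_unit coord_imul)

text \<open>An orthonormal basis of the underlying real space. Every complex basis vector
  contributes two, so real traces are twice the real parts of the complex ones.\<close>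

definition real_basis :: "'i \<times> bool \<Rightarrow> 'i l2" where
  "real_basis p = (if snd p then imul (unit (fst p)) else unit (fst p))"

lemma sum_bool: "(\<Sum>c\<in>(UNIV::bool set). f c) = f False + f True"
  by (simp add: UNIV_bool)

lemma has_sum_bool_iff:
  fixes f :: "'i \<times> bool \<Rightarrow> real"
  assumes "\<And>p. 0 \<le> f p"
  shows "(f has_sum s) UNIV \<longleftrightarrow> ((\<lambda>i. f (i, False) + f (i, True)) has_sum s) UNIV"
proof -
  have inner: "((\<lambda>c. f (i, c)) has_sum f (i, False) + f (i, True)) UNIV" for i
    by (rule has_sum_finiteI) (simp_all add: sum_bool)
  show ?thesis
    unfolding UNIV_Times_UNIV[symmetric]
  proof
    assume "(f has_sum s) (UNIV \<times> UNIV)"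
    then show "((\<lambda>i. f (i, False) + f (i, True)) has_sum s) UNIV"
      by (rule has_sum_SigmaD) (use inner in simp)
  next
    assume *: "((\<lambda>i. f (i, False) + f (i, True)) has_sum s) UNIV"
    show "(f has_sum s) (UNIV \<times> UNIV)"
      by (rule has_sum_SigmaI[OF inner *], rule summable_on_SigmaI[OF inner])
        (use * assms in \<open>auto simp: has_sum_imp_summable\<close>)
  qed
qed

lemma real_basis_parseval: "((\<lambda>p. (inner f (real_basis p))\<^sup>2) has_sum (norm f)\<^sup>2) UNIV"
  by (subst has_sum_bool_iff)
    (use norm_l2_has_sum[of f] in \<open>simp_all add: real_basis_def inner_unit inner_imul_unit cmod_power2\<close>)

text \<open>Convergence is in norm, so that bounded operators can be applied term by term; this
  recovers an operator from its kernel. By Pythagoras the squared error of a finite partial sum is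
  the rest of the sum for |f|^2.\<close>

lemma l2_has_sum_unit:
  "((\<lambda>i. Re (coord f i) *\<^sub>R unit i + Im (coord f i) *\<^sub>R imul (unit i)) has_sum f) UNIV"
proof -
  define g where "g i = Re (coord f i) *\<^sub>R unit i + Im (coord f i) *\<^sub>R imul (unit i)" for i
  have inner_g: "inner h (g i) = Re (coord f i) * Re (coord h i) + Im (coord f i) * Im (coord h i)" for h i
    by (simp add: g_def inner_add_right inner_unit inner_imul_unit)
  have coord_g: "coord (g i) j = (if j = i then coord f i else 0)" for i j
    by (simp add: g_def coord_add coord_scaleR coord_imul coord_unit complex_eq_iff)
  have coord_sum: "coord (sum h F) j = (\<Sum>i\<in>F. coord (h i) j)" for h :: "'a \<Rightarrow> 'a l2" and F j
    by (rule linear_sum[OF bounded_linear.linear[OF coord_bounded_linear]])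
  have norm_eq: "(norm (f - sum g F))\<^sup>2 = (norm f)\<^sup>2 - (\<Sum>i\<in>F. (cmod (coord f i))\<^sup>2)" if "finite F" for F
  proof -
    have "inner f (sum g F) = (\<Sum>i\<in>F. (cmod (coord f i))\<^sup>2)"
      by (simp add: inner_sum_right inner_g cmod_power2 flip: power2_eq_square)
    moreover have "inner (sum g F) (sum g F) = (\<Sum>i\<in>F. (cmod (coord f i))\<^sup>2)"
      using that by (simp add: inner_sum_right inner_g coord_sum coord_g cmod_power2 flip: power2_eq_square)
    ultimately show ?thesis
      by (simp add: power2_norm_eq_inner inner_diff inner_commute)
  qed
  have "((\<lambda>F. (norm f)\<^sup>2 - (\<Sum>i\<in>F. (cmod (coord f i))\<^sup>2)) \<longlongrightarrow> (norm f)\<^sup>2 - (norm f)\<^sup>2)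
      (finite_subsets_at_top UNIV)"
    using norm_l2_has_sum[of f] unfolding has_sum_def by (intro tendsto_diff tendsto_const)
  moreover have "\<forall>\<^sub>F F in finite_subsets_at_top UNIV.
      (norm f)\<^sup>2 - (\<Sum>i\<in>F. (cmod (coord f i))\<^sup>2) = (norm (f - sum g F))\<^sup>2"
    by (intro eventually_finite_subsets_at_top_weakI) (simp add: norm_eq)
  ultimately have "((\<lambda>F. (norm (f - sum g F))\<^sup>2) \<longlongrightarrow> (norm f)\<^sup>2 - (norm f)\<^sup>2) (finite_subsets_at_top UNIV)"
    by (rule Lim_transform_eventually)
  then have "((\<lambda>F. (norm (f - sum g F))\<^sup>2) \<longlongrightarrow> 0) (finite_subsets_at_top UNIV)" by simp
  then have "((\<lambda>F. sqrt ((norm (f - sum g F))\<^sup>2)) \<longlongrightarrow> sqrt 0) (finite_subsets_at_top UNIV)"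
    by (rule tendsto_real_sqrt)
  then have "((\<lambda>F. norm (sum g F - f)) \<longlongrightarrow> 0) (finite_subsets_at_top UNIV)"
    by (simp add: norm_minus_commute)
  then have "(sum g \<longlongrightarrow> f) (finite_subsets_at_top UNIV)"
    using Lim_null tendsto_norm_zero_iff by blast
  then show ?thesis unfolding has_sum_def g_def .
qed

subsection \<open>Kernels as complex-linear operators\<close>

definition clinear :: "('i l2 \<Rightarrow>\<^sub>L 'i l2) \<Rightarrow> bool" where
  "clinear L \<longleftrightarrow> commutes L imul_op"

definition kern :: "('i l2 \<Rightarrow>\<^sub>L 'i l2) \<Rightarrow> ('i, 'i) kernel" where
  "kern L i j = coord (L (unit j)) i"

definition supported :: "'i set \<Rightarrow> ('i, 'i) kernel \<Rightarrow> bool" where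
  "supported I A \<longleftrightarrow> (\<forall>i j. i \<notin> I \<or> j \<notin> I \<longrightarrow> A i j = 0)"

lemma clinear_imul: "clinear L \<Longrightarrow> L (imul f) = imul (L f)"
  unfolding clinear_def using commutesD[of L imul_op] by simp

lemma clinearI: "(\<And>f. blinfun_apply L (imul f) = imul (L f)) \<Longrightarrow> clinear L"
  unfolding clinear_def by (rule commutesI) simp

lemma clinear_compose: "clinear A \<Longrightarrow> clinear B \<Longrightarrow> clinear (A o\<^sub>L B)"
  by (rule clinearI) (simp add: clinear_imul)

lemma coord_apply_has_sum:
  assumes "clinear L"
  shows "((\<lambda>j. kern L i j * coord f j) has_sum coord (L f) i) UNIV"
proof -
  have "bounded_linear (\<lambda>f. coord (L f) i)"
    using bounded_linear_compose[OF coord_bounded_linear blinfun.bounded_linear_right] .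
  from has_sum_bounded_linear[OF this l2_has_sum_unit[of f]]
  show ?thesis
    by (rule has_sum_cong[THEN iffD1, rotated])
      (simp add: blinfun.bilinear_simps coord_add coord_scaleR clinear_imul[OF assms] coord_imul
        kern_def complex_eq_iff)
qed

lemma kern_inject:
  assumes "clinear A" "clinear B" "kern A = kern B"
  shows "A = B"
proof (rule blinfun_eqI, rule l2_eqI)
  fix f i
  show "coord (A f) i = coord (B f) i"
    using coord_apply_has_sum[OF assms(1), of i f] coord_apply_has_sum[OF assms(2), of i f]
    by (simp add: assms(3) has_sum_unique)
qed

lemma comp_op_kern:
  assumes "clinear A" "supported I (kern B)"
  shows "comp_op I (kern A) (kern B) = kern (A o\<^sub>L B)"
proof (intro ext)
  fix i j
  have "((\<lambda>k. kern A i k * kern B k j) has_sum kern (A o\<^sub>L B) i j) UNIV"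
    using coord_apply_has_sum[OF assms(1), of i "B (unit j)"] by (simp add: kern_def)
  then have "((\<lambda>k. kern A i k * kern B k j) has_sum kern (A o\<^sub>L B) i j) I"
    by (subst has_sum_cong_neutral[where T = UNIV]) (use assms(2) in \<open>auto simp: supported_def\<close>)
  then show "comp_op I (kern A) (kern B) i j = kern (A o\<^sub>L B) i j"
    unfolding comp_op_def by (rule infsumI)
qed

text \<open>Elements of \<open>ell2 I\<close> are arbitrary outside I; this picks the representative
  that vanishes there.\<close>

definition restrict_l2 :: "'i set \<Rightarrow> ('i \<Rightarrow> complex) \<Rightarrow> 'i l2" where
  "restrict_l2 I \<psi> = Abs_l2 (\<lambda>i. if i \<in> I then \<psi> i else 0)"

lemma coord_restrict_l2:
  assumes "\<psi> \<in> ell2 I"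
  shows "coord (restrict_l2 I \<psi>) i = (if i \<in> I then \<psi> i else 0)"
proof -
  have "(\<lambda>i. (cmod (if i \<in> I then \<psi> i else 0))\<^sup>2) summable_on UNIV"
    using assms unfolding ell2_def mem_Collect_eq
    by (subst summable_on_cong_neutral[where T = I]) auto
  then show ?thesis unfolding restrict_l2_def by (subst coord_Abs_l2) (simp_all add: ell2_def)
qed

lemma norm_restrict_l2:
  assumes "\<psi> \<in> ell2 I"
  shows "norm (restrict_l2 I \<psi>) = norm_on I \<psi>"
proof -
  have "(norm (restrict_l2 I \<psi>))\<^sup>2 = (\<Sum>\<^sub>\<infinity>i. (cmod (coord (restrict_l2 I \<psi>) i))\<^sup>2)"
    by (rule infsumI[OF norm_l2_has_sum, symmetric])
  also have "\<dots> = (\<Sum>\<^sub>\<infinity>i\<in>I. (cmod (\<psi> i))\<^sup>2)"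
    by (rule infsum_cong_neutral) (auto simp: coord_restrict_l2[OF assms])
  finally show ?thesis by (simp add: norm_on_def real_sqrt_unique)
qed

lemma apply_op_kern:
  assumes "clinear L" "supported I (kern L)" "\<psi> \<in> ell2 I"
  shows "((\<lambda>j. kern L i j * \<psi> j) has_sum coord (L (restrict_l2 I \<psi>)) i) I"
    and "apply_op I (kern L) \<psi> i = coord (L (restrict_l2 I \<psi>)) i"
proof -
  show *: "((\<lambda>j. kern L i j * \<psi> j) has_sum coord (L (restrict_l2 I \<psi>)) i) I"
    by (rule has_sum_cong_neutral[THEN iffD1, OF _ _ _ coord_apply_has_sum[OF assms(1)]])
      (use assms(2) in \<open>auto simp: supported_def coord_restrict_l2[OF assms(3)]\<close>)
  show "apply_op I (kern L) \<psi> i = coord (L (restrict_l2 I \<psi>)) i"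
    unfolding apply_op_def using * by (rule infsumI)
qed

lemma bounded_op_kern:
  assumes "clinear L" "supported I (kern L)"
  shows "bounded_op I (kern L)"
  unfolding bounded_op_def
proof (intro conjI exI[of _ "norm L"] ballI)
  show "\<forall>i j. i \<notin> I \<or> j \<notin> I \<longrightarrow> kern L i j = 0" using assms(2) by (simp add: supported_def)
  fix \<psi> assume \<psi>: "\<psi> \<in> ell2 I"
  note app = apply_op_kern[OF assms \<psi>]
  show "(\<lambda>j. kern L i j * \<psi> j) summable_on I" for i using app(1) has_sum_imp_summable by blast
  have eq: "apply_op I (kern L) \<psi> = coord (L (restrict_l2 I \<psi>))" using app(2) by (intro ext)
  show mem: "apply_op I (kern L) \<psi> \<in> ell2 I"
    unfolding eq by (rule ell2_subset[OF coord_in_ell2 subset_UNIV])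
  have "norm_on I (apply_op I (kern L) \<psi>) = norm (restrict_l2 I (apply_op I (kern L) \<psi>))"
    by (rule norm_restrict_l2[OF mem, symmetric])
  also have "restrict_l2 I (apply_op I (kern L) \<psi>) = L (restrict_l2 I \<psi>)"
  proof (rule l2_eqI)
    fix i
    have "coord (L (restrict_l2 I \<psi>)) i = 0" if "i \<notin> I"
      using coord_apply_has_sum[OF assms(1), of i "restrict_l2 I \<psi>"] assms(2) that
      by (simp add: supported_def has_sum_unique[OF _ has_sum_0])
    then show "coord (restrict_l2 I (apply_op I (kern L) \<psi>)) i = coord (L (restrict_l2 I \<psi>)) i"
      by (simp add: coord_restrict_l2[OF mem[unfolded eq]] eq)
  qed
  also have "norm \<dots> \<le> norm L * norm (restrict_l2 I \<psi>)" by (rule norm_blinfun)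
  also have "\<dots> = norm L * norm_on I \<psi>" by (simp add: norm_restrict_l2[OF \<psi>])
  finally show "norm_on I (apply_op I (kern L) \<psi>) \<le> norm L * norm_on I \<psi>" .
qed

text \<open>Converse of \<open>bounded_op_kern\<close>: together they let the operator theory above
  speak about the kernels of the definitions.\<close>

lemma bounded_op_obtain:
  assumes "bounded_op I A"
  obtains L where "clinear L" "kern L = A" "supported I A"
proof -
  obtain C where supp: "\<And>i j. i \<notin> I \<or> j \<notin> I \<Longrightarrow> A i j = 0"
    and sm: "\<And>\<psi> i. \<psi> \<in> ell2 I \<Longrightarrow> i \<in> I \<Longrightarrow> (\<lambda>j. A i j * \<psi> j) summable_on I"
    and mem: "\<And>\<psi>. \<psi> \<in> ell2 I \<Longrightarrow> apply_op I A \<psi> \<in> ell2 I"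
    and bd: "\<And>\<psi>. \<psi> \<in> ell2 I \<Longrightarrow> norm_on I (apply_op I A \<psi>) \<le> C * norm_on I \<psi>"
    using assms unfolding bounded_op_def by metis
  define f where "f \<psi> = restrict_l2 I (apply_op I A (coord \<psi>))" for \<psi>
  have cI: "coord \<psi> \<in> ell2 I" for \<psi> :: "'a l2" by (rule ell2_subset[OF coord_in_ell2 subset_UNIV])
  have coord_f: "coord (f \<psi>) i = (\<Sum>\<^sub>\<infinity>j\<in>I. A i j * coord \<psi> j)" for \<psi> i
    unfolding f_def coord_restrict_l2[OF mem[OF cI]]
    using supp by (auto simp: apply_op_def intro!: infsum_0[symmetric])
  have sm': "(\<lambda>j. A i j * coord \<psi> j) summable_on I" for \<psi> i
  proof (cases "i \<in> I")
    case False
    then show ?thesis using supp by (simp add: summable_on_0)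
  qed (use sm cI in blast)
  have lin: "f (\<psi> + \<phi>) = f \<psi> + f \<phi>" "f (r *\<^sub>R \<psi>) = r *\<^sub>R f \<psi>" "f (imul \<psi>) = imul (f \<psi>)" for \<psi> \<phi> r
  proof (rule_tac [!] l2_eqI)
    fix i
    show "coord (f (\<psi> + \<phi>)) i = coord (f \<psi> + f \<phi>) i"
      by (simp add: coord_f coord_add distrib_left infsum_add sm')
    show "coord (f (r *\<^sub>R \<psi>)) i = coord (r *\<^sub>R f \<psi>) i"
      by (simp add: coord_f coord_scaleR mult.left_commute infsum_cmult_right')
    show "coord (f (imul \<psi>)) i = coord (imul (f \<psi>)) i"
      by (simp add: coord_f coord_imul mult.left_commute infsum_cmult_right')
  qed
  have "bounded_linear f"
  proof (rule bounded_linear_intro[where K = "\<bar>C\<bar>"])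
    fix \<psi>
    have "norm (f \<psi>) = norm_on I (apply_op I A (coord \<psi>))"
      unfolding f_def by (rule norm_restrict_l2[OF mem[OF cI]])
    also have "\<dots> \<le> C * norm_on I (coord \<psi>)" by (rule bd[OF cI])
    \<comment> \<open>C carries no sign condition in \<open>bounded_op\<close>, while monotonicity
      in the norm, used next, needs a non-negative factor.\<close>
    also have "\<dots> \<le> \<bar>C\<bar> * norm_on I (coord \<psi>)"
      by (intro mult_right_mono) (auto simp: norm_on_def infsum_nonneg)
    also have "\<bar>C\<bar> * norm_on I (coord \<psi>) \<le> \<bar>C\<bar> * norm \<psi>"
    proof (rule mult_left_mono)
      have "(\<Sum>\<^sub>\<infinity>i\<in>I. (cmod (coord \<psi> i))\<^sup>2) \<le> (norm \<psi>)\<^sup>2"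
        using cI[of \<psi>] unfolding ell2_def mem_Collect_eq
        by (rule infsum_le_finite_sums) (rule sum_coord_le_norm)
      then show "norm_on I (coord \<psi>) \<le> norm \<psi>" unfolding norm_on_def by (intro real_le_lsqrt) auto
    qed simp
    finally show "norm (f \<psi>) \<le> norm \<psi> * \<bar>C\<bar>" by (simp add: mult.commute)
  qed (simp_all add: lin)
  then have L: "blinfun_apply (Blinfun f) = f" by (rule bounded_linear_Blinfun_apply)
  show thesis
  proof (rule that)
    show "clinear (Blinfun f)" by (rule clinearI) (simp add: L lin)
    show "supported I A" using supp by (simp add: supported_def)
    show "kern (Blinfun f) = A"
    proof (intro ext)
      fix i j
      have "kern (Blinfun f) i j = (\<Sum>\<^sub>\<infinity>k\<in>I. A i k * (if k = j then 1 else 0))"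
        by (simp add: kern_def L coord_f coord_unit)
      also have "\<dots> = (\<Sum>\<^sub>\<infinity>k\<in>{j}. A i k * (if k = j then 1 else 0))"
        by (rule infsum_cong_neutral) (use supp in auto)
      finally show "kern (Blinfun f) i j = A i j" by simp
    qed
  qed
qed

text \<open>The real inner product is the real part of the complex one; the imaginary part of the
  complex one is the real inner product with \<open>imul\<close> applied in the first slot.\<close>

lemma inner_on_kern:
  assumes "clinear L" "supported I (kern L)" "\<psi> \<in> ell2 I"
  defines "\<phi> \<equiv> restrict_l2 I \<psi>"
  shows "inner_on I \<psi> (apply_op I (kern L) \<psi>) = Complex (inner \<phi> (L \<phi>)) (inner (imul \<phi>) (L \<phi>))"
proof -
  have "((\<lambda>i. cnj (coord \<phi> i) * coord (L \<phi>) i) has_sum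
      (of_real (inner \<phi> (L \<phi>)) + \<i> * of_real (inner (imul \<phi>) (L \<phi>)))) UNIV"
  proof -
    have "((\<lambda>i. of_real (inner (coord \<phi> i) (coord (L \<phi>) i)) + \<i> * of_real (inner (coord (imul \<phi>) i) (coord (L \<phi>) i)))
        has_sum (of_real (inner \<phi> (L \<phi>)) + \<i> * of_real (inner (imul \<phi>) (L \<phi>)))) UNIV"
      by (intro has_sum_add has_sum_cmult_right has_sum_of_real inner_l2_has_sum)
    then show ?thesis
      by (rule has_sum_cong[THEN iffD1, rotated])
        (simp add: complex_eq_iff inner_complex_def coord_imul)
  qed
  then have "((\<lambda>i. cnj (\<psi> i) * apply_op I (kern L) \<psi> i) has_sum
      (of_real (inner \<phi> (L \<phi>)) + \<i> * of_real (inner (imul \<phi>) (L \<phi>)))) I"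
    by (rule has_sum_cong_neutral[THEN iffD1, rotated -1])
      (auto simp: apply_op_kern(2)[OF assms(1-3)] \<phi>_def coord_restrict_l2[OF assms(3)])
  then show ?thesis
    unfolding inner_on_def by (simp add: infsumI complex_eq_iff)
qed

text \<open>\<open>positive_op\<close> demands only a real non-negative form, whereas
  \<open>pos\<close> includes symmetry. Over the complex numbers the first implies the second, by
  polarizing and replacing x by \<open>imul x\<close>.\<close>

lemma selfadjoint_of_real_form:
  assumes "clinear L" and real: "\<And>f. inner (imul f) (L f) = 0"
  shows "selfadjoint L"
  unfolding selfadjoint_def
proof (intro allI)
  fix x y
  have polar: "inner (imul f) (L g) + inner (imul g) (L f) = 0" for f g
    using real[of "f + g"] real[of f] real[of g]
    by (simp add: imul_add blinfun.add_right inner_add)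
  have "inner (imul (imul x)) (L y) + inner (imul y) (L (imul x)) = 0" by (rule polar)
  then show "inner x (L y) = inner (L x) y"
    by (simp add: clinear_imul[OF assms(1)] inner_commute)
qed

lemma positive_op_kern:
  assumes "clinear L" "supported I (kern L)" "pos L"
  shows "positive_op I (kern L)"
proof -
  have "inner (imul f) (L f) = 0" for f
    using selfadjointD[OF pos_selfadjoint[OF assms(3)], of "imul f" f]
      clinear_imul[OF assms(1), of f] inner_imul_left[of "f" "L f"] inner_imul_left[of "L f" f]
    by (simp add: inner_commute)
  then show ?thesis
    unfolding positive_op_def
    using bounded_op_kern[OF assms(1,2)] inner_on_kern[OF assms(1,2)] pos_nonneg[OF assms(3)]
    by (simp add: complex_is_Real_iff)
qed

lemma positive_op_obtain:
  assumes "positive_op I A"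
  obtains L where "clinear L" "kern L = A" "supported I A" "pos L"
proof -
  obtain L where L: "clinear L" "kern L = A" "supported I A"
    using assms bounded_op_obtain unfolding positive_op_def by blast
  have form: "inner (imul f) (L f) = 0 \<and> 0 \<le> inner f (L f)" for f
  proof -
    \<comment> \<open>The hypothesis only tests vectors on I; L neither sees nor produces
      coordinates outside I, so f can be replaced by its restriction.\<close>
    define g where "g = restrict_l2 I (coord f)"
    have cI: "coord f \<in> ell2 I" by (rule ell2_subset[OF coord_in_ell2 subset_UNIV])
    have g: "coord g i = (if i \<in> I then coord f i else 0)" for i
      unfolding g_def by (rule coord_restrict_l2[OF cI])
    have Lg: "coord (L f) i = coord (L g) i" for i
      by (rule has_sum_unique[OF coord_apply_has_sum[OF L(1)]],
          rule has_sum_cong[THEN iffD1, rotated], rule coord_apply_has_sum[OF L(1)])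
        (use L(2,3) in \<open>auto simp: g supported_def\<close>)
    then have Lfg: "L f = L g" by (rule l2_eqI)
    have zero: "coord (L g) i = 0" if "i \<notin> I" for i
      using coord_apply_has_sum[OF L(1), of i g] L(2,3) that
      by (simp add: supported_def has_sum_unique[OF _ has_sum_0])
    have "inner f (L f) = inner g (L g)"
      unfolding Lfg inner_l2_def by (rule infsum_cong) (auto simp: g zero)
    moreover have "inner (imul f) (L f) = inner (imul g) (L g)"
      unfolding Lfg inner_l2_def by (rule infsum_cong) (auto simp: g zero coord_imul)
    moreover have "inner_on I (coord f) (apply_op I A (coord f)) = Complex (inner g (L g)) (inner (imul g) (L g))"
      using inner_on_kern[OF L(1) _ cI] L(2,3) by (simp add: g_def)
    ultimately show ?thesis
      using assms cI unfolding positive_op_def by (auto simp: complex_is_Real_iff)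
  qed
  then have "pos L"
    unfolding pos_def using selfadjoint_of_real_form[OF L(1)] by blast
  with L that show thesis by blast
qed

lemma kern_hermitian:
  assumes "clinear L" "selfadjoint L"
  shows "kern L j i = cnj (kern L i j)"
proof -
  have "inner (unit i) (L (unit j)) = inner (L (unit i)) (unit j)"
    "inner (imul (unit i)) (L (unit j)) = inner (L (imul (unit i))) (unit j)"
    by (rule selfadjointD[OF assms(2)])+
  then show ?thesis
    by (simp add: kern_def complex_eq_iff inner_unit inner_imul_unit inner_commute[of "unit i"]
        inner_commute[of "imul (unit i)"] clinear_imul[OF assms(1)] coord_imul)
qed

text \<open>If A kills a basis vector e then so does S, because |S e|^2 = <e, A e>. Rows follow from
  columns by hermiticity.\<close>

lemma sqrt_supported:
  assumes "clinear S" "pos S" "S o\<^sub>L S = A" "supported I (kern A)"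
  shows "supported I (kern S)"
proof -
  have sa: "selfadjoint S" using assms(2) by (rule pos_selfadjoint)
  have zero: "kern S i j = 0" if "j \<notin> I" for i j
  proof -
    have "A (unit j) = 0"
      using assms(4) that by (intro l2_eqI) (auto simp: supported_def kern_def coord_zero)
    then have "S (S (unit j)) = 0" using assms(3) by auto
    then have "inner (S (unit j)) (S (unit j)) = 0" by (simp flip: selfadjointD[OF sa])
    then show ?thesis by (simp add: kern_def coord_zero)
  qed
  moreover have "kern S i j = 0" if "i \<notin> I" for i j
    using zero[OF that, of j] kern_hermitian[OF assms(1) sa, of i j] by simp
  ultimately show ?thesis by (auto simp: supported_def)
qed

lemma sqrt_op_kern:
  assumes A: "supported I (kern A)"
    and S: "clinear S" "pos S" "S o\<^sub>L S = A"
  shows "sqrt_op I (kern A) = kern S"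
  unfolding sqrt_op_def
proof (rule the_equality)
  have supp: "supported I (kern S)" by (rule sqrt_supported[OF S A])
  show "positive_op I (kern S) \<and> comp_op I (kern S) (kern S) = kern A"
    using positive_op_kern[OF S(1) supp S(2)] comp_op_kern[OF S(1) supp] S(3) by simp
  fix r assume r: "positive_op I r \<and> comp_op I r r = kern A"
  then obtain R where R: "clinear R" "kern R = r" "supported I r" "pos R"
    using positive_op_obtain by blast
  have "clinear A" using clinear_compose[OF S(1,1)] S(3) by simp
  have "R o\<^sub>L R = A"
    using r R comp_op_kern[OF R(1), of I R]
    by (intro kern_inject clinear_compose R \<open>clinear A\<close>) simp
  have "pos A"
    using selfadjointD[OF pos_selfadjoint[OF S(2)]] S(3)
    unfolding pos_def selfadjoint_def by (metis blinfun_apply_blinfun_compose inner_ge_zero)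
  \<comment> \<open>Only the root supplied by \<open>pos_sqrt_exists\<close> is known to commute
    with all that commutes with A, so both S and the competitor R are compared with it.\<close>
  then obtain S' where S': "pos S'" "S' o\<^sub>L S' = A" "\<And>C. commutes A C \<Longrightarrow> commutes S' C"
    using pos_sqrt_exists by blast
  have "R = S'" using pos_sqrt_unique[OF S'(1) R(4) S'(2) \<open>R o\<^sub>L R = A\<close> S'(3)] .
  moreover have "S = S'" using pos_sqrt_unique[OF S'(1) S(2) S'(2) S(3) S'(3)] .
  ultimately show "r = kern S" using R(2) by simp
qed

text \<open>Complex linearity is commutation with \<open>imul_op\<close>, so the root inherits it
  from A.\<close>

lemma clinear_sqrt_exists:
  assumes "pos A" "clinear A"
  obtains S where "pos S" "clinear S" "S o\<^sub>L S = A"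
  using pos_sqrt_exists[OF assms(1)] assms(2) unfolding clinear_def by blast

section \<open>Fidelity of mixtures and of diagonal states\<close>

subsection \<open>Mixtures of vectors\<close>

text \<open>The complex operator |w><w| in real terms: the complex coefficient of w has real part
  \<open>inner w f\<close> and imaginary part \<open>inner (imul w) f\<close>.\<close>

definition rank_one :: "'i l2 \<Rightarrow> 'i l2 \<Rightarrow>\<^sub>L 'i l2" where
  "rank_one w = Blinfun (\<lambda>f. inner w f *\<^sub>R w + inner (imul w) f *\<^sub>R imul w)"

text \<open>The state left when the label e of a purification with components w e is traced
  out.\<close>

definition mixture :: "('e \<Rightarrow> 'i l2) \<Rightarrow> 'i l2 \<Rightarrow>\<^sub>L 'i l2" where
  "mixture w = (\<Sum>\<^sub>\<infinity>e. rank_one (w e))"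

lemma rank_one_bound:
  "norm (inner w f *\<^sub>R w + inner (imul w) f *\<^sub>R imul w) \<le> norm f * (2 * (norm w)\<^sup>2)"
proof -
  have "norm (inner v f *\<^sub>R v) \<le> norm f * (norm v)\<^sup>2" for v :: "'a l2"
    using mult_right_mono[OF Cauchy_Schwarz_ineq2[of v f], of "norm v"]
    by (simp add: power2_eq_square mult_ac)
  from this[of w] this[of "imul w"] show ?thesis
    using norm_triangle_ineq[of "inner w f *\<^sub>R w" "inner (imul w) f *\<^sub>R imul w"]
    by (simp add: algebra_simps)
qed

lemma rank_one_apply: "rank_one w f = inner w f *\<^sub>R w + inner (imul w) f *\<^sub>R imul w"
  unfolding rank_one_def
  by (subst bounded_linear_Blinfun_apply)
    (auto intro!: bounded_linear_intro[OF _ _ rank_one_bound] simp: inner_add_right scaleR_add_left scaleR_add_right)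

lemma norm_rank_one_le: "norm (rank_one w) \<le> 2 * (norm w)\<^sup>2"
  using rank_one_bound[of w] by (intro norm_blinfun_bound) (simp_all add: rank_one_apply mult.commute)

lemma kern_rank_one: "kern (rank_one w) p q = coord w p * cnj (coord w q)"
  by (simp add: kern_def rank_one_apply coord_add coord_diff coord_scaleR coord_imul inner_unit
      inner_imul_left inner_imul_unit complex_eq_iff)

lemma rank_one_form: "inner x (rank_one w y) = inner x w * inner y w + inner x (imul w) * inner y (imul w)"
  by (simp add: rank_one_apply inner_add_right inner_commute mult.commute)

text \<open>Applying Cauchy-Schwarz to w and \<open>imul w\<close> separately would lose a factor 2.
  Applied to x and v = |w><w| x instead, it gives s^2 \<le> |x|^2 s |w|^2, from which s is
  cancelled.\<close>

lemma rank_one_form_le: "inner x (rank_one w x) \<le> (norm w)\<^sup>2 * (norm x)\<^sup>2"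
proof -
  define s where "s = inner x (rank_one w x)"
  define v where "v = rank_one w x"
  have s: "s = (inner w x)\<^sup>2 + (inner (imul w) x)\<^sup>2"
    by (simp add: s_def rank_one_form inner_commute power2_eq_square)
  have "(norm v)\<^sup>2 = s * (norm w)\<^sup>2"
    unfolding power2_norm_eq_inner
    by (simp add: v_def rank_one_apply inner_add s power2_eq_square algebra_simps)
  moreover have "s\<^sup>2 \<le> (norm x)\<^sup>2 * (norm v)\<^sup>2"
    unfolding s_def v_def using Cauchy_Schwarz_ineq[of x "rank_one w x"] by (simp add: power2_norm_eq_inner)
  ultimately have *: "s * s \<le> s * ((norm w)\<^sup>2 * (norm x)\<^sup>2)" by (simp add: power2_eq_square mult_ac)
  have "0 \<le> s" by (simp add: s)
  then show ?thesis
    using * by (cases "s = 0") (auto simp flip: s_def)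
qed

locale unit_mixture =
  fixes w :: "'e \<Rightarrow> 'i l2"
  assumes total: "((\<lambda>e. (norm (w e))\<^sup>2) has_sum 1) UNIV"
begin

lemma has_sum_mixture: "((\<lambda>e. rank_one (w e)) has_sum mixture w) UNIV"
proof -
  have "(\<lambda>e. rank_one (w e)) abs_summable_on UNIV"
  proof (rule summable_on_comparison_test)
    show "(\<lambda>e. 2 * (norm (w e))\<^sup>2) summable_on UNIV"
      using total by (intro summable_on_cmult_right) (rule has_sum_imp_summable)
  qed (simp_all add: norm_rank_one_le)
  then show ?thesis unfolding mixture_def by (rule has_sum_infsum[OF abs_summable_summable])
qed

lemma mixture_apply_has_sum: "((\<lambda>e. rank_one (w e) f) has_sum mixture w f) UNIV"
  by (rule has_sum_bounded_linear[OF blinfun.bounded_linear_left has_sum_mixture])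

lemma mixture_form_has_sum: "((\<lambda>e. inner x (rank_one (w e) y)) has_sum inner x (mixture w y)) UNIV"
  by (rule has_sum_bounded_linear[OF bounded_linear_inner_right mixture_apply_has_sum])

lemma mixture_kern_has_sum: "((\<lambda>e. coord (w e) p * cnj (coord (w e) q)) has_sum kern (mixture w) p q) UNIV"
  using has_sum_bounded_linear[OF coord_bounded_linear[of p] mixture_apply_has_sum[of "unit q"]]
  by (simp add: kern_rank_one flip: kern_def)

lemma clinear_mixture: "clinear (mixture w)"
proof (rule clinearI, rule has_sum_unique[OF mixture_apply_has_sum])
  fix f
  have "((\<lambda>e. imul (rank_one (w e) f)) has_sum imul (mixture w f)) UNIV"
    using has_sum_bounded_linear[OF blinfun.bounded_linear_right[of imul_op] mixture_apply_has_sum[of f]]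
    by simp
  moreover have "imul (rank_one v f) = rank_one v (imul f)" for v
    using inner_imul_left[of v f]
    by (simp add: rank_one_apply imul_add imul_diff imul_scaleR add.commute)
  ultimately show "((\<lambda>e. rank_one (w e) (imul f)) has_sum imul (mixture w f)) UNIV" by simp
qed

lemma mixture_square_has_sum:
  "((\<lambda>e. (inner x (w e))\<^sup>2 + (inner x (imul (w e)))\<^sup>2) has_sum inner x (mixture w x)) UNIV"
  using mixture_form_has_sum[of x x] by (simp add: rank_one_form power2_eq_square)

lemma pos_mixture: "pos (mixture w)"
  unfolding pos_def selfadjoint_def
proof (intro conjI allI)
  fix x y
  show "0 \<le> inner x (mixture w x)"
    using mixture_square_has_sum by (rule has_sum_nonneg) simp
  have "((\<lambda>e. inner x (rank_one (w e) y)) has_sum inner y (mixture w x)) UNIV"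
    using mixture_form_has_sum[of y x] by (simp add: rank_one_form mult.commute)
  from has_sum_unique[OF mixture_form_has_sum this]
  show "inner x (mixture w y) = inner (mixture w x) y" by (simp add: inner_commute)
qed

lemma mixture_form_le: "inner x (mixture w x) \<le> (norm x)\<^sup>2"
proof (rule has_sum_mono[OF mixture_form_has_sum])
  show "((\<lambda>e. (norm (w e))\<^sup>2 * (norm x)\<^sup>2) has_sum (norm x)\<^sup>2) UNIV"
    using has_sum_cmult_left[OF total, of "(norm x)\<^sup>2"] by simp
qed (rule rank_one_form_le)

text \<open>Real counterpart of the family w: its squared real coefficients add up to the complex
  quadratic form, at the price of total weight 2.\<close>

definition doubled :: "'e \<times> bool \<Rightarrow> 'i l2" where
  "doubled p = (if snd p then imul (w (fst p)) else w (fst p))"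

lemma doubled_has_sum: "((\<lambda>p. (inner x (doubled p))\<^sup>2) has_sum inner x (mixture w x)) UNIV"
  by (subst has_sum_bool_iff) (use mixture_square_has_sum[of x] in \<open>simp_all add: doubled_def\<close>)

lemma doubled_total: "((\<lambda>p. (norm (doubled p))\<^sup>2) has_sum 2) UNIV"
  by (subst has_sum_bool_iff) (use has_sum_add[OF total total] in \<open>simp_all add: doubled_def\<close>)

lemma trace_mixture_le:
  assumes "finite F"
  shows "(\<Sum>j\<in>F. inner (real_basis j) (mixture w (real_basis j))) \<le> 2"
proof (rule has_sum_mono[OF _ doubled_total])
  show "((\<lambda>p. \<Sum>j\<in>F. (inner (real_basis j) (doubled p))\<^sup>2) has_sum
      (\<Sum>j\<in>F. inner (real_basis j) (mixture w (real_basis j)))) UNIV"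
    by (intro has_sum_sum doubled_has_sum)
  fix p
  show "(\<Sum>j\<in>F. (inner (real_basis j) (doubled p))\<^sup>2) \<le> (norm (doubled p))\<^sup>2"
    using finite_sum_le_has_sum[OF real_basis_parseval[of "doubled p"] assms]
    by (simp add: inner_commute)
qed

end

subsection \<open>Fidelity\<close>

lemma supported_compose:
  assumes "clinear A" "supported I (kern A)" "supported I (kern B)"
  shows "supported I (kern (A o\<^sub>L B))"
  using assms(2,3) unfolding comp_op_kern[OF assms(1,3), symmetric] supported_def comp_op_def
  by (auto intro!: infsum_0)

text \<open>By uniqueness of positive roots any witnesses R and T may be supplied. The trace is
  given as a convergent sum, since \<open>infsum\<close> would otherwise return 0.\<close>

lemma fidelity_kern:
  assumes A: "supported I (kern A)" and B: "supported I (kern B)" "clinear B"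
    and R: "clinear R" "pos R" "R o\<^sub>L R = A"
    and T: "clinear T" "pos T" "T o\<^sub>L T = (R o\<^sub>L B) o\<^sub>L R"
    and trace: "((\<lambda>i. Re (kern T i i)) has_sum t) UNIV"
  shows "fidelity I (kern A) (kern B) = t"
proof -
  have suppR: "supported I (kern R)" by (rule sqrt_supported[OF R A])
  have cRB: "clinear (R o\<^sub>L B)" by (intro clinear_compose R B)
  have suppC: "supported I (kern ((R o\<^sub>L B) o\<^sub>L R))"
    by (intro supported_compose suppR B R cRB)
  have suppT: "supported I (kern T)" by (rule sqrt_supported[OF T suppC])
  have "kern T i i = of_real (Re (kern T i i))" for i
    using kern_hermitian[OF T(1) pos_selfadjoint[OF T(2)], of i i] by (simp add: complex_eq_iff)
  then have "((\<lambda>i. kern T i i) has_sum of_real t) UNIV"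
    using has_sum_of_real[OF trace, where ?'a = complex] by simp
  then have "((\<lambda>i. kern T i i) has_sum of_real t) I"
    by (subst has_sum_cong_neutral[where T = UNIV]) (use suppT in \<open>auto simp: supported_def\<close>)
  then show ?thesis
    by (simp add: fidelity_def sqrt_op_kern[OF A R] comp_op_kern[OF R(1) B(1)]
        comp_op_kern[OF cRB suppR] sqrt_op_kern[OF suppC T] trace_op_def infsumI)
qed

lemma real_basis_form:
  assumes "clinear T"
  shows "inner (real_basis p) (T (real_basis p)) = Re (kern T (fst p) (fst p))"
  by (simp add: real_basis_def clinear_imul[OF assms] kern_def inner_unit inner_commute[of "unit _"])

text \<open>w and z are the components of two purifications over the same label space, and the left
  side is the real part of their overlap truncated to E. Finite truncations are enough to bound a
  convergent overlap.\<close>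

theorem fidelity_mixture_ge:
  fixes w z :: "'e \<Rightarrow> 'i l2"
  assumes w: "unit_mixture w" and z: "unit_mixture z"
    and supp: "supported I (kern (mixture w))" "supported I (kern (mixture z))"
    and fin: "finite E"
  shows "(\<Sum>e\<in>E. inner (w e) (z e)) \<le> fidelity I (kern (mixture w)) (kern (mixture z))"
proof -
  interpret w: unit_mixture w by fact
  interpret z: unit_mixture z by fact
  define A B where "A = mixture w" and "B = mixture z"
  obtain R where R: "pos R" "clinear R" "R o\<^sub>L R = A"
    using clinear_sqrt_exists[OF w.pos_mixture w.clinear_mixture] A_def by metis
  have R_sa: "inner x (R y) = inner (R x) y" for x y using R(1) pos_selfadjoint selfadjointD by blast
  have RR: "R (R x) = A x" for x using R(3) by auto
  define C where "C = (R o\<^sub>L B) o\<^sub>L R"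
  have C: "inner x (C y) = inner (R x) (B (R y))" for x y by (simp add: C_def R_sa)
  have "pos C"
    using selfadjointD[OF pos_selfadjoint[OF z.pos_mixture]] pos_nonneg[OF z.pos_mixture]
    unfolding pos_def selfadjoint_def by (simp add: C B_def) (simp add: C_def B_def R_sa)
  moreover have "clinear C" unfolding C_def B_def by (intro clinear_compose R z.clinear_mixture)
  ultimately obtain T where T: "pos T" "clinear T" "T o\<^sub>L T = C" by (rule clinear_sqrt_exists)
  have T_sa: "inner x (T y) = inner (T x) y" for x y using T(1) pos_selfadjoint selfadjointD by blast
  have TT: "T (T x) = C x" for x using T(3) by auto
  have nR: "(norm (R x))\<^sup>2 = inner x (A x)" for x
    by (simp add: power2_norm_eq_inner RR flip: R_sa)
  have nT: "(norm (T x))\<^sup>2 = inner (R x) (B (R x))" for x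
    by (simp add: power2_norm_eq_inner TT C flip: T_sa)
  have contract: "pos_contraction X" if "pos X" "\<And>x. (norm (X x))\<^sup>2 \<le> (norm x)\<^sup>2"
    for X :: "'i l2 \<Rightarrow>\<^sub>L 'i l2"
  proof
    fix x
    have "norm (X x) \<le> norm x" using that(2) by (rule power2_le_imp_le) simp
    then have "norm x * norm (X x) \<le> norm x * norm x" by (rule mult_left_mono) simp
    with norm_cauchy_schwarz[of x "X x"] show "inner x (X x) \<le> (norm x)\<^sup>2"
      by (simp add: power2_eq_square)
  qed fact
  have nR_le: "(norm (R x))\<^sup>2 \<le> (norm x)\<^sup>2" for x
    unfolding nR A_def by (rule w.mixture_form_le)
  have "(norm (T x))\<^sup>2 \<le> (norm x)\<^sup>2" for x
    unfolding nT B_def using z.mixture_form_le[of "R x"] nR_le[of x] by linarith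
  then have cT: "pos_contraction T" by (rule contract[OF T(1)])
  have cR: "pos_contraction R" by (rule contract[OF R(1) nR_le])
  have zT: "((\<lambda>p. (inner (R x) (z.doubled p))\<^sup>2) has_sum (norm (T x))\<^sup>2) UNIV" for x
    unfolding nT B_def by (rule z.doubled_has_sum)
  have wR: "((\<lambda>p. (inner x (w.doubled p))\<^sup>2) has_sum (norm (R x))\<^sup>2) UNIV" for x
    unfolding nR A_def by (rule w.doubled_has_sum)
  define d where "d p = inner (real_basis p) (T (real_basis p))" for p
  have d_nonneg: "0 \<le> d p" for p unfolding d_def by (rule pos_nonneg[OF T(1)])
  \<comment> \<open>Each 2 bounds the squared Hilbert-Schmidt norm of one factor, R or the doubled
    z: it is the real trace of a state.\<close>
  have "(\<Sum>p\<in>F. d p) \<le> (2 + 2) / 2" if "finite F" for F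
    unfolding d_def
  proof (rule trace_bounded[OF real_basis_parseval R(1) cT zT _ _ that])
    show "(\<Sum>e\<in>E. (norm (z.doubled e))\<^sup>2) \<le> 2" if "finite E" for E
      by (rule finite_sum_le_has_sum[OF z.doubled_total that]) auto
    show "(\<Sum>j\<in>F. (norm (R (real_basis j)))\<^sup>2) \<le> 2" if "finite F" for F
      unfolding nR A_def by (rule w.trace_mixture_le[OF that])
  qed
  then have "d summable_on UNIV"
    by (intro nonneg_bdd_above_summable_on d_nonneg bdd_aboveI[where M = 2]) auto
  then obtain t where t: "(d has_sum t) UNIV" by (auto simp: summable_on_def)
  \<comment> \<open>The real trace t is twice the complex one; the doubled overlap below carries the
    same factor.\<close>
  have "((\<lambda>i. 2 * Re (kern T i i)) has_sum t) UNIV"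
    using t by (subst (asm) has_sum_bool_iff) (simp_all add: d_nonneg, simp add: d_def real_basis_form[OF T(2)])
  from has_sum_cmult_right[OF this, of "1/2"]
  have "((\<lambda>i. Re (kern T i i)) has_sum t / 2) UNIV" by simp
  then have fid: "fidelity I (kern A) (kern B) = t / 2"
    using supp R T unfolding C_def A_def B_def by (intro fidelity_kern) (simp_all add: z.clinear_mixture)
  have "(\<Sum>p\<in>E \<times> UNIV. inner (w.doubled p) (z.doubled p)) \<le> t"
  proof (rule overlap_le_trace[OF real_basis_parseval cR cT t[unfolded d_def]])
    show "finite (E \<times> (UNIV :: bool set))" using fin by simp
    then show "(\<Sum>p\<in>E \<times> UNIV. (inner x (w.doubled p))\<^sup>2) \<le> (norm (R x))\<^sup>2"
      "(\<Sum>p\<in>E \<times> UNIV. (inner (R x) (z.doubled p))\<^sup>2) \<le> (norm (T x))\<^sup>2" for x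
      by (auto intro!: finite_sum_le_has_sum[OF wR] finite_sum_le_has_sum[OF zT])
  qed
  moreover have "(\<Sum>p\<in>E \<times> UNIV. inner (w.doubled p) (z.doubled p)) = 2 * (\<Sum>e\<in>E. inner (w e) (z e))"
  proof -
    have "(\<Sum>p\<in>E \<times> UNIV. inner (w.doubled p) (z.doubled p))
        = (\<Sum>e\<in>E. \<Sum>c\<in>UNIV. inner (w.doubled (e, c)) (z.doubled (e, c)))"
      by (simp add: sum.cartesian_product case_prod_unfold)
    then show ?thesis by (simp add: sum_bool w.doubled_def z.doubled_def sum_distrib_left)
  qed
  ultimately show ?thesis using fid by (simp add: A_def B_def)
qed

subsection \<open>Diagonal operators\<close>

definition diag :: "('i \<Rightarrow> real) \<Rightarrow> ('i, 'i) kernel" where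
  "diag d i j = (if i = j then of_real (d i) else 0)"

definition diag_op :: "('i \<Rightarrow> real) \<Rightarrow> 'i l2 \<Rightarrow>\<^sub>L 'i l2" where
  "diag_op d = Blinfun (\<lambda>f. Abs_l2 (\<lambda>i. of_real (d i) * coord f i))"

lemma coord_diag_op:
  assumes "\<And>i. \<bar>d i\<bar> \<le> 1"
  shows "coord (diag_op d f) i = of_real (d i) * coord f i"
proof -
  define g where "g f = Abs_l2 (\<lambda>i. of_real (d i) * coord f i)" for f
  have g: "coord (g f) i = of_real (d i) * coord f i" for f i
  proof -
    have "(\<lambda>i. of_real (d i) * coord f i) \<in> ell2 UNIV"
      using assms by (intro ell2_comparison[OF coord_in_ell2[of f], where C = 1])
        (simp add: norm_mult mult_left_le_one_le)
    then show ?thesis by (simp add: g_def)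
  qed
  have "bounded_linear g"
  proof (rule bounded_linear_intro[where K = 1])
    fix f
    show "norm (g f) \<le> norm f * 1"
    proof (rule norm_l2_le)
      fix F :: "'a set" assume "finite F"
      have "(\<Sum>i\<in>F. (cmod (coord (g f) i))\<^sup>2) \<le> (\<Sum>i\<in>F. (cmod (coord f i))\<^sup>2)"
        using assms by (intro sum_mono power_mono) (simp_all add: g norm_mult mult_left_le_one_le)
      also have "\<dots> \<le> (norm f * 1)\<^sup>2" using sum_coord_le_norm[OF \<open>finite F\<close>] by simp
      finally show "(\<Sum>i\<in>F. (cmod (coord (g f) i))\<^sup>2) \<le> (norm f * 1)\<^sup>2" .
    qed simp
  qed (auto intro!: l2_eqI simp: g coord_add coord_scaleR algebra_simps)
  then have "diag_op d f = g f"
    unfolding diag_op_def g_def[symmetric] by (simp add: bounded_linear_Blinfun_apply)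
  then show ?thesis by (simp add: g)
qed

context
  fixes d :: "'i \<Rightarrow> real"
  assumes d: "\<And>i. 0 \<le> d i" "\<And>i. d i \<le> 1"
begin

lemma coord_diag: "coord (diag_op d f) i = of_real (d i) * coord f i"
  by (rule coord_diag_op) (simp add: d)

lemma kern_diag_op: "kern (diag_op d) = diag d"
  by (intro ext) (auto simp: kern_def diag_def coord_diag coord_unit)

lemma clinear_diag_op: "clinear (diag_op d)"
  by (intro clinearI l2_eqI) (simp add: coord_diag coord_imul)

lemma pos_diag_op: "pos (diag_op d)"
  unfolding pos_def selfadjoint_def
proof (intro conjI allI)
  fix x y
  have scale: "of_real r * c = r *\<^sub>R c" for r :: real and c :: complex by (simp add: scaleR_conv_of_real)
  show "inner x (diag_op d y) = inner (diag_op d x) y"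
    by (simp add: inner_l2_def coord_diag scale)
  show "0 \<le> inner x (diag_op d x)"
    unfolding inner_l2_def by (intro infsum_nonneg) (simp add: coord_diag scale d)
qed

end

lemma diag_op_compose:
  assumes "\<And>i. 0 \<le> d i" "\<And>i. d i \<le> 1" "\<And>i. 0 \<le> e i" "\<And>i. e i \<le> 1"
  shows "diag_op d o\<^sub>L diag_op e = diag_op (\<lambda>i. d i * e i)"
proof (intro blinfun_eqI l2_eqI)
  fix f i
  have "0 \<le> d i * e i" "d i * e i \<le> 1" for i using assms by (auto intro: mult_le_one)
  then show "coord ((diag_op d o\<^sub>L diag_op e) f) i = coord (diag_op (\<lambda>i. d i * e i) f) i"
    by (simp add: coord_diag assms)
qed

text \<open>In the commuting case the fidelity is the Bhattacharyya coefficient of p and q: all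
  roots are taken entrywise on the diagonal.\<close>

lemma fidelity_diag:
  fixes p q :: "'i \<Rightarrow> real"
  assumes p: "\<And>i. 0 \<le> p i" "\<And>i. p i \<le> 1" "\<And>i. i \<notin> I \<Longrightarrow> p i = 0"
    and q: "\<And>i. 0 \<le> q i" "\<And>i. q i \<le> 1" "\<And>i. i \<notin> I \<Longrightarrow> q i = 0"
    and sum: "((\<lambda>i. sqrt (p i * q i)) has_sum s) UNIV"
  shows "fidelity I (diag p) (diag q) = s"
proof -
  define r t where "r i = sqrt (p i)" and "t i = sqrt (p i * q i)" for i
  have r: "0 \<le> r i" "r i \<le> 1" and t: "0 \<le> t i" "t i \<le> 1" for i
    using p q by (auto simp: r_def t_def mult_le_one)
  have rq: "0 \<le> r i * q i" "r i * q i \<le> 1" for i using r q by (auto intro: mult_le_one)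
  have "fidelity I (kern (diag_op p)) (kern (diag_op q)) = s"
  proof (rule fidelity_kern)
    show "supported I (kern (diag_op p))" "supported I (kern (diag_op q))"
      using p q by (auto simp: supported_def kern_diag_op diag_def)
    show "clinear (diag_op q)" "clinear (diag_op r)" "clinear (diag_op t)"
      using q r t by (auto intro: clinear_diag_op)
    show "pos (diag_op r)" "pos (diag_op t)" using r t by (auto intro: pos_diag_op)
    show "diag_op r o\<^sub>L diag_op r = diag_op p"
      using r p by (simp add: diag_op_compose) (simp add: r_def)
    show "diag_op t o\<^sub>L diag_op t = (diag_op r o\<^sub>L diag_op q) o\<^sub>L diag_op r"
      using r q t rq p by (simp add: diag_op_compose) (simp add: r_def t_def mult_ac)
    show "((\<lambda>i. Re (kern (diag_op t) i i)) has_sum s) UNIV"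
      using sum t by (simp add: kern_diag_op diag_def t_def)
  qed
  then show ?thesis using p q by (simp add: kern_diag_op)
qed

section \<open>The amplifier: overlaps, Kraus form and amplified purifications\<close>

subsection \<open>Amplifier coefficients\<close>

definition amp_coeff :: "real \<Rightarrow> nat \<Rightarrow> nat \<Rightarrow> real" where
  "amp_coeff \<tau> n a = (1 / cosh \<tau>) ^ (n + 1) * sqrt (real ((n + a) choose a)) * tanh \<tau> ^ a"

lemma amp_coeff_nonneg: "0 \<le> \<tau> \<Longrightarrow> 0 \<le> amp_coeff \<tau> n a"
  by (simp add: amp_coeff_def)

lemma amplifier_isometry_eq:
  "amplifier_isometry \<tau> (k, a) n = (if k = n + a then of_real (amp_coeff \<tau> n a) else 0)"
  by (simp add: amplifier_isometry_def amp_coeff_def)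

lemma negative_binomial_has_sum:
  fixes x :: real
  assumes "0 \<le> x" "x < 1"
  shows "((\<lambda>a. real ((n + a) choose a) * x ^ a) has_sum 1 / (1 - x) ^ (n + 1)) UNIV"
proof -
  have "(\<lambda>a. ((- real (n + 1)) gchoose a) * (- x) ^ a) sums (1 + - x) powr (- real (n + 1))"
    using assms by (intro gen_binomial_real) auto
  also have "(\<lambda>a. ((- real (n + 1)) gchoose a) * (- x) ^ a) = (\<lambda>a. real ((n + a) choose a) * x ^ a)"
  proof
    fix a
    have "((- real (n + 1)) gchoose a) = (-1) ^ a * real ((n + a) choose a)"
      by (subst gbinomial_minus) (simp add: binomial_gbinomial add_ac)
    moreover have "(- x) ^ a = (-1) ^ a * x ^ a" by (rule power_minus)
    moreover have "(-1::real) ^ a * (-1) ^ a = 1" by (simp flip: power_mult_distrib)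
    ultimately show "((- real (n + 1)) gchoose a) * (- x) ^ a = real ((n + a) choose a) * x ^ a"
      by (simp add: algebra_simps)
  qed
  also have "(1 + - x) powr (- real (n + 1)) = 1 / (1 - x) ^ (n + 1)"
    using assms unfolding powr_minus by (subst powr_realpow) (auto simp: inverse_eq_divide)
  finally show ?thesis
    using assms by (intro sums_nonneg_imp_has_sum) auto
qed

text \<open>A negative binomial series in x = tanh \<tau> tanh \<tau>', where 1 - x = cosh(\<tau>' -
  \<tau>) / (cosh \<tau> cosh \<tau>'). The prefactors cancel all but the power of cosh(\<tau>' -
  \<tau>); this is where \<nu> comes from.\<close>

lemma amp_coeff_overlap:
  assumes "0 \<le> \<tau>" "0 \<le> \<tau>'"
  shows "((\<lambda>a. amp_coeff \<tau> n a * amp_coeff \<tau>' n a) has_sum (1 / cosh (\<tau>' - \<tau>)) ^ (n + 1)) UNIV"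
proof -
  define x where "x = tanh \<tau> * tanh \<tau>'"
  have t: "0 \<le> tanh \<tau>" "0 \<le> tanh \<tau>'" "tanh \<tau> < 1" "tanh \<tau>' < 1"
    using assms tanh_real_lt_1 by auto
  then have x: "0 \<le> x" by (simp add: x_def)
  have "x \<le> tanh \<tau> * 1" unfolding x_def using t by (intro mult_left_mono) auto
  then have x1: "x < 1" using t by linarith
  define c where "c = (1 / cosh \<tau> * (1 / cosh \<tau>')) ^ (n + 1)"
  have cosh: "cosh \<tau> \<noteq> 0" "cosh \<tau>' \<noteq> 0" by simp_all
  have "1 - x = cosh (\<tau>' - \<tau>) / (cosh \<tau> * cosh \<tau>')"
    using cosh by (simp add: x_def tanh_def cosh_diff field_simps)
  then have "c * (1 / (1 - x) ^ (n + 1)) = (1 / cosh (\<tau>' - \<tau>)) ^ (n + 1)"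
    using cosh by (simp add: c_def power_divide power_mult_distrib)
  moreover have "amp_coeff \<tau> n a * amp_coeff \<tau>' n a = c * (real ((n + a) choose a) * x ^ a)" for a
  proof -
    define b where "b = real ((n + a) choose a)"
    have "amp_coeff \<tau> n a * amp_coeff \<tau>' n a = c * ((sqrt b * sqrt b) * x ^ a)"
      by (simp only: amp_coeff_def b_def[symmetric] c_def x_def power_mult_distrib mult_ac)
    also have "sqrt b * sqrt b = b" by (simp add: b_def)
    finally show ?thesis by (simp add: b_def)
  qed
  ultimately show ?thesis
    using has_sum_cmult_right[OF negative_binomial_has_sum[OF x x1, of n], of c] by simp
qed

definition mode_coeff :: "real \<Rightarrow> ('m::finite \<Rightarrow> nat) \<Rightarrow> ('m \<Rightarrow> nat) \<Rightarrow> real" where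
  "mode_coeff \<tau> n a = (\<Prod>m\<in>UNIV. amp_coeff \<tau> (n m) (a m))"

lemma mode_coeff_nonneg: "0 \<le> \<tau> \<Longrightarrow> 0 \<le> mode_coeff \<tau> n a"
  by (simp add: mode_coeff_def prod_nonneg amp_coeff_nonneg)

lemma mode_coeff_overlap:
  fixes n :: "'m::finite \<Rightarrow> nat"
  assumes "0 \<le> \<tau>" "0 \<le> \<tau>'"
  shows "((\<lambda>a. mode_coeff \<tau> n a * mode_coeff \<tau>' n a) has_sum
    (1 / cosh (\<tau>' - \<tau>)) ^ (CARD('m) + (\<Sum>m\<in>UNIV. n m))) UNIV"
proof -
  define f where "f m a = amp_coeff \<tau> (n m) a * amp_coeff \<tau>' (n m) a" for m a
  define \<nu> where "\<nu> = 1 / cosh (\<tau>' - \<tau>)"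
  have f: "(f m has_sum \<nu> ^ (n m + 1)) UNIV" for m
    unfolding f_def \<nu>_def by (rule amp_coeff_overlap[OF assms])
  have "(\<Sum>\<^sub>\<infinity>a\<in>Pi\<^sub>E UNIV (\<lambda>_. UNIV). \<Prod>m\<in>UNIV. f m (a m)) = (\<Prod>m\<in>UNIV. \<Sum>\<^sub>\<infinity>a. f m a)"
  proof (rule infsum_prod_PiE_abs)
    fix m
    have "norm (f m a) = f m a" for a by (simp add: f_def amp_coeff_nonneg assms)
    then show "(\<lambda>a. norm (f m a)) summable_on UNIV" using has_sum_imp_summable[OF f] by simp
  qed simp
  also have "\<dots> = \<nu> ^ (CARD('m) + (\<Sum>m\<in>UNIV. n m))"
    using infsumI[OF f] by (simp add: power_add prod.distrib power_sum)
  also have "(\<lambda>a. \<Prod>m\<in>UNIV. f m (a m)) = (\<lambda>a. mode_coeff \<tau> n a * mode_coeff \<tau>' n a)"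
    by (simp add: f_def mode_coeff_def prod.distrib)
  also have "Pi\<^sub>E UNIV (\<lambda>_. UNIV) = (UNIV :: ('m \<Rightarrow> nat) set)" by (auto simp: PiE_def)
  finally have eq: "(\<Sum>\<^sub>\<infinity>a. mode_coeff \<tau> n a * mode_coeff \<tau>' n a) = \<nu> ^ (CARD('m) + (\<Sum>m\<in>UNIV. n m))" .
  \<comment> \<open>A nonzero value of the infinite sum witnesses summability.\<close>
  have "0 < \<nu>" by (simp add: \<nu>_def)
  then have "(\<Sum>\<^sub>\<infinity>a. mode_coeff \<tau> n a * mode_coeff \<tau>' n a) \<noteq> 0" unfolding eq by simp
  then have "(\<lambda>a. mode_coeff \<tau> n a * mode_coeff \<tau>' n a) summable_on UNIV" using infsum_not_exists by blast
  then show ?thesis using eq by (simp add: has_sum_iff \<nu>_def)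
qed

lemma mode_coeff_square_has_sum:
  assumes "0 \<le> \<tau>" shows "((\<lambda>a. (mode_coeff \<tau> n a)\<^sup>2) has_sum 1) UNIV"
  using mode_coeff_overlap[OF assms assms, of n] by (simp add: power2_eq_square)

lemma mode_coeff_le_1:
  assumes "0 \<le> \<tau>" shows "mode_coeff \<tau> n a \<le> 1"
proof (rule power2_le_imp_le)
  show "(mode_coeff \<tau> n a)\<^sup>2 \<le> 1\<^sup>2"
    using finite_sum_le_has_sum[OF mode_coeff_square_has_sum[OF assms], of "{a}" n] by simp
qed simp

subsection \<open>Matrix elements of the channel output\<close>

lemma infsum_single:
  assumes "\<And>j. j \<noteq> i \<Longrightarrow> f j = 0" shows "infsum f UNIV = f i"
proof -
  have "infsum f UNIV = infsum f {i}" by (rule infsum_cong_neutral) (use assms in auto)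
  then show ?thesis by simp
qed

text \<open>Tracing out the environment forces both legs to the same environment number k - n = l -
  n'. The inequalities guard against truncated subtraction.\<close>

lemma amplifier_matrix_unit:
  "amplifier \<tau> (matrix_unit n n') k l =
    (if n \<le> k \<and> n' \<le> l \<and> k - n = l - n' then of_real (amp_coeff \<tau> n (k - n) * amp_coeff \<tau> n' (l - n')) else 0)"
proof -
  let ?V = "amplifier_isometry \<tau>"
  have VX: "comp_op UNIV ?V (matrix_unit n n') p j = (if j = n' then ?V p n else 0)" for p j
    unfolding comp_op_def by (subst infsum_single[of n]) (auto simp: matrix_unit_def)
  have VXV: "comp_op UNIV (comp_op UNIV ?V (matrix_unit n n')) (adj_op ?V) p q = ?V p n * cnj (?V q n')" for p q
    unfolding comp_op_def[of _ "comp_op UNIV ?V (matrix_unit n n')"] VX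
    by (subst infsum_single[of n']) (auto simp: adj_op_def)
  have "amplifier \<tau> (matrix_unit n n') k l = (\<Sum>\<^sub>\<infinity>e. ?V (k, e) n * cnj (?V (l, e) n'))"
    by (simp add: amplifier_def trace_env_def VXV)
  also have "\<dots> = ?V (k, k - n) n * cnj (?V (l, k - n) n')"
    by (rule infsum_single) (auto simp: amplifier_isometry_eq)
  finally show ?thesis by (auto simp: amplifier_isometry_eq)
qed

definition fdiff :: "('m \<Rightarrow> nat) \<Rightarrow> ('m \<Rightarrow> nat) \<Rightarrow> 'm \<Rightarrow> nat" where
  "fdiff k a = (\<lambda>m. k m - a m)"

definition fplus :: "('m \<Rightarrow> nat) \<Rightarrow> ('m \<Rightarrow> nat) \<Rightarrow> 'm \<Rightarrow> nat" where
  "fplus k a = (\<lambda>m. k m + a m)"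

lemma fdiff_fplus [simp]: "fdiff (fplus n a) a = n"
  and le_fplus [simp]: "a \<le> fplus n a" "n \<le> fplus n a"
  and fplus_fdiff [simp]: "a \<le> k \<Longrightarrow> fplus (fdiff k a) a = k"
  by (auto simp: fdiff_def fplus_def le_fun_def)

lemma fdiff_eq_iff: "a \<le> k \<Longrightarrow> b \<le> k \<Longrightarrow> fdiff k a = fdiff k b \<longleftrightarrow> a = b"
  unfolding fdiff_def le_fun_def fun_eq_iff by (metis diff_diff_cancel)

lemma finite_le_fun: "finite {a. a \<le> (k :: 'm::finite \<Rightarrow> nat)}"
proof -
  have "{a. a \<le> k} \<subseteq> Pi\<^sub>E UNIV (\<lambda>m. {..k m})" by (auto simp: le_fun_def)
  moreover have "finite (Pi\<^sub>E UNIV (\<lambda>m. {..k m}))" by (intro finite_PiE) auto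
  ultimately show ?thesis by (rule finite_subset)
qed

text \<open>Only pairs (n, n') = (k - a, l - a) with a common environment occupation a contribute,
  so the double series collapses to a finite sum: the Kraus form of the channel.\<close>

lemma tensor_power_amplifier:
  fixes k l :: "'m::finite \<Rightarrow> nat"
  shows "tensor_power (amplifier \<tau>) X k l =
    (\<Sum>a | a \<le> k \<and> a \<le> l. of_real (mode_coeff \<tau> (fdiff k a) a * mode_coeff \<tau> (fdiff l a) a) * X (fdiff k a) (fdiff l a))"
proof -
  let ?D = "{a. a \<le> k \<and> a \<le> l}"
  let ?g = "\<lambda>a. (fdiff k a, fdiff l a)"
  let ?F = "\<lambda>(n, n'). X n n' * (\<Prod>m\<in>UNIV. amplifier \<tau> (matrix_unit (n m) (n' m)) (k m) (l m))"
  have fin: "finite ?D" by (rule finite_subset[OF _ finite_le_fun[of k]]) auto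
  have zero: "?F p = 0" if "p \<notin> ?g ` ?D" for p
  proof -
    obtain n n' where p: "p = (n, n')" by (cases p)
    have "\<exists>m. amplifier \<tau> (matrix_unit (n m) (n' m)) (k m) (l m) = 0"
    proof (rule ccontr)
      assume "\<not> ?thesis"
      then have *: "n m \<le> k m \<and> n' m \<le> l m \<and> k m - n m = l m - n' m" for m
        by (metis amplifier_matrix_unit)
      have "k m - n m \<le> k m \<and> k m - n m \<le> l m" "k m - (k m - n m) = n m" "l m - (k m - n m) = n' m" for m
        using *[of m] by auto
      then have "fdiff k n \<in> ?D" "p = ?g (fdiff k n)"
        by (simp_all add: fdiff_def le_fun_def p fun_eq_iff)
      with that show False by blast
    qed
    then have "(\<Prod>m\<in>UNIV. amplifier \<tau> (matrix_unit (n m) (n' m)) (k m) (l m)) = 0"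
      by (intro prod_zero) auto
    then show ?thesis by (simp add: p)
  qed
  have "tensor_power (amplifier \<tau>) X k l = infsum ?F (?g ` ?D)"
    unfolding tensor_power_def by (rule infsum_cong_neutral) (use zero in auto)
  also have "\<dots> = infsum (?F \<circ> ?g) ?D"
    by (rule infsum_reindex) (auto simp: inj_on_def fdiff_eq_iff)
  also have "\<dots> = (\<Sum>a\<in>?D. (?F \<circ> ?g) a)" using fin by (rule infsum_finite)
  also have "\<dots> = (\<Sum>a\<in>?D. of_real (mode_coeff \<tau> (fdiff k a) a * mode_coeff \<tau> (fdiff l a) a) * X (fdiff k a) (fdiff l a))"
  proof (rule sum.cong)
    fix a assume a: "a \<in> ?D"
    have "amplifier \<tau> (matrix_unit (fdiff k a m) (fdiff l a m)) (k m) (l m)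
        = of_real (amp_coeff \<tau> (fdiff k a m) (a m)) * of_real (amp_coeff \<tau> (fdiff l a m) (a m))" for m
      using a by (auto simp: amplifier_matrix_unit fdiff_def le_fun_def)
    then show "(?F \<circ> ?g) a = of_real (mode_coeff \<tau> (fdiff k a) a * mode_coeff \<tau> (fdiff l a) a) * X (fdiff k a) (fdiff l a)"
      by (simp add: mode_coeff_def prod.distrib mult.commute)
  qed simp
  finally show ?thesis .
qed

lemma has_sum_shift:
  fixes g :: "'a \<times> ('m \<Rightarrow> nat) \<Rightarrow> 'b::{comm_monoid_add, topological_space}"
  shows "((\<lambda>(\<alpha>, k). if a \<le> k then g (\<alpha>, fdiff k a) else 0) has_sum s) UNIV \<longleftrightarrow> (g has_sum s) UNIV"
proof -
  let ?h = "\<lambda>(\<alpha> :: 'a, n). (\<alpha>, fplus n a)"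
  let ?f = "\<lambda>(\<alpha>, k). if a \<le> k then g (\<alpha>, fdiff k a) else 0"
  have inj: "inj ?h" by (auto simp: inj_on_def fplus_def fun_eq_iff)
  have "p \<in> range ?h" if "?f p \<noteq> 0" for p
    using that by (cases p) (auto intro!: rev_image_eqI[of "(fst p, fdiff (snd p) a)"] split: if_splits)
  then have "(?f has_sum s) UNIV \<longleftrightarrow> (?f has_sum s) (range ?h)"
    by (intro has_sum_cong_neutral) auto
  also have "\<dots> \<longleftrightarrow> (?f \<circ> ?h has_sum s) UNIV" by (rule has_sum_reindex[OF inj])
  also have "?f \<circ> ?h = g" by (auto simp: fun_eq_iff)
  finally show ?thesis .
qed

subsection \<open>Kraus vectors\<close>

text \<open>The Kraus operator sends |n> to a multiple of |n + a> and leaves the ancilla alone; it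
  is written here at the output k = n + a.\<close>

definition kraus :: "real \<Rightarrow> ('m::finite \<Rightarrow> nat) \<Rightarrow> ('a \<times> ('m \<Rightarrow> nat)) l2 \<Rightarrow> ('a \<times> ('m \<Rightarrow> nat)) l2" where
  "kraus \<tau> a u = Abs_l2 (\<lambda>(\<alpha>, k). if a \<le> k then of_real (mode_coeff \<tau> (fdiff k a) a) * coord u (\<alpha>, fdiff k a) else 0)"

lemma coord_kraus:
  assumes "0 \<le> \<tau>"
  shows "coord (kraus \<tau> a u) (\<alpha>, k) =
    (if a \<le> k then of_real (mode_coeff \<tau> (fdiff k a) a) * coord u (\<alpha>, fdiff k a) else 0)"
proof -
  let ?g = "\<lambda>(\<alpha>, n). of_real (mode_coeff \<tau> n a) * coord u (\<alpha>, n)"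
  have "?g \<in> ell2 UNIV"
    using mode_coeff_nonneg[OF assms, of _ a] mode_coeff_le_1[OF assms, of _ a]
    by (intro ell2_comparison[OF coord_in_ell2[of u], where C = 1])
      (auto simp: norm_mult mult_left_le_one_le)
  then obtain s where "((\<lambda>p. (cmod (?g p))\<^sup>2) has_sum s) UNIV" by (auto simp: ell2_def summable_on_def)
  then have "((\<lambda>(\<alpha>, k). if a \<le> k then (cmod (?g (\<alpha>, fdiff k a)))\<^sup>2 else 0) has_sum s) UNIV"
    using has_sum_shift[where g = "\<lambda>p. (cmod (?g p))\<^sup>2"] by blast
  then have "(\<lambda>(\<alpha>, k). if a \<le> k then (cmod (?g (\<alpha>, fdiff k a)))\<^sup>2 else 0) summable_on UNIV"
    by (rule has_sum_imp_summable)
  then have "(\<lambda>(\<alpha>, k). if a \<le> k then of_real (mode_coeff \<tau> (fdiff k a) a) * coord u (\<alpha>, fdiff k a) else 0) \<in> ell2 UNIV"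
    unfolding ell2_def mem_Collect_eq
    by (rule summable_on_cong[THEN iffD1, rotated]) auto
  then show ?thesis by (simp add: kraus_def)
qed

lemma inner_of_real_mult: "inner (of_real c * z) (of_real d * z) = c * d * (cmod z)\<^sup>2"
  by (simp add: inner_complex_def cmod_power2) (simp add: power2_eq_square algebra_simps)

text \<open>Each output k has the single preimage k - a, so the adjoint of one Kraus operator times
  the other is diagonal in the Fock basis. Hence only the moduli of the coordinates of u enter,
  never their phases.\<close>

lemma inner_kraus_has_sum:
  assumes "0 \<le> \<tau>" "0 \<le> \<tau>'"
  shows "((\<lambda>p. mode_coeff \<tau> (snd p) a * mode_coeff \<tau>' (snd p) a * (cmod (coord u p))\<^sup>2)
    has_sum inner (kraus \<tau> a u) (kraus \<tau>' a u)) UNIV"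
proof -
  have "((\<lambda>(\<alpha>, k). if a \<le> k then (\<lambda>p. mode_coeff \<tau> (snd p) a * mode_coeff \<tau>' (snd p) a * (cmod (coord u p))\<^sup>2) (\<alpha>, fdiff k a) else 0)
      has_sum inner (kraus \<tau> a u) (kraus \<tau>' a u)) UNIV"
    by (rule has_sum_cong[THEN iffD1, rotated, OF inner_l2_has_sum])
      (auto simp: coord_kraus[OF assms(1)] coord_kraus[OF assms(2)] inner_of_real_mult)
  then show ?thesis by (rule has_sum_shift[THEN iffD1])
qed

lemma has_sum_tonelli:
  fixes g :: "'p \<Rightarrow> 'e \<Rightarrow> real"
  assumes "\<And>p e. 0 \<le> g p e" "\<And>p. (g p has_sum G p) UNIV" "(G has_sum s) UNIV"
    and "\<And>e. ((\<lambda>p. g p e) has_sum f e) UNIV"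
  shows "(f has_sum s) UNIV"
proof -
  have "((\<lambda>(p, e). g p e) has_sum s) (UNIV \<times> UNIV)"
    by (rule has_sum_SigmaI[OF _ assms(3)], use assms(2) in simp, rule summable_on_SigmaI[where g = G])
      (use assms in \<open>auto simp: has_sum_imp_summable\<close>)
  then have "((\<lambda>(e, p). g p e) has_sum s) (UNIV \<times> UNIV)"
    by (subst has_sum_swap) simp
  then show ?thesis by (rule has_sum_SigmaD) (use assms(4) in simp)
qed

lemma has_sum_product:
  fixes f :: "'x \<Rightarrow> real" and g :: "'y \<Rightarrow> real"
  assumes "(f has_sum s) UNIV" "(g has_sum t) UNIV" "\<And>x. 0 \<le> f x" "\<And>y. 0 \<le> g y"
  shows "((\<lambda>(x, y). f x * g y) has_sum s * t) UNIV"
proof -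
  have inner: "((\<lambda>y. case (x, y) of (x, y) \<Rightarrow> f x * g y) has_sum f x * t) UNIV" for x
    using has_sum_cmult_right[OF assms(2), of "f x"] by simp
  have outer: "((\<lambda>x. f x * t) has_sum s * t) UNIV" by (rule has_sum_cmult_left[OF assms(1)])
  show ?thesis
    unfolding UNIV_Times_UNIV[symmetric]
    by (rule has_sum_SigmaI[OF inner outer], rule summable_on_SigmaI[OF inner])
      (use assms outer in \<open>auto simp: has_sum_imp_summable\<close>)
qed

locale purified =
  fixes R :: "('a \<times> ('m::finite \<Rightarrow> nat)) l2 \<Rightarrow>\<^sub>L ('a \<times> ('m \<Rightarrow> nat)) l2"
    and J :: "'a set" and \<rho> :: "('a \<times> ('m \<Rightarrow> nat), 'a \<times> ('m \<Rightarrow> nat)) kernel"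
  assumes R: "pos R" "clinear R" "kern (R o\<^sub>L R) = \<rho>"
    and supp: "supported (J \<times> UNIV) \<rho>"
    and trace: "((\<lambda>p. Re (\<rho> p p)) has_sum 1) UNIV"
begin

text \<open>
  The vectors \<open>K\<^sub>a \<surd>\<rho> |x\<rangle>\<close>, with \<open>K\<^sub>a\<close> the Kraus operator for \<open>a\<close> environment photons: together they
  form the amplified purification of \<open>\<rho>\<close>, and tracing out the index \<open>(x, a)\<close> gives the output state.
\<close>

definition krausvec :: "real \<Rightarrow> ('a \<times> ('m \<Rightarrow> nat)) \<times> ('m \<Rightarrow> nat) \<Rightarrow> ('a \<times> ('m \<Rightarrow> nat)) l2" where
  "krausvec \<tau> e = kraus \<tau> (snd e) (R (unit (fst e)))"

lemma rho_has_sum: "((\<lambda>x. kern R p x * cnj (kern R q x)) has_sum \<rho> p q) UNIV"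
proof -
  have "coord (R (R (unit q))) p = \<rho> p q" using fun_cong[OF fun_cong[OF R(3), of p], of q] by (simp add: kern_def)
  then show ?thesis
    using coord_apply_has_sum[OF R(2), of p "R (unit q)"]
      kern_hermitian[OF R(2) pos_selfadjoint[OF R(1)], of q]
    by (simp flip: kern_def)
qed

lemma rho_diag_has_sum: "((\<lambda>x. (cmod (kern R p x))\<^sup>2) has_sum Re (\<rho> p p)) UNIV"
  using has_sum_Re[OF rho_has_sum[of p p]] by (simp add: cmod_power2 flip: power2_eq_square)

lemma rho_diag_nonneg: "0 \<le> Re (\<rho> p p)"
  using rho_diag_has_sum by (rule has_sum_nonneg) simp

text \<open>Summing over x restores the diagonal of \<rho>, summing over a gives
  \<open>mode_coeff_overlap\<close>; non-negativity allows the exchange of summations.\<close>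

lemma overlap_has_sum:
  assumes "0 \<le> \<tau>" "0 \<le> \<tau>'"
    and s: "((\<lambda>p. Re (\<rho> p p) * (1 / cosh (\<tau>' - \<tau>)) ^ (CARD('m) + (\<Sum>m\<in>UNIV. snd p m))) has_sum s) UNIV"
  shows "((\<lambda>e. inner (krausvec \<tau> e) (krausvec \<tau>' e)) has_sum s) UNIV"
proof (rule has_sum_tonelli[OF _ _ s])
  let ?g = "\<lambda>p e. (cmod (kern R p (fst e)))\<^sup>2 * (mode_coeff \<tau> (snd p) (snd e) * mode_coeff \<tau>' (snd p) (snd e))"
  fix p e
  show "0 \<le> ?g p e" by (simp add: mode_coeff_nonneg assms)
  show "(?g p has_sum Re (\<rho> p p) * (1 / cosh (\<tau>' - \<tau>)) ^ (CARD('m) + (\<Sum>m\<in>UNIV. snd p m))) UNIV"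
    using has_sum_product[OF rho_diag_has_sum[of p] mode_coeff_overlap[OF assms(1,2), of "snd p"]]
    by (simp add: mode_coeff_nonneg assms case_prod_unfold)
  show "((\<lambda>p. ?g p e) has_sum inner (krausvec \<tau> e) (krausvec \<tau>' e)) UNIV"
    using inner_kraus_has_sum[OF assms(1,2), of "snd e" "R (unit (fst e))"]
    by (simp add: krausvec_def kern_def mult.commute)
qed

text \<open>Trace preservation, as the case \<tau>' = \<tau> of the overlap: there the base 1 / cosh
  0 of the weight is 1.\<close>

lemma unit_mixture_krausvec:
  assumes "0 \<le> \<tau>" shows "unit_mixture (krausvec \<tau>)"
  using overlap_has_sum[OF assms assms, of 1] trace
  by unfold_locales (simp add: power2_norm_eq_inner)

lemma kern_mixture_krausvec:
  assumes "0 \<le> \<tau>"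
  shows "kern (mixture (krausvec \<tau>)) = id_tensor J (tensor_power (amplifier \<tau>)) \<rho>"
proof (intro ext)
  fix p q :: "'a \<times> ('m \<Rightarrow> nat)"
  obtain \<alpha> k \<beta> l where p: "p = (\<alpha>, k)" and q: "q = (\<beta>, l)" by (cases p, cases q)
  interpret unit_mixture "krausvec \<tau>" by (rule unit_mixture_krausvec[OF assms])
  define c where "c a = (complex_of_real (mode_coeff \<tau> (fdiff k a) a * mode_coeff \<tau> (fdiff l a) a))" for a
  define h where "h a = (if a \<le> k \<and> a \<le> l then c a * \<rho> (\<alpha>, fdiff k a) (\<beta>, fdiff l a) else 0)" for a
  have "((\<lambda>(x, a). coord (krausvec \<tau> (x, a)) p * cnj (coord (krausvec \<tau> (x, a)) q))
      has_sum kern (mixture (krausvec \<tau>)) p q) (UNIV \<times> UNIV)"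
    using mixture_kern_has_sum[of p q] by (simp add: case_prod_unfold)
  then have "((\<lambda>(a, x). coord (krausvec \<tau> (x, a)) p * cnj (coord (krausvec \<tau> (x, a)) q))
      has_sum kern (mixture (krausvec \<tau>)) p q) (UNIV \<times> UNIV)"
    by (subst has_sum_swap) simp
  then have "(h has_sum kern (mixture (krausvec \<tau>)) p q) UNIV"
  proof (rule has_sum_SigmaD)
    fix a
    have "((\<lambda>x. c a * (kern R (\<alpha>, fdiff k a) x * cnj (kern R (\<beta>, fdiff l a) x)))
        has_sum c a * \<rho> (\<alpha>, fdiff k a) (\<beta>, fdiff l a)) UNIV"
      by (intro has_sum_cmult_right rho_has_sum)
    then show "((\<lambda>x. case (a, x) of (a, x) \<Rightarrow> coord (krausvec \<tau> (x, a)) p * cnj (coord (krausvec \<tau> (x, a)) q))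
        has_sum h a) UNIV"
      by (cases "a \<le> k \<and> a \<le> l")
        (auto simp: h_def c_def krausvec_def p q coord_kraus[OF assms] kern_def mult_ac)
  qed
  moreover have "(h has_sum (\<Sum>a | a \<le> k \<and> a \<le> l. h a)) UNIV"
  proof (rule has_sum_finite_neutralI)
    show "finite {a. a \<le> k \<and> a \<le> l}" by (rule finite_subset[OF _ finite_le_fun[of k]]) auto
  qed (auto simp: h_def)
  ultimately have "kern (mixture (krausvec \<tau>)) p q = (\<Sum>a | a \<le> k \<and> a \<le> l. h a)"
    by (rule has_sum_unique)
  also have "\<dots> = tensor_power (amplifier \<tau>) (\<lambda>n n'. \<rho> (\<alpha>, n) (\<beta>, n')) k l"
    by (simp add: tensor_power_amplifier h_def c_def)
  \<comment> \<open>Outside J, where \<open>id_tensor\<close> is cut to 0, the blocks of \<rho>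
    vanish as well.\<close>
  also have "\<dots> = id_tensor J (tensor_power (amplifier \<tau>)) \<rho> p q"
    using supp by (auto simp: id_tensor_def p q tensor_power_amplifier supported_def)
  finally show "kern (mixture (krausvec \<tau>)) p q = id_tensor J (tensor_power (amplifier \<tau>)) \<rho> p q" .
qed

lemma output_fidelity_ge:
  assumes "0 \<le> \<tau>" "0 \<le> \<tau>'"
    and s: "((\<lambda>p. Re (\<rho> p p) * (1 / cosh (\<tau>' - \<tau>)) ^ (CARD('m) + (\<Sum>m\<in>UNIV. snd p m))) has_sum s) UNIV"
  shows "s \<le> output_fidelity (tensor_power (amplifier \<tau>)) (tensor_power (amplifier \<tau>')) (J, \<rho>)"
proof (rule has_sum_le_finite_sums[OF overlap_has_sum[OF assms]])
  fix E :: "(('a \<times> ('m \<Rightarrow> nat)) \<times> ('m \<Rightarrow> nat)) set" assume "finite E"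
  have supp: "supported (J \<times> UNIV) (id_tensor J (tensor_power (amplifier t)) \<rho>)" for t
    by (auto simp: supported_def id_tensor_def)
  show "(\<Sum>e\<in>E. inner (krausvec \<tau> e) (krausvec \<tau>' e))
      \<le> output_fidelity (tensor_power (amplifier \<tau>)) (tensor_power (amplifier \<tau>')) (J, \<rho>)"
    using fidelity_mixture_ge[OF unit_mixture_krausvec[OF assms(1)] unit_mixture_krausvec[OF assms(2)] _ _ \<open>finite E\<close>,
        of "J \<times> UNIV"] supp
    by (simp add: kern_mixture_krausvec[OF assms(1)] kern_mixture_krausvec[OF assms(2)] output_fidelity_def)
qed

end

section \<open>Convexity bound, optimal probe and the Bures distance\<close>

subsection \<open>The minimum\<close>

abbreviation photons :: "('m::finite \<Rightarrow> nat) \<Rightarrow> nat" where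
  "photons n \<equiv> \<Sum>m\<in>UNIV. n m"

text \<open>Discrete convexity: the line through the points at n and n + 1 stays below the sequence.
  To the right this is Bernoulli's inequality; to the left, with j = n - k, it becomes \<nu>^j (1 +
  j (1 - \<nu>)) \<le> 1, by induction.\<close>

lemma chord_le_power:
  fixes \<nu> :: real
  assumes "0 < \<nu>" "\<nu> \<le> 1"
  shows "\<nu> ^ n + (real k - real n) * (\<nu> ^ Suc n - \<nu> ^ n) \<le> \<nu> ^ k"
proof (cases "n \<le> k")
  case True
  then obtain j where j: "k = n + j" using le_Suc_ex by blast
  have "1 + real j * (\<nu> - 1) \<le> \<nu> ^ j" using Bernoulli_inequality[of "\<nu> - 1" j] assms by simp
  then have "\<nu> ^ n * (1 + real j * (\<nu> - 1)) \<le> \<nu> ^ n * \<nu> ^ j" using assms by (intro mult_left_mono) auto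
  then show ?thesis by (simp add: j power_add algebra_simps)
next
  case False
  then obtain j where j: "n = k + j" using le_Suc_ex nat_le_linear by blast
  have "\<nu> ^ j * (1 + real j * (1 - \<nu>)) \<le> 1" for j
  proof (induction j)
    case (Suc j)
    have "\<nu> * (1 + real (Suc j) * (1 - \<nu>)) \<le> 1 + real j * (1 - \<nu>)"
    proof -
      have "1 + real j * (1 - \<nu>) - \<nu> * (1 + real (Suc j) * (1 - \<nu>)) = (1 - \<nu>) * (1 - \<nu>) * (real j + 1)"
        by (simp add: algebra_simps)
      moreover have "0 \<le> (1 - \<nu>) * (1 - \<nu>) * (real j + 1)" using assms by simp
      ultimately show ?thesis by linarith
    qed
    then have "\<nu> ^ j * (\<nu> * (1 + real (Suc j) * (1 - \<nu>))) \<le> \<nu> ^ j * (1 + real j * (1 - \<nu>))"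
      using assms by (intro mult_left_mono) auto
    then show ?case using Suc by (simp add: mult_ac)
  qed simp
  from this[of j] have "\<nu> ^ k * (\<nu> ^ j * (1 + real j * (1 - \<nu>))) \<le> \<nu> ^ k * 1"
    using assms by (intro mult_left_mono) auto
  then show ?thesis by (simp add: j power_add algebra_simps)
qed

text \<open>The two sides use the ceiling and the successor of the floor. These differ only at
  integers, where the weight of that term is 0.\<close>

lemma interpolation_eq_chord:
  fixes N \<nu> :: real
  assumes "0 \<le> N"
  shows "(1 - frac N) * \<nu> ^ nat \<lfloor>N\<rfloor> + frac N * \<nu> ^ nat \<lceil>N\<rceil>
    = \<nu> ^ nat \<lfloor>N\<rfloor> + (N - real (nat \<lfloor>N\<rfloor>)) * (\<nu> ^ Suc (nat \<lfloor>N\<rfloor>) - \<nu> ^ nat \<lfloor>N\<rfloor>)"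
proof -
  have fr: "frac N = N - real (nat \<lfloor>N\<rfloor>)" using assms by (simp add: frac_def)
  show ?thesis
  proof (cases "frac N = 0")
    case True
    then show ?thesis unfolding fr[symmetric] True by simp
  next
    case False
    then have "N \<notin> \<int>" by simp
    then have "\<lceil>N\<rceil> = \<lfloor>N\<rfloor> + 1" by (simp add: ceiling_altdef frac_eq_0_iff[symmetric] frac_def)
    then have "nat \<lceil>N\<rceil> = Suc (nat \<lfloor>N\<rfloor>)" using assms by (simp add: nat_add_distrib)
    then show ?thesis unfolding fr by (simp add: algebra_simps)
  qed
qed

lemma mean_photon_number_diag:
  fixes \<rho> :: "('a \<times> ('m::finite \<Rightarrow> nat), 'a \<times> ('m \<Rightarrow> nat)) kernel"
  assumes "supported (J \<times> UNIV) \<rho>"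
  shows "comp_op (J \<times> UNIV) \<rho> (tensor_op (id_op J) number_op) p p = \<rho> p p * of_nat (photons (snd p))"
proof -
  let ?f = "\<lambda>q. \<rho> p q * tensor_op (id_op J) number_op q p"
  have "?f q = 0" if "q \<noteq> p" for q
    using that by (cases q, cases p) (auto simp: tensor_op_def id_op_def number_op_eq)
  note zero = this
  have "infsum ?f (J \<times> UNIV) = \<rho> p p * of_nat (photons (snd p))"
  proof (cases "p \<in> J \<times> UNIV")
    case True
    then have "infsum ?f (J \<times> UNIV) = infsum ?f {p}"
      by (intro infsum_cong_neutral) (auto simp: zero)
    then show ?thesis using True by (auto simp: tensor_op_def id_op_def number_op_eq)
  next
    case False
    then have "\<rho> p q = 0" for q using assms unfolding supported_def by blast
    then show ?thesis by simp
  qed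
  then show ?thesis by (simp add: comp_op_def)
qed

lemma output_fidelity_lower_bound:
  fixes P :: "'a::infinite set \<times> ('a \<times> ('m::finite \<Rightarrow> nat), 'a \<times> ('m \<Rightarrow> nat)) kernel"
  assumes "0 \<le> N" "0 \<le> \<tau>" "0 \<le> \<tau>'" and P: "P \<in> probes N"
  defines "\<nu> \<equiv> 1 / cosh (\<tau>' - \<tau>)"
  shows "\<nu> ^ CARD('m) * ((1 - frac N) * \<nu> ^ nat \<lfloor>N\<rfloor> + frac N * \<nu> ^ nat \<lceil>N\<rceil>)
    \<le> output_fidelity (tensor_power (amplifier \<tau>)) (tensor_power (amplifier \<tau>')) P"
proof -
  obtain J \<rho> where JP: "P = (J, \<rho>)" by (cases P)
  have dens: "density_op (J \<times> UNIV) \<rho>" and mean: "mean_photon_number_is J \<rho> N"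
    using P by (auto simp: probes_def JP)
  obtain L where L: "clinear L" "kern L = \<rho>" "supported (J \<times> UNIV) \<rho>" "pos L"
    using dens positive_op_obtain unfolding density_op_def by blast
  obtain R where R: "pos R" "clinear R" "R o\<^sub>L R = L" using clinear_sqrt_exists[OF L(4,1)] .
  define d where "d p = Re (\<rho> p p)" for p
  have extend: "(f has_sum s) UNIV" if "(f has_sum s) (J \<times> UNIV)" "\<And>p. p \<notin> J \<times> UNIV \<Longrightarrow> f p = 0"
    for f :: "'a \<times> ('m \<Rightarrow> nat) \<Rightarrow> real" and s
    by (rule has_sum_cong_neutral[THEN iffD1, rotated -1, OF that(1)]) (use that(2) in auto)
  have d0: "d p = 0" if "p \<notin> J \<times> UNIV" for p
  proof -
    have "\<rho> p p = 0" using L(3) that unfolding supported_def by blast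
    then show ?thesis by (simp add: d_def)
  qed
  have trace_d: "(d has_sum 1) UNIV"
  proof (rule extend)
    have "((\<lambda>p. \<rho> p p) has_sum 1) (J \<times> UNIV)" using dens by (simp add: density_op_def)
    from has_sum_Re[OF this] show "(d has_sum 1) (J \<times> UNIV)"
      unfolding d_def[abs_def] by simp
  qed (rule d0)
  have energy: "((\<lambda>p. d p * real (photons (snd p))) has_sum N) UNIV"
  proof (rule extend)
    have "((\<lambda>p. \<rho> p p * of_nat (photons (snd p))) has_sum of_real N) (J \<times> UNIV)"
      using mean unfolding mean_photon_number_is_def mean_photon_number_diag[OF L(3)] .
    from has_sum_Re[OF this] show "((\<lambda>p. d p * real (photons (snd p))) has_sum N) (J \<times> UNIV)"
      by (simp add: d_def)
  qed (simp add: d0)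
  interpret purified R J \<rho>
    by unfold_locales (use R L trace_d[unfolded d_def[abs_def]] in simp_all)
  have d_nonneg: "0 \<le> d p" for p unfolding d_def by (rule rho_diag_nonneg)
  have \<nu>: "0 < \<nu>" "\<nu> \<le> 1" using cosh_real_ge_1[of "\<tau>' - \<tau>"] by (auto simp: \<nu>_def)
  let ?g = "\<lambda>p. d p * \<nu> ^ (CARD('m) + photons (snd p))"
  have "?g summable_on UNIV"
  proof (rule summable_on_comparison_test[OF has_sum_imp_summable[OF trace_d]])
    fix p
    show "?g p \<le> d p" using d_nonneg[of p] \<nu> by (intro mult_left_le power_le_one) auto
    show "0 \<le> ?g p" using d_nonneg[of p] \<nu> by simp
  qed
  then obtain s where s: "(?g has_sum s) UNIV" by (auto simp: summable_on_def)
  define n where "n = nat \<lfloor>N\<rfloor>"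
  define \<delta> where "\<delta> = \<nu> ^ Suc n - \<nu> ^ n"
  \<comment> \<open>The chord is affine in the photon number, so its average depends only on the
    trace 1 and the mean energy N.\<close>
  have "((\<lambda>p. \<nu> ^ CARD('m) * ((\<nu> ^ n - real n * \<delta>) * d p + \<delta> * (d p * real (photons (snd p)))))
      has_sum \<nu> ^ CARD('m) * ((\<nu> ^ n - real n * \<delta>) * 1 + \<delta> * N)) UNIV"
    by (intro has_sum_cmult_right has_sum_add trace_d energy)
  then have "\<nu> ^ CARD('m) * ((\<nu> ^ n - real n * \<delta>) * 1 + \<delta> * N) \<le> s"
  proof (rule has_sum_mono[OF _ s])
    fix p
    have "d p * (\<nu> ^ n + (real (photons (snd p)) - real n) * \<delta>) \<le> d p * \<nu> ^ photons (snd p)"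
      unfolding \<delta>_def by (intro mult_left_mono chord_le_power \<nu> d_nonneg)
    then have "\<nu> ^ CARD('m) * (d p * (\<nu> ^ n + (real (photons (snd p)) - real n) * \<delta>))
        \<le> \<nu> ^ CARD('m) * (d p * \<nu> ^ photons (snd p))"
      by (rule mult_left_mono) (use \<nu> in simp)
    then show "\<nu> ^ CARD('m) * ((\<nu> ^ n - real n * \<delta>) * d p + \<delta> * (d p * real (photons (snd p)))) \<le> ?g p"
      by (simp add: power_add algebra_simps)
  qed
  moreover have "s \<le> output_fidelity (tensor_power (amplifier \<tau>)) (tensor_power (amplifier \<tau>')) P"
    unfolding JP by (rule output_fidelity_ge[OF assms(2,3)]) (use s in \<open>simp add: d_def \<nu>_def\<close>)
  ultimately show ?thesis
    unfolding interpolation_eq_chord[OF assms(1)]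
    unfolding n_def[symmetric] \<delta>_def[symmetric]
    by (simp add: algebra_simps)
qed

subsection \<open>An optimal probe\<close>

text \<open>Subtracting the same a is injective on occupations above a, so no off-diagonal entry can
  arise from a diagonal input.\<close>

lemma id_tensor_amplifier_diag:
  fixes d :: "'a \<times> ('m::finite \<Rightarrow> nat) \<Rightarrow> real"
  assumes "\<And>p. fst p \<notin> J \<Longrightarrow> d p = 0"
  shows "id_tensor J (tensor_power (amplifier \<tau>)) (diag d) =
    diag (\<lambda>(\<alpha>, k). \<Sum>a | a \<le> k. (mode_coeff \<tau> (fdiff k a) a)\<^sup>2 * d (\<alpha>, fdiff k a))"
proof (intro ext)
  fix p q :: "'a \<times> ('m \<Rightarrow> nat)"
  obtain \<alpha> k \<beta> l where p: "p = (\<alpha>, k)" and q: "q = (\<beta>, l)" by (cases p, cases q)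
  have "fdiff k a = fdiff l a \<longleftrightarrow> k = l" if "a \<le> k" "a \<le> l" for a
    using that by (metis fplus_fdiff)
  then show "id_tensor J (tensor_power (amplifier \<tau>)) (diag d) p q =
    diag (\<lambda>(\<alpha>, k). \<Sum>a | a \<le> k. (mode_coeff \<tau> (fdiff k a) a)\<^sup>2 * d (\<alpha>, fdiff k a)) p q"
    using assms by (auto simp: id_tensor_def p q tensor_power_amplifier diag_def power2_eq_square intro!: sum.neutral)
qed

lemma optimal_probe:
  fixes N \<tau> \<tau>' :: real
  assumes "0 \<le> N" "0 \<le> \<tau>" "0 \<le> \<tau>'"
  defines "\<nu> \<equiv> 1 / cosh (\<tau>' - \<tau>)"
  shows "\<exists>P \<in> (probes N :: ('a::infinite set \<times> ('a \<times> ('m::finite \<Rightarrow> nat), 'a \<times> ('m \<Rightarrow> nat)) kernel) set).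
    output_fidelity (tensor_power (amplifier \<tau>)) (tensor_power (amplifier \<tau>')) P
    = \<nu> ^ CARD('m) * ((1 - frac N) * \<nu> ^ nat \<lfloor>N\<rfloor> + frac N * \<nu> ^ nat \<lceil>N\<rceil>)"
proof -
  obtain \<alpha>0 \<alpha>1 :: 'a where \<alpha>: "\<alpha>0 \<noteq> \<alpha>1"
    using infinite_UNIV by (metis (full_types) UNIV_I ex_new_if_finite finite.emptyI finite.insertI insertCI)
  \<comment> \<open>Any mode will do, since only the total photon number matters.\<close>
  define m0 :: 'm where "m0 = undefined"
  define fock where "fock j = (\<lambda>m. if m = m0 then j else 0)" for j :: nat
  have photons_fock: "photons (fock j) = j" for j by (simp add: fock_def)
  define k0 k1 where "k0 = fock (nat \<lfloor>N\<rfloor>)" and "k1 = fock (nat \<lceil>N\<rceil>)"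
  define f where "f = frac N"
  have f: "0 \<le> f" "f \<le> 1" using frac_lt_1[of N] by (auto simp: f_def)
  define J where "J = {\<alpha>0, \<alpha>1}"
  \<comment> \<open>The weights 1 - f and f make the mean energy N; the flags keep the two entries
    distinct even when N is an integer and k0 = k1.\<close>
  define d where "d p = (if p = (\<alpha>0, k0) then 1 - f else if p = (\<alpha>1, k1) then f else 0)" for p
  have d: "0 \<le> d p" "d p \<le> 1" and dJ: "fst p \<notin> J \<Longrightarrow> d p = 0" for p
    using f by (auto simp: d_def J_def)
  have sum_d: "((\<lambda>p. h p * of_real (d p)) has_sum h (\<alpha>0, k0) * of_real (1 - f) + h (\<alpha>1, k1) * of_real f) (J \<times> UNIV)"
    for h :: "'a \<times> ('m \<Rightarrow> nat) \<Rightarrow> complex"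
    by (rule has_sum_finite_neutralI[where B = "{(\<alpha>0, k0), (\<alpha>1, k1)}"]) (use \<alpha> in \<open>auto simp: d_def J_def\<close>)
  have supp: "supported (J \<times> UNIV) (diag d)"
    using dJ by (auto simp: supported_def diag_def)
  have "density_op (J \<times> UNIV) (diag d)"
    unfolding density_op_def
  proof
    show "positive_op (J \<times> UNIV) (diag d)"
      using positive_op_kern[OF clinear_diag_op _ pos_diag_op, of d] d supp by (simp add: kern_diag_op)
    show "((\<lambda>i. diag d i i) has_sum 1) (J \<times> UNIV)"
      using sum_d[of "\<lambda>_. 1"] by (simp add: diag_def)
  qed
  moreover have "mean_photon_number_is J (diag d) N"
    unfolding mean_photon_number_is_def mean_photon_number_diag[OF supp]
  proof -
    have "real (nat \<lfloor>N\<rfloor>) * (1 - f) + real (nat \<lceil>N\<rceil>) * f = N"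
    proof (cases "f = 0")
      case True
      then show ?thesis using assms(1) by (simp add: f_def frac_def)
    next
      case False
      then have "\<lceil>N\<rceil> = \<lfloor>N\<rfloor> + 1" by (simp add: f_def ceiling_altdef frac_def)
      then show ?thesis using assms(1) by (simp add: f_def frac_def algebra_simps)
    qed
    from this[THEN arg_cong, of complex_of_real]
    show "((\<lambda>i. diag d i i * of_nat (photons (snd i))) has_sum of_real N) (J \<times> UNIV)"
      using sum_d[of "\<lambda>p. of_nat (photons (snd p))"]
      by (simp add: diag_def k0_def k1_def photons_fock mult.commute)
  qed
  ultimately have probe: "(J, diag d) \<in> probes N" by (simp add: probes_def J_def)
  \<comment> \<open>Diagonal of the output for input weight c on flag \<alpha> and Fock state n; the
    output k forces the environment occupation k - n.\<close>
  define out where "out t \<alpha> n c = (\<lambda>(\<beta>, k). if \<beta> = \<alpha> \<and> n \<le> k then (mode_coeff t n (fdiff k n))\<^sup>2 * c else 0)"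
    for t :: real and \<alpha> :: 'a and n :: "'m \<Rightarrow> nat" and c :: real
  define q where "q t p = out t \<alpha>0 k0 (1 - f) p + out t \<alpha>1 k1 f p" for t p
  have out_range: "0 \<le> out t \<alpha> n c p" "out t \<alpha> n c p \<le> 1" if "0 \<le> t" "0 \<le> c" "c \<le> 1" for t \<alpha> n c p
    using that mode_coeff_nonneg[of t] mode_coeff_le_1[of t]
    by (auto simp: out_def split: prod.splits intro!: mult_le_one power_le_one)
  \<comment> \<open>The flags survive the channel, so at every index at most one summand of q is
    non-zero, and the square root of the product splits additively.\<close>
  have out_disj: "out t \<alpha>0 k0 (1 - f) p = 0 \<or> out t' \<alpha>1 k1 f p = 0" for t t' p
    using \<alpha> by (auto simp: out_def split: prod.splits)
  have q_range: "0 \<le> q t p" "q t p \<le> 1" if "0 \<le> t" for t p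
    using out_range[OF that, of "1 - f" \<alpha>0 k0 p] out_range[OF that, of f \<alpha>1 k1 p] out_disj[of t p t] f
    by (auto simp: q_def)
  have q_zero: "q t p = 0" if "p \<notin> J \<times> UNIV" for t p
    using that by (cases p) (auto simp: q_def out_def J_def)
  have out_eq: "id_tensor J (tensor_power (amplifier t)) (diag d) = diag (q t)" for t
  proof (rule trans[OF id_tensor_amplifier_diag], rule dJ, assumption, rule arg_cong[where f = diag], rule ext)
    fix p :: "'a \<times> ('m \<Rightarrow> nat)"
    obtain \<beta> k where p: "p = (\<beta>, k)" by (cases p)
    have single: "(\<Sum>a | a \<le> k. (mode_coeff t (fdiff k a) a)\<^sup>2 * (if (\<beta>, fdiff k a) = (\<alpha>, n) then c else 0)) = out t \<alpha> n c p"
      for \<alpha> n c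
    proof (cases "\<beta> = \<alpha> \<and> n \<le> k")
      case True
      have inv: "fdiff k a = n \<longleftrightarrow> a = fdiff k n" if "a \<le> k" for a
        using that True by (auto simp: fdiff_def le_fun_def fun_eq_iff) (metis diff_diff_cancel)+
      have "(\<Sum>a | a \<le> k. (mode_coeff t (fdiff k a) a)\<^sup>2 * (if (\<beta>, fdiff k a) = (\<alpha>, n) then c else 0))
          = (\<Sum>a | a \<le> k. if a = fdiff k n then (mode_coeff t n a)\<^sup>2 * c else 0)"
        using True inv[of "fdiff k n"] by (intro sum.cong) (auto simp: inv fdiff_def le_fun_def)
      also have "\<dots> = (mode_coeff t n (fdiff k n))\<^sup>2 * c"
        by (simp add: finite_le_fun) (auto simp: fdiff_def le_fun_def)
      finally show ?thesis using True by (simp add: out_def p)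
    next
      case False
      then have zero: "(if (\<beta>, fdiff k a) = (\<alpha>, n) then c else 0) = 0" for a
        by (auto simp: fdiff_def le_fun_def)
      show ?thesis unfolding zero using False by (auto simp: out_def p)
    qed
    have "d x = (if x = (\<alpha>0, k0) then 1 - f else 0) + (if x = (\<alpha>1, k1) then f else 0)" for x
      using \<alpha> by (auto simp: d_def)
    then show "(case p of (\<alpha>, k) \<Rightarrow> \<Sum>a | a \<le> k. (mode_coeff t (fdiff k a) a)\<^sup>2 * d (\<alpha>, fdiff k a)) = q t p"
      using single by (simp add: p q_def distrib_left sum.distrib)
  qed
  have out_sum: "((\<lambda>p. sqrt (out \<tau> \<alpha> n c p * out \<tau>' \<alpha> n c p)) has_sum \<nu> ^ (CARD('m) + photons n) * c) UNIV"
    if "0 \<le> c" for \<alpha> n c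
  proof -
    let ?h = "\<lambda>a. (\<alpha>, fplus n a)"
    have inj: "inj ?h" by (auto simp: inj_on_def fplus_def fun_eq_iff)
    have plus_diff: "fdiff (fplus n a) n = a" for a by (simp add: fdiff_def fplus_def)
    have range: "p \<in> range ?h" if nz: "out \<tau> \<alpha> n c p \<noteq> 0" for p
    proof -
      obtain k where "p = (\<alpha>, k)" "n \<le> k" using nz by (cases p) (auto simp: out_def split: if_splits)
      then have "p = ?h (fdiff k n)" by (auto simp: fdiff_def fplus_def le_fun_def)
      then show ?thesis by blast
    qed
    have "((\<lambda>a. mode_coeff \<tau> n a * mode_coeff \<tau>' n a * c) has_sum \<nu> ^ (CARD('m) + photons n) * c) UNIV"
      unfolding \<nu>_def by (intro has_sum_cmult_left mode_coeff_overlap assms)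
    also have "(\<lambda>a. mode_coeff \<tau> n a * mode_coeff \<tau>' n a * c) = (\<lambda>p. sqrt (out \<tau> \<alpha> n c p * out \<tau>' \<alpha> n c p)) \<circ> ?h"
    proof
      fix a
      have "out \<tau> \<alpha> n c (?h a) * out \<tau>' \<alpha> n c (?h a) = (mode_coeff \<tau> n a * mode_coeff \<tau>' n a * c)\<^sup>2"
        by (simp add: out_def plus_diff power2_eq_square mult_ac)
      then show "mode_coeff \<tau> n a * mode_coeff \<tau>' n a * c = ((\<lambda>p. sqrt (out \<tau> \<alpha> n c p * out \<tau>' \<alpha> n c p)) \<circ> ?h) a"
        using that assms by (simp add: mode_coeff_nonneg)
    qed
    finally have "((\<lambda>p. sqrt (out \<tau> \<alpha> n c p * out \<tau>' \<alpha> n c p)) has_sum \<nu> ^ (CARD('m) + photons n) * c) (range ?h)"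
      by (subst has_sum_reindex[OF inj])
    then show ?thesis
      by (rule has_sum_cong_neutral[THEN iffD1, rotated -1]) (use range in auto)
  qed
  have "((\<lambda>p. sqrt (q \<tau> p * q \<tau>' p)) has_sum
      \<nu> ^ (CARD('m) + photons k0) * (1 - f) + \<nu> ^ (CARD('m) + photons k1) * f) UNIV"
  proof -
    have "sqrt (q \<tau> p * q \<tau>' p) = sqrt (out \<tau> \<alpha>0 k0 (1 - f) p * out \<tau>' \<alpha>0 k0 (1 - f) p)
        + sqrt (out \<tau> \<alpha>1 k1 f p * out \<tau>' \<alpha>1 k1 f p)" for p
      using \<alpha> by (auto simp: q_def out_def split: prod.splits)
    then show ?thesis using f by (simp only:) (intro has_sum_add out_sum; simp)
  qed
  then have "fidelity (J \<times> UNIV) (diag (q \<tau>)) (diag (q \<tau>'))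
      = \<nu> ^ (CARD('m) + photons k0) * (1 - f) + \<nu> ^ (CARD('m) + photons k1) * f"
    by (intro fidelity_diag q_range q_zero assms(2,3))
  then have "output_fidelity (tensor_power (amplifier \<tau>)) (tensor_power (amplifier \<tau>')) (J, diag d)
      = \<nu> ^ CARD('m) * ((1 - frac N) * \<nu> ^ nat \<lfloor>N\<rfloor> + frac N * \<nu> ^ nat \<lceil>N\<rceil>)"
    by (simp add: output_fidelity_def out_eq k0_def k1_def photons_fock f_def power_add algebra_simps)
  with probe show ?thesis by blast
qed

theorem mainTheorem10:
  fixes N \<tau> \<tau>' \<nu> Fmin :: real
    and A A' :: "('m::finite \<Rightarrow> nat, 'm \<Rightarrow> nat) kernel \<Rightarrow> ('m \<Rightarrow> nat, 'm \<Rightarrow> nat) kernel"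
    and S :: "('a::infinite set \<times> ('a \<times> ('m \<Rightarrow> nat), 'a \<times> ('m \<Rightarrow> nat)) kernel) set"
  assumes "0 \<le> N" and "0 \<le> \<tau>" and "0 \<le> \<tau>'"
  defines "\<nu> \<equiv> 1 / cosh (\<tau>' - \<tau>)"
    and "Fmin \<equiv> \<nu> ^ CARD('m) * ((1 - frac N) * \<nu> ^ nat \<lfloor>N\<rfloor> + frac N * \<nu> ^ nat \<lceil>N\<rceil>)"
    and "A \<equiv> tensor_power (amplifier \<tau>)"
    and "A' \<equiv> tensor_power (amplifier \<tau>')"
    and "S \<equiv> probes N"
  shows "Fmin \<in> output_fidelity A A' ` S
       \<and> (\<forall>P\<in>S. Fmin \<le> output_fidelity A A' P)
       \<and> ec_bures_distance TYPE('a) N A A' = sqrt (1 - Fmin)"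
proof (intro conjI)
  show attained: "Fmin \<in> output_fidelity A A' ` S"
    using optimal_probe[OF assms(1-3), where ?'a = 'a and ?'m = 'm]
    unfolding A_def A'_def S_def Fmin_def \<nu>_def by (metis image_eqI)
  show bound: "\<forall>P\<in>S. Fmin \<le> output_fidelity A A' P"
    unfolding A_def A'_def S_def Fmin_def \<nu>_def
    using output_fidelity_lower_bound[OF assms(1-3)] by blast
  \<comment> \<open>The map x \<mapsto> sqrt (1 - x) is decreasing, so the supremum is attained at
    the probe of minimal fidelity.\<close>
  show "ec_bures_distance TYPE('a) N A A' = sqrt (1 - Fmin)"
    unfolding ec_bures_distance_def S_def[symmetric]
    by (rule cSup_eq_maximum) (use attained bound in auto)
qed

end
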